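(* Let $\ell>0$, let $r$ be a vocal-tract radius in class $\mathcal{A}$ on $[0,\ell]$, and let $P(k,x)$ be the corresponding pressure. Then any one of the input data sets $$\mathcal{D}_1=\{P(k,\ell):k\in\mathbf{R}^+\},\qquad \mathcal{D}_2=\{|P(k,\ell)|:k\in\mathbf{R}^+;\ \{k_j^-\}_{j=1}^{N^-}\},$$ $$\mathcal{D}_3=\{\ell;\{k_j^-\}_{j=1}^{N^-};\{k_j^+\}_{j=1}^{N^+}\},\qquad \mathcal{D}_4=\{r_\ell;\{k_j^-\}_{j=1}^{N^-};\{k_j^+\}_{j=1}^{N^+}\},$$ $$\mathcal{D}_5=\{\ell;\ E(k):k\in\mathbf{C}\},\qquad \mathcal{D}_6=\{r_\ell;\ E(k):k\in\mathbf{C}\},$$ or any data set equivalent to one of these six, uniquely determines the radius function $r$. That is: if $(\ell,r)$ and $(\tilde\ell,\tilde r)$ are two such pairs for which the data sets $\mathcal{D}_j$ coincide for some $j\in\{1,\dots,6\}$ (or for which some data set equivalent to one of them coincides), then $r=\tilde r$ as functions (in particular with the same domain).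
   Context: Class $\mathcal{A}$: $r:[0,\ell]\to\mathbf{R}$ with $r(x)>0$ on $[0,\ell]$, $r'$ continuous on $[0,\ell]$ (and absolutely continuous), $r''$ integrable on $(0,\ell)$. Notation: prime is $d/dx$, $r_0=r(0)$, $r_\ell=r(\ell)$, $r_0'=r'(0)$, $r_\ell'=r'(\ell)$, $\mathbf{R}^+=(0,+\infty)$. The constants $c,\mu>0$ are fixed and known (the same for all $r$). Normalized impedance: $z(k)=1-\dfrac{J_1(2kr_\ell)}{kr_\ell}+i\,\dfrac{\mathbf{H}_1(2kr_\ell)}{kr_\ell}$, $k\in\mathbf{C}$ (value at $k=0$ by removing the singularity), $J_1$ the Bessel function and $\mathbf{H}_1$ the Struve function of order one. Pressure: $P(k,x)$ is the solution of $[r(x)^2P'(k,x)]'+k^2r(x)^2P(k,x)=0$, $x\in(0,\ell)$, with $P'(k,0)=-\dfrac{ikc\mu}{\pi r_0^2}$ and $P'(k,\ell)+\dfrac{ik}{z(k)}P(k,\ell)=0$ (for the $k$ for which this boundary value problem is uniquely solvable); $P(k,\ell)$ is regarded as a meromorphic function of $k\in\mathbf{C}$. $\{k_j^+\}_{j=1}^{N^+}$ and $\{k_j^-\}_{j=1}^{N^-}$ are the poles of $P(k,\ell)$, listed with multiplicity and in order of nondecreasing modulus, in the open first quadrant and in the open fourth quadrant of $\mathbf{C}$, respectively ($N^-$ finite, $N^+=+\infty$). Further, $$E(k)=-ik\prod_{\sigma\in\{-,+\}}\ \prod_{j=1}^{N^\sigma}\Big(1-\frac{k}{k_j^\sigma}\Big)e^{k/k_j^\sigma}\Big(1+\frac{k}{(k_j^\sigma)^*}\Big)e^{-k/(k_j^\sigma)^*},$$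 where $*$ is complex conjugation. Two data sets are equivalent if each is determined by the other: whenever two pairs $(\ell,r)$, $(\tilde\ell,\tilde r)$ agree on one, they agree on the other. *)

theory Defs
  imports "HOL-Complex_Analysis.Complex_Analysis" "HOL-Library.Extended_Nat"
begin

section \<open>The class of vocal-tract radii\<close>

definition abs_cont_on :: "real set \<Rightarrow> (real \<Rightarrow> real) \<Rightarrow> bool" where
  "abs_cont_on S f \<longleftrightarrow>
     (\<forall>\<epsilon>>0. \<exists>\<delta>>0. \<forall>(n::nat) a b.
        (\<forall>i<n. a i \<in> S \<and> b i \<in> S \<and> a i \<le> b i) \<and>
        (\<forall>i<n. \<forall>j<n. i \<noteq> j \<longrightarrow> {a i<..<b i} \<inter> {a j<..<b j} = {}) \<and>
        (\<Sum>i<n. b i - a i) < \<delta>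
        \<longrightarrow> (\<Sum>i<n. \<bar>f (b i) - f (a i)\<bar>) < \<epsilon>)"

text \<open>A radius is represented by a total function of which only the values on
  \<open>{0..l}\<close> matter. The derivatives at the end points are one-sided, and the second
  derivative is required to exist almost everywhere.\<close>

definition radius_class :: "real \<Rightarrow> (real \<Rightarrow> real) set" where
  "radius_class l =
     {r. (\<forall>x\<in>{0..l}. 0 < r x) \<and>
         (\<exists>r' r''.
            (\<forall>x\<in>{0..l}. (r has_real_derivative r' x) (at x within {0..l})) \<and>
            continuous_on {0..l} r' \<and> abs_cont_on {0..l} r' \<and>
            (AE x in lebesgue. x \<in> {0<..<l} \<longrightarrow> (r' has_real_derivative r'' x) (at x)) \<and>
            set_integrable lebesgue {0<..<l} r'')}"


section \<open>The normalized impedance\<close>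

definition bessel_J :: "nat \<Rightarrow> complex \<Rightarrow> complex" where
  "bessel_J \<nu> w = (\<Sum>m. (-1) ^ m / (fact m * fact (m + \<nu>)) * (w / 2) ^ (2 * m + \<nu>))"

definition struve_H :: "nat \<Rightarrow> complex \<Rightarrow> complex" where
  "struve_H \<nu> w = (\<Sum>m. (-1) ^ m / (Gamma (of_nat m + 3 / 2) * Gamma (of_nat m + of_nat \<nu> + 3 / 2))
                        * (w / 2) ^ (2 * m + \<nu> + 1))"

text \<open>The argument \<open>\<rho>\<close> is the radius at the lips. The formula has a removable singularity
  at \<open>k = 0\<close>, where division by zero in HOL would give the wrong value.\<close>

definition impedance :: "real \<Rightarrow> complex \<Rightarrow> complex" where
  "impedance \<rho> = remove_sings
     (\<lambda>k. 1 - bessel_J 1 (2 * k * of_real \<rho>) / (k * of_real \<rho>)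
            + \<i> * (struve_H 1 (2 * k * of_real \<rho>) / (k * of_real \<rho>)))"


section \<open>The pressure\<close>

text \<open>The function \<open>P'\<close> is the derivative of \<open>P\<close> with respect to \<open>x\<close>. The conjunct
  \<open>impedance (r l) k \<noteq> 0\<close> keeps the quotient in the boundary condition at \<open>l\<close> meaningful.\<close>

definition pressure_bvp ::
    "real \<Rightarrow> real \<Rightarrow> real \<Rightarrow> (real \<Rightarrow> real) \<Rightarrow> complex \<Rightarrow> (real \<Rightarrow> complex) \<Rightarrow> (real \<Rightarrow> complex) \<Rightarrow> bool" where
  "pressure_bvp c \<mu> l r k P P' \<longleftrightarrow>
     impedance (r l) k \<noteq> 0 \<and>
     (\<forall>x\<in>{0..l}. (P has_vector_derivative P' x) (at x within {0..l})) \<and>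
     continuous_on {0..l} P' \<and>
     (\<forall>x\<in>{0<..<l}. \<exists>D. ((\<lambda>y. of_real ((r y)\<^sup>2) * P' y) has_vector_derivative D) (at x) \<and>
                       D + k\<^sup>2 * of_real ((r x)\<^sup>2) * P x = 0) \<and>
     P' 0 = - (\<i> * k * of_real (c * \<mu>) / of_real (pi * (r 0)\<^sup>2)) \<and>
     P' l + \<i> * k / impedance (r l) k * P l = 0"

definition uniquely_solvable :: "real \<Rightarrow> real \<Rightarrow> real \<Rightarrow> (real \<Rightarrow> real) \<Rightarrow> complex \<Rightarrow> bool" where
  "uniquely_solvable c \<mu> l r k \<longleftrightarrow>
     (\<exists>P P'. pressure_bvp c \<mu> l r k P P') \<and>
     (\<forall>P P' Q Q'. pressure_bvp c \<mu> l r k P P' \<and> pressure_bvp c \<mu> l r k Q Q'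
        \<longrightarrow> (\<forall>x\<in>{0..l}. P x = Q x))"

text \<open>\<open>lip_pressure c \<mu> l r\<close> is \<open>k \<mapsto> P(k,l)\<close> as a meromorphic function on the plane:
  the values \<open>P(k,l)\<close> of the unique solutions, extended to the remaining \<open>k\<close> by removing
  singularities. The placeholder \<open>0\<close> at those \<open>k\<close> is irrelevant, because
  \<^const>\<open>remove_sings\<close>, \<^const>\<open>is_pole\<close> and \<^const>\<open>zorder\<close> only look at punctured neighbourhoods.\<close>

definition lip_pressure :: "real \<Rightarrow> real \<Rightarrow> real \<Rightarrow> (real \<Rightarrow> real) \<Rightarrow> complex \<Rightarrow> complex" where
  "lip_pressure c \<mu> l r = remove_sings
     (\<lambda>k. if uniquely_solvable c \<mu> l r k
          then THE p. \<exists>P P'. pressure_bvp c \<mu> l r k P P' \<and> p = P l else 0)"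


section \<open>Poles and the function E\<close>

definition quadrant1 :: "complex set" where
  "quadrant1 = {k. 0 < Re k \<and> 0 < Im k}"

definition quadrant4 :: "complex set" where
  "quadrant4 = {k. 0 < Re k \<and> Im k < 0}"

definition pole_mult :: "(complex \<Rightarrow> complex) \<Rightarrow> complex \<Rightarrow> nat" where
  "pole_mult f k = (if is_pole f k then nat (- zorder f k) else 0)"

text \<open>\<open>is_pole_listing f Q (N, s)\<close>: the family \<open>s j\<close> with \<open>j < N\<close>, where \<open>N\<close> may be infinite,
  lists the poles of \<open>f\<close> in \<open>Q\<close>, each as often as its multiplicity, by nondecreasing modulus.
  The indices start at \<open>0\<close>, and \<open>s\<close> is \<open>undefined\<close> outside the index set, so that
  equality of pairs is equality of families.\<close>

definition is_pole_listing ::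
    "(complex \<Rightarrow> complex) \<Rightarrow> complex set \<Rightarrow> enat \<times> (nat \<Rightarrow> complex) \<Rightarrow> bool" where
  "is_pole_listing f Q L \<longleftrightarrow>
     (case L of (N, s) \<Rightarrow>
        s \<in> extensional {j. enat j < N} \<and>
        (\<forall>j. enat j < N \<longrightarrow> s j \<in> Q \<and> is_pole f (s j)) \<and>
        (\<forall>i j. i \<le> j \<and> enat j < N \<longrightarrow> cmod (s i) \<le> cmod (s j)) \<and>
        (\<forall>k\<in>Q. finite {j. enat j < N \<and> s j = k} \<and>
                card {j. enat j < N \<and> s j = k} = pole_mult f k))"

text \<open>Poles of equal modulus may be listed in several orders. The predicate
  \<^const>\<open>is_pole_listing\<close> depends on \<open>f\<close> only through the poles in \<open>Q\<close> and their
  multiplicities, so the choice made below does too.\<close>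

definition pole_listing :: "(complex \<Rightarrow> complex) \<Rightarrow> complex set \<Rightarrow> enat \<times> (nat \<Rightarrow> complex)" where
  "pole_listing f Q = (SOME L. is_pole_listing f Q L)"

definition poles_plus :: "real \<Rightarrow> real \<Rightarrow> real \<Rightarrow> (real \<Rightarrow> real) \<Rightarrow> enat \<times> (nat \<Rightarrow> complex)" where
  "poles_plus c \<mu> l r = pole_listing (lip_pressure c \<mu> l r) quadrant1"

definition poles_minus :: "real \<Rightarrow> real \<Rightarrow> real \<Rightarrow> (real \<Rightarrow> real) \<Rightarrow> enat \<times> (nat \<Rightarrow> complex)" where
  "poles_minus c \<mu> l r = pole_listing (lip_pressure c \<mu> l r) quadrant4"

definition E_product :: "enat \<times> (nat \<Rightarrow> complex) \<Rightarrow> complex \<Rightarrow> complex" where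
  "E_product L k =
     (case L of (N, s) \<Rightarrow>
        (\<Prod>j. if enat j < N
              then (1 - k / s j) * exp (k / s j) * (1 + k / cnj (s j)) * exp (- k / cnj (s j))
              else 1))"

definition E_fun :: "real \<Rightarrow> real \<Rightarrow> real \<Rightarrow> (real \<Rightarrow> real) \<Rightarrow> complex \<Rightarrow> complex" where
  "E_fun c \<mu> l r k =
     - \<i> * k * (E_product (poles_minus c \<mu> l r) k * E_product (poles_plus c \<mu> l r) k)"


section \<open>Data sets\<close>

text \<open>A data set is a function of the pair \<open>l\<close>, \<open>r\<close>.\<close>

definition data1 :: "real \<Rightarrow> real \<Rightarrow> real \<Rightarrow> (real \<Rightarrow> real) \<Rightarrow> real \<Rightarrow> complex" where
  "data1 c \<mu> l r = (\<lambda>k\<in>{0<..}. lip_pressure c \<mu> l r (of_real k))"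

definition data2 :: "real \<Rightarrow> real \<Rightarrow> real \<Rightarrow> (real \<Rightarrow> real) \<Rightarrow>
    (real \<Rightarrow> real) \<times> (enat \<times> (nat \<Rightarrow> complex))" where
  "data2 c \<mu> l r =
     ((\<lambda>k\<in>{0<..}. cmod (lip_pressure c \<mu> l r (of_real k))), poles_minus c \<mu> l r)"

definition data3 :: "real \<Rightarrow> real \<Rightarrow> real \<Rightarrow> (real \<Rightarrow> real) \<Rightarrow>
    real \<times> (enat \<times> (nat \<Rightarrow> complex)) \<times> (enat \<times> (nat \<Rightarrow> complex))" where
  "data3 c \<mu> l r = (l, poles_minus c \<mu> l r, poles_plus c \<mu> l r)"

definition data4 :: "real \<Rightarrow> real \<Rightarrow> real \<Rightarrow> (real \<Rightarrow> real) \<Rightarrow>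
    real \<times> (enat \<times> (nat \<Rightarrow> complex)) \<times> (enat \<times> (nat \<Rightarrow> complex))" where
  "data4 c \<mu> l r = (r l, poles_minus c \<mu> l r, poles_plus c \<mu> l r)"

definition data5 :: "real \<Rightarrow> real \<Rightarrow> real \<Rightarrow> (real \<Rightarrow> real) \<Rightarrow> real \<times> (complex \<Rightarrow> complex)" where
  "data5 c \<mu> l r = (l, E_fun c \<mu> l r)"

definition data6 :: "real \<Rightarrow> real \<Rightarrow> real \<Rightarrow> (real \<Rightarrow> real) \<Rightarrow> real \<times> (complex \<Rightarrow> complex)" where
  "data6 c \<mu> l r = (r l, E_fun c \<mu> l r)"

definition data_equiv ::
    "(real \<Rightarrow> (real \<Rightarrow> real) \<Rightarrow> 'a) \<Rightarrow> (real \<Rightarrow> (real \<Rightarrow> real) \<Rightarrow> 'b) \<Rightarrow> bool" where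
  "data_equiv D D' \<longleftrightarrow>
     (\<forall>l r m s. 0 < l \<and> r \<in> radius_class l \<and> 0 < m \<and> s \<in> radius_class m
        \<longrightarrow> (D l r = D m s \<longleftrightarrow> D' l r = D' m s))"

end

theory Submission
  imports Defs
begin

text \<open>Let \<open>u\<close> be the solution of the pressure equation with \<open>u(0) = 1\<close> and \<open>u'(0) = 0\<close>. By constancy of
  the Wronskian, \<open>P(k,l) = c \<mu> z(k) / (\<pi> r(l)\<^sup>2 F(k))\<close> with
  \<open>F(k) = u(k,l) - i z(k) u'(k,l) / k\<close>. This \<open>F\<close> is entire of exponential type, and
  its zeros are exactly the poles of \<open>P(k,l)\<close>; they avoid both axes and are symmetric under
  \<open>k \<mapsto> -k\<^sup>*\<close>. Hence the poles in the first and fourth quadrants, or the zeros of \<open>E\<close>,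
  determine \<open>F\<close> up to a factor \<open>exp (b k)\<close>. On the two halves of the imaginary axis \<open>F\<close> grows like
  \<open>exp (l t)\<close> and, up to powers of \<open>t\<close>, \<open>exp ((l + 2 r(l)) t)\<close>, so one of \<open>l\<close>, \<open>r(l)\<close> fixes \<open>b\<close> and the other one.
  As \<open>z\<close> has positive real part on the real axis, where \<open>u\<close> is real, \<open>F\<close> yields \<open>u(k,l)\<close> and \<open>u'(k,l)\<close>,
  and an argument in the style of Borg and Marchenko recovers \<open>r\<close>.

  If two tracts have the same \<open>P(k,l)\<close> for \<open>k > 0\<close>, then \<open>z F~ / r(l)\<^sup>2\<close> and \<open>z~ F / r~(l)\<^sup>2\<close> coincide,
  and their growth on the negative imaginary axis shows that the lengths agree. If they only have the same
  \<open>|P(k,l)|\<close>, then these two functions \<open>N\<close>, \<open>M\<close> satisfy \<open>N(k) N(-k) = M(k) M(-k)\<close>. The function \<open>z\<close> has no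
  zeros in the closed lower half plane except \<open>0\<close>, so the poles in the fourth quadrant give the zeros of
  \<open>N\<close> and \<open>M\<close> there, hence everywhere; thus \<open>N / M\<close> is an exponential that is unimodular on the
  real axis.\<close>

section \<open>Entire functions of exponential type\<close>

text \<open>The recurring obstacle is that a zero-free quotient of two functions of exponential type
  must be shown to have exponential type before it can be called an exponential. Canonical products
  for F are avoided: for each R the zeros in the disc of radius R are divided out, the maximum
  principle on the circle of radius 3 R bounds the cofactor from above, and Borel-Caratheodory
  bounds it from below. The same extraction counts zeros, which gives the convergence of the product
  in E. On the imaginary axis every ingredient of F has a sign, so F is real and at least 1 there,
  and no cancellation can disturb a growth rate. This is why b can be read off on that axis. Only
  exponential rates are compared, never asymptotic expansions; they come from energy estimates for
  two waves that are coupled through the bounded function r' / r.\<close>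

definition exp_type :: "(complex \<Rightarrow> complex) \<Rightarrow> bool" where
  "exp_type f \<longleftrightarrow> f holomorphic_on UNIV \<and> (\<exists>A B. 0 \<le> B \<and> (\<forall>k. cmod (f k) \<le> A * exp (B * cmod k)))"

section \<open>Closure properties of functions of exponential type\<close>

lemma exp_typeI:
  assumes "f holomorphic_on UNIV" "\<And>k. cmod (f k) \<le> A * exp (B * cmod k)"
  shows "exp_type f"
proof -
  have "0 \<le> A" using assms(2)[of 0] norm_ge_zero[of "f 0"] by (simp del: norm_ge_zero)
  have "cmod (f k) \<le> A * exp (\<bar>B\<bar> * cmod k)" for k
    using assms(2)[of k] \<open>0 \<le> A\<close> by (smt (verit) exp_le_cancel_iff mult_left_mono mult_right_mono norm_ge_zero)
  then show ?thesis using assms(1) unfolding exp_type_def by (meson abs_ge_zero)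
qed

lemma exp_type_bound:
  assumes "exp_type f"
  obtains A B where "1 \<le> A" "0 \<le> B" "\<And>k. cmod (f k) \<le> A * exp (B * cmod k)"
proof -
  obtain A B where AB: "0 \<le> B" "\<And>k. cmod (f k) \<le> A * exp (B * cmod k)"
    using assms unfolding exp_type_def by auto
  have "cmod (f k) \<le> max 1 A * exp (B * cmod k)" for k
    by (rule order_trans[OF AB(2)]) (intro mult_right_mono; simp)
  then show ?thesis using that[of "max 1 A" B] AB(1) by simp
qed

lemma exp_type_holo: "exp_type f \<Longrightarrow> f holomorphic_on UNIV"
  by (simp add: exp_type_def)

lemma exp_type_mult:
  assumes "exp_type f" "exp_type g" shows "exp_type (\<lambda>k. f k * g k)"
proof -
  obtain A B where AB: "1 \<le> A" "0 \<le> B" "\<And>k. cmod (f k) \<le> A * exp (B * cmod k)"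
    using exp_type_bound[OF assms(1)] by metis
  obtain A' B' where AB': "1 \<le> A'" "0 \<le> B'" "\<And>k. cmod (g k) \<le> A' * exp (B' * cmod k)"
    using exp_type_bound[OF assms(2)] by metis
  have "cmod (f k * g k) \<le> (A * A') * exp ((B + B') * cmod k)" for k
  proof -
    have "cmod (f k * g k) \<le> (A * exp (B * cmod k)) * (A' * exp (B' * cmod k))"
      unfolding norm_mult by (intro mult_mono AB AB') (use AB in auto)
    then show ?thesis by (simp add: exp_add ring_distribs mult_ac)
  qed
  then show ?thesis
    by (rule exp_typeI[OF holomorphic_on_mult[OF exp_type_holo[OF assms(1)] exp_type_holo[OF assms(2)]]])
qed

lemma exp_type_add:
  assumes "exp_type f" "exp_type g" shows "exp_type (\<lambda>k. f k + g k)"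
proof -
  obtain A B where AB: "1 \<le> A" "0 \<le> B" "\<And>k. cmod (f k) \<le> A * exp (B * cmod k)"
    using exp_type_bound[OF assms(1)] by metis
  obtain A' B' where AB': "1 \<le> A'" "0 \<le> B'" "\<And>k. cmod (g k) \<le> A' * exp (B' * cmod k)"
    using exp_type_bound[OF assms(2)] by metis
  have "cmod (f k + g k) \<le> (A + A') * exp ((B + B') * cmod k)" for k
  proof -
    have "A * exp (B * cmod k) \<le> A * exp ((B + B') * cmod k)"
         "A' * exp (B' * cmod k) \<le> A' * exp ((B + B') * cmod k)"
      using AB(1,2) AB'(1,2) by (auto intro!: mult_left_mono mult_right_mono)
    then show ?thesis
      using norm_triangle_ineq[of "f k" "g k"] AB(3)[of k] AB'(3)[of k] by (simp add: ring_distribs)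
  qed
  then show ?thesis
    by (rule exp_typeI[OF holomorphic_on_add[OF exp_type_holo[OF assms(1)] exp_type_holo[OF assms(2)]]])
qed

lemma exp_type_const: "exp_type (\<lambda>_. c)"
  by (intro exp_typeI[of _ "cmod c" 0]) auto

lemma exp_type_scale:
  assumes "exp_type f" shows "exp_type (\<lambda>k. f (of_real c * k))"
proof -
  obtain A B where AB: "1 \<le> A" "0 \<le> B" "\<And>k. cmod (f k) \<le> A * exp (B * cmod k)"
    using exp_type_bound[OF assms] by metis
  have "(f \<circ> (\<lambda>k. of_real c * k)) holomorphic_on UNIV"
    by (intro holomorphic_on_compose holomorphic_intros holomorphic_on_subset[OF exp_type_holo[OF assms]]) auto
  then show ?thesis
    using AB(3)[of "of_real c * _"] by (intro exp_typeI[of _ A "B * \<bar>c\<bar>"]) (auto simp: o_def norm_mult mult_ac)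
qed

lemma exp_type_analytic: "exp_type f \<Longrightarrow> f analytic_on A"
  using exp_type_holo analytic_on_open[of UNIV f] analytic_on_subset by blast

lemma exp_type_eventually_nonzero:
  assumes "exp_type f" "f a \<noteq> 0"
  shows "\<forall>\<^sub>F k in at z. f k \<noteq> 0"
  using non_zero_neighbour_alt[OF exp_type_holo[OF assms(1)] open_UNIV connected_UNIV, of z a] assms(2)
  by simp

text \<open>Schwarz's lemma for q / (2 a - q), where q is p(R w) - p(0) and a = A - Re (p 0). The
  map sends the half plane Re < a into the unit disc and fixes 0; solving back for q gives the
  bound.\<close>

lemma Borel_Caratheodory:
  assumes "p holomorphic_on ball 0 R" "0 < R" and A: "\<And>z. cmod z < R \<Longrightarrow> Re (p z) < A"
    and "cmod z < R"
  shows "cmod (p z - p 0) \<le> 2 * (A - Re (p 0)) * cmod z / (R - cmod z)"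
proof -
  define a where "a = A - Re (p 0)"
  have "a > 0" using A[of 0] assms(2) by (simp add: a_def)
  define q where "q w = p (of_real R * w) - p 0" for w
  have Rw: "cmod (of_real R * w) < R" if "cmod w < 1" for w
    using that assms(2) by (simp add: norm_mult)
  have Req: "Re (q w) < a" if "cmod w < 1" for w
    using A[OF Rw[OF that]] by (simp add: q_def a_def)
  have ne: "2 * of_real a - q w \<noteq> 0" if "cmod w < 1" for w
  proof
    assume "2 * of_real a - q w = 0"
    then have "Re (2 * of_real a - q w) = 0" by simp
    with Req[OF that] \<open>a > 0\<close> show False by simp
  qed
  have holq: "q holomorphic_on ball 0 1"
  proof -
    have "(p \<circ> (\<lambda>w. of_real R * w)) holomorphic_on ball 0 1"
      by (rule holomorphic_on_compose_gen[OF _ assms(1)]) (auto intro!: holomorphic_intros simp: Rw)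
    then show ?thesis unfolding q_def o_def by (intro holomorphic_intros)
  qed
  define f where "f w = q w / (2 * of_real a - q w)" for w
  have f1: "cmod (f w) < 1" if "cmod w < 1" for w
  proof -
    have "(Re (q w))\<^sup>2 < (2 * a - Re (q w))\<^sup>2"
    proof -
      have "(2 * a - Re (q w))\<^sup>2 - (Re (q w))\<^sup>2 = 4 * a * (a - Re (q w))"
        by (simp add: power2_eq_square algebra_simps)
      moreover have "4 * a * (a - Re (q w)) > 0" using Req[OF that] \<open>a > 0\<close> by simp
      ultimately show ?thesis by linarith
    qed
    then have "(cmod (q w))\<^sup>2 < (cmod (2 * of_real a - q w))\<^sup>2"
      by (simp add: cmod_power2)
    then have "cmod (q w) < cmod (2 * of_real a - q w)"
      by (simp add: power2_less_imp_less)
    then show ?thesis using ne[OF that] by (simp add: f_def norm_divide)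
  qed
  have "f holomorphic_on ball 0 1"
    unfolding f_def by (intro holomorphic_intros holq) (use ne in auto)
  moreover have "f 0 = 0" by (simp add: f_def q_def)
  ultimately have Sch: "cmod (f w) \<le> cmod w" if "cmod w < 1" for w
    by (intro Schwarz_Lemma(1)) (use f1 that in auto)
  define w where "w = z / of_real R"
  have w: "cmod w < 1" using assms by (simp add: w_def norm_divide)
  have qw: "q w = p z - p 0" using assms(2) by (simp add: q_def w_def)
  have "q w = f w * (2 * of_real a - q w)" using ne[OF w] by (simp add: f_def)
  then have "cmod (q w) = cmod (f w) * cmod (2 * of_real a - q w)" by (metis norm_mult)
  also have "\<dots> \<le> cmod w * (2 * a + cmod (q w))"
    using Sch[OF w] norm_triangle_ineq4[of "2 * of_real a" "q w"] \<open>a > 0\<close>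
    by (intro mult_mono) (auto simp: norm_mult)
  finally have "cmod (q w) * (1 - cmod w) \<le> 2 * a * cmod w" by (simp add: algebra_simps)
  moreover have "1 - cmod w = (R - cmod z) / R" using assms(2) by (simp add: w_def norm_divide field_simps)
  moreover have "cmod w = cmod z / R" using assms(2) by (simp add: w_def norm_divide)
  ultimately have "(cmod (q w) * (R - cmod z)) / R \<le> (2 * a * cmod z) / R" by simp
  then have "cmod (q w) * (R - cmod z) \<le> 2 * a * cmod z"
    using assms(2) by (simp add: divide_le_cancel)
  then show ?thesis using assms(4) by (simp add: qw a_def field_simps)
qed

text \<open>A logarithm p of h has real part of at most linear growth. Borel-Caratheodory turns this
  into linear growth of |p|, so Liouville's theorem makes p a polynomial of degree at most
  one.\<close>

lemma exp_type_zero_free: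
  assumes "exp_type h" "\<And>k. h k \<noteq> 0"
  obtains b where "\<And>k. h k = h 0 * exp (b * k)"
proof -
  obtain p where p: "p holomorphic_on UNIV" "\<And>k. exp (p k) = h k"
    using holomorphic_logarithm_exists[OF convex_UNIV open_UNIV exp_type_holo[OF assms(1)] assms(2), of 0]
    by (metis UNIV_I)
  obtain A B where AB: "1 \<le> A" "0 \<le> B" "\<And>k. cmod (h k) \<le> A * exp (B * cmod k)"
    using exp_type_bound[OF assms(1)] by metis
  have Rep: "Re (p k) \<le> ln A + B * cmod k" for k
  proof -
    have "exp (Re (p k)) \<le> exp (ln A + B * cmod k)"
      using AB(3)[of k] AB(1) by (simp add: p(2)[symmetric] exp_add)
    then show ?thesis by simp
  qed
  define C where "C = 2 * (ln A + 1 + \<bar>Re (p 0)\<bar>) + cmod (p 0) + 4 * B"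
  have bound: "cmod (p z) \<le> C * cmod z ^ 1" if "1 \<le> cmod z" for z
  proof -
    \<comment> \<open>The disc has twice the radius of z, so that the denominator R - |z| cancels
      |z|. The summand 1 makes the bound on the real part strict.\<close>
    have "cmod (p z - p 0) \<le> 2 * (ln A + 1 + B * (2 * cmod z) - Re (p 0)) * cmod z / (2 * cmod z - cmod z)"
    proof (rule Borel_Caratheodory)
      show "p holomorphic_on ball 0 (2 * cmod z)" using p(1) holomorphic_on_subset by blast
      show "Re (p w) < ln A + 1 + B * (2 * cmod z)" if "cmod w < 2 * cmod z" for w
        using Rep[of w] mult_left_mono[of "cmod w" "2 * cmod z" B] that AB(2) by simp
    qed (use that in auto)
    also have "\<dots> = 2 * (ln A + 1 + B * (2 * cmod z) - Re (p 0))" using that by auto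
    also have "\<dots> = 2 * (ln A + 1 - Re (p 0)) + 4 * B * cmod z" by (simp add: algebra_simps)
    finally have "cmod (p z) \<le> 2 * (ln A + 1 + \<bar>Re (p 0)\<bar>) + cmod (p 0) + 4 * B * cmod z"
      using norm_triangle_ineq2[of "p z" "p 0"] abs_ge_minus_self[of "Re (p 0)"]
      by argo
    also have "\<dots> \<le> (2 * (ln A + 1 + \<bar>Re (p 0)\<bar>) + cmod (p 0)) * cmod z + 4 * B * cmod z"
      using mult_left_mono[OF that, of "2 * (ln A + 1 + \<bar>Re (p 0)\<bar>) + cmod (p 0)"] AB(1) by simp
    also have "\<dots> = C * cmod z ^ 1" by (simp add: C_def algebra_simps)
    finally show ?thesis .
  qed
  have two: "(\<Sum>j\<le>(1::nat). f j) = f 0 + f 1" for f :: "nat \<Rightarrow> complex" by simp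
  have "p k = (\<Sum>j\<le>1. (deriv ^^ j) p 0 / fact j * k ^ j)" for k
    by (rule Liouville_polynomial[OF p(1), of 1 C 1]) (rule bound)
  moreover have "(\<Sum>j\<le>1. (deriv ^^ j) p 0 / fact j * k ^ j) = p 0 + deriv p 0 * k" for k
    unfolding two by simp
  ultimately have "p k = p 0 + deriv p 0 * k" for k by (rule trans)
  then have "h k = h 0 * exp (deriv p 0 * k)" for k
    by (metis exp_add p(2))
  then show ?thesis using that by blast
qed

text \<open>Dividing by 1 - k / a instead of k - a keeps the value at 0, so the normalisation g(0) =
  1 survives repeated division.\<close>

lemma divide_zero_entire:
  assumes "g holomorphic_on UNIV" "g a = 0" "a \<noteq> 0"
  obtains g1 where "g1 holomorphic_on UNIV" "\<And>k. g k = (1 - k / a) * g1 k"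
proof
  let ?h = "\<lambda>z. if z = a then deriv g a else (g z - g a) / (z - a)"
  show "(\<lambda>z. - a * ?h z) holomorphic_on UNIV"
    by (intro holomorphic_intros pole_lemma) (use assms in auto)
  show "g k = (1 - k / a) * (- a * ?h k)" for k
    using assms by (auto simp: field_simps)
qed

text \<open>For |a| <= R and |k| = 3 R one has |k / a| >= 3, so each factor is at least 2 on that
  circle; the maximum principle carries the bound inside. At k = 0 it limits the number of zeros, in
  the manner of Jensen's formula; elsewhere it bounds the cofactor.\<close>

lemma zero_extraction_bound:
  assumes "0 < R" and g1: "g1 holomorphic_on UNIV"
    and g: "\<And>k. g k = (\<Prod>a\<in>#M. 1 - k / a) * g1 k"
    and M: "\<And>a. a \<in># M \<Longrightarrow> a \<noteq> 0 \<and> cmod a \<le> R"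
    and K: "\<And>k. cmod k = 3 * R \<Longrightarrow> cmod (g k) \<le> K"
    and "cmod k \<le> 3 * R"
  shows "cmod (g1 k) * 2 ^ size M \<le> K"
proof -
  have big: "2 ^ size M \<le> cmod (\<Prod>a\<in>#M. 1 - k / a)" if "cmod k = 3 * R" for k
    using M
  proof (induction M)
    case (add a M)
    have "2 ^ size M \<le> cmod (\<Prod>a\<in>#M. 1 - k / a)" using add by auto
    moreover have "2 \<le> cmod (1 - k / a)"
    proof -
      have a: "a \<noteq> 0" "cmod a \<le> R" using add.prems by auto
      then have "3 \<le> cmod (k / a)" using that by (simp add: norm_divide field_simps)
      then show ?thesis using norm_triangle_ineq2[of "k / a" 1] by (simp add: norm_minus_commute)
    qed
    ultimately show ?case by (simp add: norm_mult mult_mono)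
  qed auto
  have "cmod (g1 k) \<le> K / 2 ^ size M"
  proof (rule maximum_modulus_frontier[of g1 "cball 0 (3 * R)"])
    show "g1 holomorphic_on interior (cball 0 (3 * R))" using g1 holomorphic_on_subset by blast
    show "continuous_on (closure (cball 0 (3 * R))) g1"
      using g1 holomorphic_on_imp_continuous_on continuous_on_subset by blast
    show "cmod (g1 z) \<le> K / 2 ^ size M" if "z \<in> frontier (cball 0 (3 * R))" for z
    proof -
      have z: "cmod z = 3 * R" using that by simp
      have "2 ^ size M * cmod (g1 z) \<le> cmod (\<Prod>a\<in>#M. 1 - z / a) * cmod (g1 z)"
        by (intro mult_right_mono big z) auto
      also have "\<dots> \<le> K" using K[OF z] by (simp add: g norm_mult)
      finally show ?thesis by (simp add: field_simps)
    qed
  qed (use assms in auto)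
  then show ?thesis by (simp add: field_simps)
qed

text \<open>A maximal product of linear factors exists, because each factor doubles the size on the
  circle of radius \<open>3 R\<close>.\<close>

lemma zero_extraction:
  assumes "0 < R" "g holomorphic_on UNIV" "g 0 = 1"
    and K: "\<And>k. cmod k = 3 * R \<Longrightarrow> cmod (g k) \<le> K"
  obtains M g1 where "g1 holomorphic_on UNIV" "\<And>k. g k = (\<Prod>a\<in>#M. 1 - k / a) * g1 k"
    "\<And>a. a \<in># M \<Longrightarrow> a \<noteq> 0 \<and> cmod a \<le> R" "\<And>k. cmod k \<le> R \<Longrightarrow> g1 k \<noteq> 0" "2 ^ size M \<le> K"
proof -
  define Q where "Q M g1 \<longleftrightarrow> g1 holomorphic_on UNIV \<and> (\<forall>k. g k = (\<Prod>a\<in>#M. 1 - k / a) * g1 k)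
    \<and> (\<forall>a. a \<in># M \<longrightarrow> a \<noteq> 0 \<and> cmod a \<le> R)" for M g1
  have g10: "g1 0 = 1" if "Q M g1" for M g1
  proof -
    have "g 0 = (\<Prod>a\<in>#M. 1 - 0 / a) * g1 0" using that unfolding Q_def by blast
    then show ?thesis using assms(3) by simp
  qed
  have bd: "2 ^ size M \<le> K" if "Q M g1" for M g1
    using zero_extraction_bound[of R g1 g M K 0] that g10[OF that] assms(1) K unfolding Q_def by simp
  define P where "P M \<longleftrightarrow> (\<exists>g1. Q M g1)" for M
  have "\<exists>n. \<forall>M. P M \<longrightarrow> size M \<le> n"
  proof -
    obtain n :: nat where "K < 2 ^ n" using real_arch_pow[of 2 K] by auto
    then have "size M \<le> n" if "Q M g1" for M g1
      using bd[OF that] by (smt (verit, best) power_increasing_iff nat_le_linear)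
    then show ?thesis unfolding P_def by blast
  qed
  then obtain n where n: "\<forall>M. P M \<longrightarrow> size M < Suc n" by (auto simp: less_Suc_eq_le)
  have "P {#}" unfolding P_def using assms(2) by (intro exI[of _ g]) (simp add: Q_def)
  from ex_has_greatest_nat[OF this n] obtain M where M0: "P M" "\<forall>M'. P M' \<longrightarrow> size M' \<le> size M"
    by blast
  from M0(1) obtain g1 where "Q M g1" unfolding P_def ..
  with M0(2) have M: "Q M g1" "\<And>M' g1'. Q M' g1' \<Longrightarrow> size M' \<le> size M"
    unfolding P_def by blast+
  have "g1 k \<noteq> 0" if "cmod k \<le> R" for k
  proof
    assume 0: "g1 k = 0"
    then have "k \<noteq> 0" using g10[OF M(1)] by auto
    then obtain g2 where "g2 holomorphic_on UNIV" "\<And>w. g1 w = (1 - w / k) * g2 w"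
      using divide_zero_entire[of g1 k] 0 M(1) unfolding Q_def by metis
    then have "Q (add_mset k M) g2" using M(1) that \<open>k \<noteq> 0\<close> by (auto simp: Q_def mult_ac)
    then show False using M(2) by fastforce
  qed
  then show ?thesis using that[of g1 M] M(1) bd[OF M(1)] unfolding Q_def by blast
qed

text \<open>The quotient of the two functions after removal of the common zeros in a disc is bounded,
  because a zero-free function that is not large cannot be too small.\<close>

lemma exp_type_quotient:
  assumes "exp_type f" "exp_type g" "g 0 = 1" "h holomorphic_on UNIV"
    and fhg: "\<And>k. f k = h k * g k"
  shows "exp_type h"
proof -
  obtain A B where AB: "1 \<le> A" "0 \<le> B" "\<And>k. cmod (f k) \<le> A * exp (B * cmod k)"
    using exp_type_bound[OF assms(1)] by metis
  obtain A' B' where AB': "1 \<le> A'" "0 \<le> B'" "\<And>k. cmod (g k) \<le> A' * exp (B' * cmod k)"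
    using exp_type_bound[OF assms(2)] by metis
  define C where "C = max A A'"
  define b where "b = max B B'"
  have C: "1 \<le> C" "0 \<le> b" using AB AB' by (auto simp: C_def b_def)
  have bnd: "cmod (f k) \<le> C * exp (b * cmod k)" "cmod (g k) \<le> C * exp (b * cmod k)" for k
    by (rule order_trans[OF AB(3)] order_trans[OF AB'(3)],
        intro mult_mono; use C AB AB' in \<open>auto simp: C_def b_def intro!: mult_right_mono\<close>)+
  \<comment> \<open>\<open>K\<close> bounds f and g on the circle of radius 3 R. The zeros split off
    from g are zeros of f = h g as well, so both \<open>g1\<close> and h \<open>g1\<close> are at
    most \<open>K\<close> in the disc. As \<open>g1\<close> is 1 at 0 and zero-free,
    Borel-Caratheodory gives |g1 z| >= exp (-2 (ln K + 1)) for |z| <= R / 2. Hence |h z| <= e^2 K^3,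
    which is again exponential in R.\<close>
  have main: "cmod (h z) \<le> exp 2 * (C * exp (b * (3 * R))) ^ 3" if R: "0 < R" "cmod z \<le> R / 2" for R z
  proof -
    define K where "K = C * exp (b * (3 * R))"
    have K1: "1 \<le> K" using C R mult_mono[of 1 C 1 "exp (b * (3 * R))"] by (simp add: K_def)
    have Kf: "cmod (f k) \<le> K" if "cmod k = 3 * R" for k using bnd(1)[of k] that by (simp add: K_def)
    have Kg: "cmod (g k) \<le> K" if "cmod k = 3 * R" for k using bnd(2)[of k] that by (simp add: K_def)
    obtain M g1 where M: "g1 holomorphic_on UNIV" "\<And>k. g k = (\<Prod>a\<in>#M. 1 - k / a) * g1 k"
      "\<And>a. a \<in># M \<Longrightarrow> a \<noteq> 0 \<and> cmod a \<le> R" "\<And>k. cmod k \<le> R \<Longrightarrow> g1 k \<noteq> 0"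
      using zero_extraction[OF R(1) exp_type_holo[OF assms(2)] assms(3) Kg] by metis
    have g10: "g1 0 = 1" using M(2)[of 0] assms(3) by simp
    have two: "(1::real) \<le> 2 ^ size M" by simp
    have g1K: "cmod (g1 k) \<le> K" if "cmod k \<le> 3 * R" for k
      using zero_extraction_bound[OF R(1) M(1,2,3) Kg that]
            mult_left_mono[OF two, of "cmod (g1 k)"] by simp
    have f1K: "cmod (h k * g1 k) \<le> K" if "cmod k \<le> 3 * R" for k
    proof -
      have "cmod (h k * g1 k) * 2 ^ size M \<le> K"
        using zero_extraction_bound[of R "\<lambda>k. h k * g1 k" f M K k] R(1) M Kf that
         assms(4) fhg by (auto intro!: holomorphic_intros)
      then show ?thesis using mult_left_mono[OF two, of "cmod (h k * g1 k)"] by simp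
    qed
    have "g1 holomorphic_on ball 0 R" by (rule holomorphic_on_subset[OF M(1)]) simp
    moreover have "g1 k \<noteq> 0" if "k \<in> ball 0 R" for k by (rule M(4)) (use that in simp)
    ultimately obtain p where p: "p holomorphic_on ball 0 R" "\<And>k. k \<in> ball 0 R \<Longrightarrow> exp (p k) = g1 k"
      using holomorphic_logarithm_exists[of "ball 0 R" g1 0] R(1) by (metis centre_in_ball convex_ball open_ball)
    have Rep0: "Re (p 0) = 0"
    proof -
      have "exp (Re (p 0)) = 1" using p(2)[of 0] R(1) g10 by (metis centre_in_ball norm_exp_eq_Re norm_one)
      then show ?thesis by simp
    qed
    have "cmod (p z - p 0) \<le> 2 * ((ln K + 1) - Re (p 0)) * cmod z / (R - cmod z)"
    proof (rule Borel_Caratheodory[OF p(1) R(1)])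
      fix w assume w: "cmod w < R"
      then have "exp (Re (p w)) \<le> exp (ln K)" using g1K[of w] p(2)[of w, symmetric] K1 R(1) by simp
      then show "Re (p w) < ln K + 1" by simp
    qed (use R in auto)
    also have "\<dots> = 2 * (ln K + 1) * (cmod z / (R - cmod z))" by (simp add: Rep0)
    also have "\<dots> \<le> 2 * (ln K + 1) * 1"
      using R K1 by (intro mult_left_mono) (auto simp: field_simps)
    finally have "- 2 * (ln K + 1) \<le> Re (p z)"
      using abs_Re_le_cmod[of "p z - p 0"] Rep0 by simp
    then have "exp (- 2 * (ln K + 1)) \<le> cmod (g1 z)"
      using p(2)[of z, symmetric] R by simp
    then have "cmod (h z) * exp (- 2 * (ln K + 1)) \<le> cmod (h z * g1 z)"
      by (simp add: norm_mult mult_left_mono)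
    also have "\<dots> \<le> K" using f1K[of z] R by simp
    finally have "cmod (h z) * exp (- (2 * (ln K + 1))) \<le> K" by simp
    then have "cmod (h z) * inverse (exp (2 * (ln K + 1))) \<le> K" by (simp only: exp_minus)
    then have "cmod (h z) \<le> K * exp (2 * (ln K + 1))" by (simp add: field_simps del: mult_exp_exp)
    also have "exp (2 * (ln K + 1)) = exp 2 * (exp (ln K))^2"
      by (simp add: exp_add[symmetric] power2_eq_square algebra_simps)
    finally show ?thesis using K1 by (simp add: K_def power2_eq_square power3_eq_cube mult_ac)
  qed
  \<comment> \<open>The choice is R = 2 |z| + 1, where the 1 keeps R positive at z = 0.\<close>
  have "cmod (h z) \<le> exp 2 * (C * exp (3 * b)) ^ 3 * exp (18 * b * cmod z)" for z
  proof -
    have "exp (b * (3 * (2 * cmod z + 1))) ^ 3 = exp (3 * b) ^ 3 * exp (18 * b * cmod z)"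
      by (simp add: exp_of_nat_mult[symmetric] exp_add[symmetric] algebra_simps)
    then show ?thesis using main[of "2 * cmod z + 1" z] by (simp add: power_mult_distrib mult_ac add_nonneg_pos)
  qed
  then show ?thesis by (rule exp_typeI[OF assms(4)])
qed

text \<open>This takes the place of Hadamard's factorisation theorem: the quotient is entire and
  zero-free, it inherits exponential type, and so it is an exponential with value 1 at 0.\<close>

lemma exp_type_same_zeros:
  assumes "exp_type f" "exp_type g" "f 0 = 1" "g 0 = 1"
    "\<And>k. f k = 0 \<longleftrightarrow> g k = 0" "\<And>k. g k = 0 \<Longrightarrow> zorder f k = zorder g k"
  obtains b where "\<And>k. f k = exp (b * k) * g k"
proof -
  have zo: "zorder g k = zorder f k" for k
  proof (cases "g k = 0")
    case False
    have "f analytic_on {k}" "g analytic_on {k}"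
      using exp_type_holo assms(1,2) by (meson UNIV_I analytic_at open_UNIV)+
    then show ?thesis using False assms(5)[of k] by (simp add: zorder_eq_0I)
  qed (use assms(6) in simp)
  obtain h where h: "h holomorphic_on UNIV" "\<And>z. h z \<noteq> 0" "\<And>z. f z = h z * g z"
    using holomorphic_zorder_factorization[OF exp_type_holo[OF assms(1)] open_UNIV connected_UNIV
      exp_type_holo[OF assms(2)] assms(5)[symmetric] zo] by (metis UNIV_I)
  have "exp_type h" using exp_type_quotient[OF assms(1,2,4) h(1,3)] .
  then obtain b where b: "\<And>k. h k = h 0 * exp (b * k)" by (rule exp_type_zero_free[OF _ h(2)]) (rule that)
  have "h 0 = 1" using h(3)[of 0] assms(3,4) by simp
  then have "f k = exp (b * k) * g k" for k using b[of k] h(3)[of k] by simp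
  then show ?thesis by (rule that)
qed

section \<open>The impedance\<close>

definition circ_moment :: "nat \<Rightarrow> real" where
  "circ_moment n = integral {0..1} (\<lambda>t. t ^ n * sqrt (1 - t\<^sup>2))"

lemma circ_moment: "((\<lambda>t. t ^ n * sqrt (1 - t\<^sup>2)) has_integral circ_moment n) {0..1}"
  unfolding circ_moment_def
  by (intro integrable_integral integrable_continuous_real continuous_intros)

lemma circ_deriv:
  assumes "t \<in> {0<..<1::real}"
  shows "((\<lambda>t. (1 - t\<^sup>2) * sqrt (1 - t\<^sup>2)) has_real_derivative (- 3 * t * sqrt (1 - t\<^sup>2))) (at t)"
proof -
  have "t\<^sup>2 < 1" using assms by (simp add: power_less_one_iff abs_square_less_1)
  define s where "s = sqrt (1 - t\<^sup>2)"
  have s: "s > 0" "1 - t\<^sup>2 = s\<^sup>2" using \<open>t\<^sup>2 < 1\<close> by (simp_all add: s_def)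
  have "((\<lambda>t. (1 - t\<^sup>2) * sqrt (1 - t\<^sup>2)) has_real_derivative (- 2 * t) * s + (1 - t\<^sup>2) * (- t / s)) (at t)"
    using \<open>t\<^sup>2 < 1\<close> s by (auto intro!: derivative_eq_intros simp: s_def[symmetric] field_simps)
  moreover have "(- 2 * t) * s + (1 - t\<^sup>2) * (- t / s) = - 3 * t * s"
    unfolding s(2) using s(1) by (simp add: power2_eq_square)
  ultimately show ?thesis by (simp only: s_def)
qed

text \<open>Integrate the derivative of t^(n+1) (1 - t^2)^(3/2), which vanishes at both ends. The
  root is not differentiable at 1, hence the version of the fundamental theorem that differentiates
  only in the interior.\<close>

lemma circ_moment_rec: "real (n + 1) * circ_moment n = real (n + 4) * circ_moment (n + 2)"
proof -
  let ?F = "\<lambda>t::real. t ^ (n + 1) * ((1 - t\<^sup>2) * sqrt (1 - t\<^sup>2))"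
  let ?f = "\<lambda>t::real. real (n + 1) * (t ^ n * sqrt (1 - t\<^sup>2)) - real (n + 4) * (t ^ (n + 2) * sqrt (1 - t\<^sup>2))"
  have "(?f has_integral (?F 1 - ?F 0)) {0..1}"
  proof (rule fundamental_theorem_of_calculus_interior)
    show "(?F has_vector_derivative ?f t) (at t)" if "t \<in> {0<..<1}" for t
    proof -
      have d: "((\<lambda>t. t ^ (n + 1)) has_real_derivative real (n + 1) * t ^ n) (at t)"
        using DERIV_pow[of "n + 1" t] by simp
      define s where "s = sqrt (1 - t\<^sup>2)"
      have "real (n + 1) * t ^ n * ((1 - t\<^sup>2) * s) + (- 3 * t * s) * t ^ (n + 1) =
        real (n + 1) * (t ^ n * s) - real (n + 4) * (t ^ (n + 2) * s)"
        by (simp add: power_add algebra_simps power2_eq_square)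
      with DERIV_mult[OF d circ_deriv[OF that]] show ?thesis
        by (simp only: s_def has_real_derivative_iff_has_vector_derivative)
    qed
  qed (auto intro!: continuous_intros)
  moreover have "(?f has_integral (real (n + 1) * circ_moment n - real (n + 4) * circ_moment (n + 2))) {0..1}"
    by (intro has_integral_diff has_integral_mult_right circ_moment)
  ultimately have "?F 1 - ?F 0 = real (n + 1) * circ_moment n - real (n + 4) * circ_moment (n + 2)"
    by (rule has_integral_unique)
  then show ?thesis by simp
qed

lemma circ_moment_0: "circ_moment 0 = pi / 4"
proof -
  let ?F = "\<lambda>t::real. (arcsin t + t * sqrt (1 - t\<^sup>2)) / 2"
  have "((\<lambda>t. sqrt (1 - t\<^sup>2)) has_integral (?F 1 - ?F 0)) {0..1}"
  proof (rule fundamental_theorem_of_calculus_interior)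
    show "(?F has_vector_derivative sqrt (1 - t\<^sup>2)) (at t)" if "t \<in> {0<..<1}" for t
    proof -
      have "t\<^sup>2 < 1" using that by (simp add: power_less_one_iff abs_square_less_1)
      define s where "s = sqrt (1 - t\<^sup>2)"
      have s: "s > 0" "1 - t\<^sup>2 = s\<^sup>2" using \<open>t\<^sup>2 < 1\<close> by (simp_all add: s_def)
      have "(?F has_real_derivative ((1 / s + (s + t * (- t / s))) / 2)) (at t)"
        using \<open>t\<^sup>2 < 1\<close> s that by (auto intro!: derivative_eq_intros simp: s_def[symmetric] field_simps)
      moreover have "1 / s + (s + t * (- t / s)) = s + (1 - t\<^sup>2) / s"
        by (simp add: power2_eq_square diff_divide_distrib)
      moreover have "(1 - t\<^sup>2) / s = s" using s(1) unfolding s(2) by (simp add: power2_eq_square)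
      ultimately have "(?F has_real_derivative ((s + s) / 2)) (at t)" by (simp only:)
      then show ?thesis by (simp add: has_real_derivative_iff_has_vector_derivative s_def)
    qed
  qed (auto intro!: continuous_intros)
  then show ?thesis using has_integral_unique[OF circ_moment[of 0]] by fastforce
qed

lemma circ_moment_1: "circ_moment 1 = 1 / 3"
proof -
  let ?F = "\<lambda>t::real. (- 1 / 3) * ((1 - t\<^sup>2) * sqrt (1 - t\<^sup>2))"
  have "((\<lambda>t. t * sqrt (1 - t\<^sup>2)) has_integral (?F 1 - ?F 0)) {0..1}"
  proof (rule fundamental_theorem_of_calculus_interior)
    show "(?F has_vector_derivative t * sqrt (1 - t\<^sup>2)) (at t)" if "t \<in> {0<..<1}" for t
      using DERIV_cmult[OF circ_deriv[OF that], of "- 1 / 3"]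
      by (simp add: has_real_derivative_iff_has_vector_derivative)
  qed (auto intro!: continuous_intros)
  then show ?thesis using has_integral_unique[OF circ_moment[of 1]] by fastforce
qed

text \<open>The recursion links n and n + 2, hence the induction in steps of two: both sides are
  multiplied by 1 / ((n/2 + 1) (n/2 + 2)). The base cases come down to the moments pi/4 and 1/3 and
  to Gamma (1/2).\<close>

lemma circ_moment_Gamma:
  "4 / pi * circ_moment n * 2 ^ n / fact n = 1 / (Gamma (real n / 2 + 1) * Gamma (real n / 2 + 2))"
proof (induction n rule: nat_induct2)
  case 0
  have "Gamma (2::real) = 1" using Gamma_fact[of 1, where 'a=real] by simp
  then show ?case by (simp add: circ_moment_0 Gamma_fact[of 0, where 'a=real, simplified])
next
  case 1
  have "(1 / 2 :: real) \<notin> \<int>\<^sub>\<le>\<^sub>0" "(3 / 2 :: real) \<notin> \<int>\<^sub>\<le>\<^sub>0"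
    by (rule notI, drule nonpos_Ints_nonpos, simp)+
  note nonp = this
  have 32: "Gamma (3 / 2 :: real) = sqrt pi / 2"
    using Gamma_plus1[of "1/2::real"] nonp by (simp add: Gamma_one_half_real)
  have 52: "Gamma (5 / 2 :: real) = 3 / 2 * (sqrt pi / 2)"
    using Gamma_plus1[of "3/2::real"] nonp by (simp add: 32)
  have "1 / (Gamma (real 1 / 2 + 1) * Gamma (real 1 / 2 + 2)) = 1 / (Gamma (3/2) * Gamma (5/2 :: real))"
    by (simp add: add.commute)
  then show ?case by (simp add: circ_moment_1[unfolded One_nat_def] 32 52)
next
  case (step n)
  have 1: "Gamma (real (n + 2) / 2 + 1) = (real n / 2 + 1) * Gamma (real n / 2 + 1)"
    using Gamma_plus1[of "real n / 2 + 1"] by (simp add: add_divide_distrib add_ac nonpos_Ints_def)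
  have 2: "Gamma (real (n + 2) / 2 + 2) = (real n / 2 + 2) * Gamma (real n / 2 + 2)"
    using Gamma_plus1[of "real n / 2 + 2"] by (simp add: add_divide_distrib add_ac nonpos_Ints_def)
  have m: "circ_moment (n + 2) = real (n + 1) * circ_moment n / real (n + 4)"
    using circ_moment_rec[of n] by (simp add: field_simps del: of_nat_add)
  have "4 / pi * circ_moment (n + 2) * 2 ^ (n + 2) / fact (n + 2)
      = (4 / pi * circ_moment n * 2 ^ n / fact n) * (1 / ((real n / 2 + 1) * (real n / 2 + 2)))"
    unfolding m by (simp add: fact_reduce[of "Suc (Suc n)"] divide_simps)
  then show ?case unfolding step.IH 1 2 by simp
qed

text \<open>The impedance is \<open>z(k) = imp_fun (r(l) k)\<close>: this is the Poisson-type integral that combines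
  those of \<open>J\<^sub>1\<close> and \<open>H\<^sub>1\<close>.\<close>

definition imp_fun :: "complex \<Rightarrow> complex" where
  "imp_fun w = of_real (4 / pi) *
     integral {0..1} (\<lambda>t. of_real (sqrt (1 - t\<^sup>2)) * (1 - exp (- 2 * \<i> * w * of_real t)))"

text \<open>One formula for two series: even n gives the coefficients of J_1, odd n those of
  H_1.\<close>

definition imp_coeff :: "nat \<Rightarrow> real" where
  "imp_coeff n = 1 / (Gamma (real n / 2 + 1) * Gamma (real n / 2 + 2))"

text \<open>The exponential series converges uniformly on the interval of integration, so it can be
  integrated term by term. The summand 1 in the integrand contributes 4 / pi times the zeroth
  moment, which is 1.\<close>

lemma imp_fun_sums: "(\<lambda>n. of_real (imp_coeff n) * (- \<i> * w) ^ n) sums (1 - imp_fun w)"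
proof -
  define a where "a = - 2 * \<i> * w"
  have na: "cmod a = 2 * cmod w" by (simp add: a_def norm_mult)
  have imp: "imp_fun w = of_real (4 / pi) * integral {0..1} (\<lambda>t. of_real (sqrt (1 - t\<^sup>2)) * (1 - exp (a * of_real t)))"
    by (simp only: imp_fun_def a_def)
  define f where "f n t = of_real (sqrt (1 - t\<^sup>2)) * (((a * of_real t) ^ n) /\<^sub>R fact n)" for n and t :: real
  have sf: "(\<lambda>n. f n t) sums (of_real (sqrt (1 - t\<^sup>2)) * exp (a * of_real t))" for t
    unfolding f_def by (intro sums_mult exp_converges)
  have ul: "uniform_limit {0..1} (\<lambda>N t. \<Sum>n<N. f n t) (\<lambda>t. suminf (\<lambda>n. f n t)) sequentially"
  proof (rule Weierstrass_m_test)
    show "norm (f n t) \<le> cmod a ^ n /\<^sub>R fact n" if t: "t \<in> {0..1}" for n t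
    proof -
      have s: "sqrt (1 - t\<^sup>2) \<le> 1" "0 \<le> sqrt (1 - t\<^sup>2)" using t by (simp_all add: abs_square_le_1)
      have "norm (f n t) = sqrt (1 - t\<^sup>2) * ((cmod a * t) ^ n /\<^sub>R fact n)"
        using s(2) t by (simp add: f_def norm_mult norm_power)
      also have "\<dots> \<le> 1 * (cmod a ^ n /\<^sub>R fact n)"
        using t s by (intro mult_mono scaleR_left_mono power_mono) (auto intro: mult_left_le)
      finally show ?thesis by simp
    qed
    show "summable (\<lambda>n. cmod a ^ n /\<^sub>R fact n)" by (rule summable_exp_generic)
  qed
  have cf: "continuous_on {0..1} (\<lambda>t. \<Sum>n<N. f n t)" for N
    unfolding f_def by (intro continuous_intros)
  obtain I J where IJ: "\<And>N. ((\<lambda>t. \<Sum>n<N. f n t) has_integral I N) {0..1}"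
    "((\<lambda>t. suminf (\<lambda>n. f n t)) has_integral J) {0..1}" "I \<longlonglongrightarrow> J"
    using uniform_limit_integral[OF ul cf] by auto
  have "suminf (\<lambda>n. f n t) = of_real (sqrt (1 - t\<^sup>2)) * exp (a * of_real t)" for t
    using sf sums_unique by metis
  then have J: "((\<lambda>t. of_real (sqrt (1 - t\<^sup>2)) * exp (a * of_real t)) has_integral J) {0..1}"
    using IJ(2) by simp
  have "((\<lambda>t. sqrt (1 - t\<^sup>2)) has_integral (pi / 4)) {0..1}"
    using circ_moment[of 0] by (simp add: circ_moment_0)
  then have m0: "((\<lambda>t. of_real (sqrt (1 - t\<^sup>2)) :: complex) has_integral of_real (pi / 4)) {0..1}"
    by (rule has_integral_of_real)
  have "((\<lambda>t. of_real (sqrt (1 - t\<^sup>2)) * (1 - exp (a * of_real t))) has_integral (of_real (pi / 4) - J)) {0..1}"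
    using has_integral_diff[OF m0 J] by (simp only: right_diff_distrib mult_1_right)
  then have "imp_fun w = of_real (4 / pi) * (of_real (pi / 4) - J)"
    unfolding imp by (simp only: integral_unique)
  then have wJ: "1 - imp_fun w = of_real (4 / pi) * J" by (simp add: algebra_simps)
  have fn: "(f n has_integral (of_real (circ_moment n) * (a ^ n / fact n))) {0..1}" for n
  proof -
    have "((\<lambda>t. of_real (t ^ n * sqrt (1 - t\<^sup>2)) * (a ^ n / fact n)) has_integral
        (of_real (circ_moment n) * (a ^ n / fact n))) {0..1}"
      by (intro has_integral_mult_left has_integral_of_real circ_moment)
    moreover have "of_real (t ^ n * sqrt (1 - t\<^sup>2)) * (a ^ n / fact n) = f n t" for t
      by (simp add: f_def power_mult_distrib scaleR_conv_of_real field_simps)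
    ultimately show ?thesis by simp
  qed
  have "I = (\<lambda>N. \<Sum>n<N. of_real (circ_moment n) * (a ^ n / fact n))"
    by (rule ext, rule has_integral_unique[OF IJ(1)]) (intro has_integral_sum fn finite_lessThan)
  with IJ(3) have "(\<lambda>n. of_real (circ_moment n) * (a ^ n / fact n)) sums J"
    by (simp only: sums_def)
  then have "(\<lambda>n. of_real (4 / pi) * (of_real (circ_moment n) * (a ^ n / fact n))) sums (1 - imp_fun w)"
    unfolding wJ by (rule sums_mult)
  moreover have "of_real (4 / pi) * (of_real (circ_moment n) * (a ^ n / fact n))
    = of_real (imp_coeff n) * (- \<i> * w) ^ n" for n
  proof -
    have "a = 2 * (- \<i> * w)" by (simp add: a_def)
    then have "a ^ n = of_real (2 ^ n) * (- \<i> * w) ^ n"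
      by (simp only: power_mult_distrib of_real_power of_real_numeral)
    then have "of_real (4 / pi) * (of_real (circ_moment n) * (a ^ n / fact n))
      = of_real (4 / pi * circ_moment n * 2 ^ n / fact n) * (- \<i> * w) ^ n"
      by simp
    then show ?thesis unfolding circ_moment_Gamma imp_coeff_def .
  qed
  ultimately show ?thesis by simp
qed

lemma imp_coeff_even: "imp_coeff (2 * m) = 1 / (fact m * fact (m + 1))"
  using Gamma_fact[of m, where 'a=real] Gamma_fact[of "m + 1", where 'a=real]
  by (simp add: imp_coeff_def add_ac)

lemma imp_coeff_odd:
  "of_real (imp_coeff (2 * m + 1)) = (1 / (Gamma (of_nat m + 3 / 2) * Gamma (of_nat m + of_nat 1 + 3 / 2)) :: complex)"
proof -
  have 1: "Gamma (of_nat m + 3 / 2 :: complex) = of_real (Gamma (real m + 3 / 2))"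
    by (simp flip: Gamma_complex_of_real)
  have 2: "Gamma (of_nat m + of_nat 1 + 3 / 2 :: complex) = of_real (Gamma (real m + 1 + 3 / 2))"
    by (simp flip: Gamma_complex_of_real)
  have 3: "real (2 * m + 1) / 2 + 1 = real m + 3 / 2" "real (2 * m + 1) / 2 + 2 = real m + 1 + 3 / 2"
    by (simp_all add: field_simps)
  show ?thesis unfolding imp_coeff_def 1 2 3 by simp
qed

text \<open>Even and odd terms of the series for 1 - \<open>imp_fun\<close> w sum to J_1(2w) / w and
  - i H_1(2w) / w respectively.\<close>

lemma impedance_expr_eq:
  assumes "w \<noteq> 0"
  shows "1 - bessel_J 1 (2 * w) / w + \<i> * (struve_H 1 (2 * w) / w) = imp_fun w"
proof -
  define c where "c n = of_real (imp_coeff n) * (- \<i> * w) ^ n" for n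
  have c: "c sums (1 - imp_fun w)" unfolding c_def by (rule imp_fun_sums)
  have "summable (\<lambda>n. of_real (imp_coeff n) * (- \<i> * of_real (cmod w + 1)) ^ n :: complex)"
    by (rule sums_summable[OF imp_fun_sums])
  moreover have "norm (- \<i> * w) < norm (- \<i> * complex_of_real (cmod w + 1))"
    unfolding norm_mult norm_of_real by simp
  ultimately have nc: "summable (\<lambda>n. norm (c n))"
    unfolding c_def by (rule powser_insidea)
  have e: "(- \<i> * w) ^ (2 * m) = (-1) ^ m * w ^ (2 * m)" for m
  proof -
    have "(- \<i> * w) ^ (2 * m) = ((-1) * w\<^sup>2) ^ m"
      unfolding power_mult by (simp add: power2_eq_square mult_ac)
    then show ?thesis by (simp only: power_mult_distrib power_mult)
  qed
  have even: "(\<lambda>m. c (2 * m)) sums (bessel_J 1 (2 * w) / w)"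
  proof -
    have "summable (\<lambda>m. norm (c (2 * m)))"
      using summable_reindex[OF nc, of "\<lambda>m. 2 * m"] by (simp add: o_def inj_def)
    then have "summable (\<lambda>m. c (2 * m))" by (rule summable_norm_cancel)
    then have "(\<lambda>m. c (2 * m) * w) sums (suminf (\<lambda>m. c (2 * m)) * w)"
      by (intro sums_mult2 summable_sums)
    moreover have "c (2 * m) * w = (-1) ^ m / (fact m * fact (m + 1)) * ((2 * w) / 2) ^ (2 * m + 1)" for m
      unfolding c_def e imp_coeff_even by simp
    ultimately have "bessel_J 1 (2 * w) = suminf (\<lambda>m. c (2 * m)) * w"
      unfolding bessel_J_def by (simp add: sums_iff)
    then show ?thesis using \<open>summable (\<lambda>m. c (2 * m))\<close> assms by (simp add: summable_sums)
  qed
  have odd: "(\<lambda>m. c (2 * m + 1)) sums (- \<i> * (struve_H 1 (2 * w) / w))"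
  proof -
    have "summable (\<lambda>m. norm (c (2 * m + 1)))"
      using summable_reindex[OF nc, of "\<lambda>m. 2 * m + 1"] by (simp add: o_def inj_def)
    then have s: "summable (\<lambda>m. c (2 * m + 1))" by (rule summable_norm_cancel)
    then have "(\<lambda>m. c (2 * m + 1) * (\<i> * w)) sums (suminf (\<lambda>m. c (2 * m + 1)) * (\<i> * w))"
      by (intro sums_mult2 summable_sums)
    moreover have "c (2 * m + 1) * (\<i> * w) = (-1) ^ m / (Gamma (of_nat m + 3 / 2) * Gamma (of_nat m + of_nat 1 + 3 / 2)) * ((2 * w) / 2) ^ (2 * m + 1 + 1)" for m
    proof -
      have "(- \<i> * w) ^ (2 * m + 1) * (\<i> * w) = (-1) ^ m * w ^ (2 * m + 1 + 1)"
        by (simp only: power_add e power_one_right) (simp add: mult_ac)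
      then show ?thesis unfolding c_def imp_coeff_odd mult.assoc by simp
    qed
    ultimately have "struve_H 1 (2 * w) = suminf (\<lambda>m. c (2 * m + 1)) * (\<i> * w)"
      unfolding struve_H_def by (simp add: sums_iff)
    then have "- \<i> * (struve_H 1 (2 * w) / w) = suminf (\<lambda>m. c (2 * m + 1))"
      using assms by (simp add: field_simps)
    then show ?thesis using s by (simp add: summable_sums)
  qed
  have "(\<lambda>m. \<Sum>n\<in>{m * 2..<m * 2 + 2}. c n) sums (1 - imp_fun w)"
    by (rule sums_group[OF c]) simp
  moreover have "(\<Sum>n\<in>{m * 2..<m * 2 + 2}. c n) = c (2 * m) + c (2 * m + 1)" for m
    by (simp add: atLeastLessThanSuc mult.commute add.commute)
  ultimately have "(\<lambda>m. c (2 * m) + c (2 * m + 1)) sums (1 - imp_fun w)" by simp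
  from sums_unique2[OF this sums_add[OF even odd]] show ?thesis
    by (simp add: algebra_simps)
qed

section \<open>Symmetry and positivity of the impedance\<close>

lemma imp_fun_has_integral:
  "((\<lambda>t. of_real (sqrt (1 - t\<^sup>2)) * (1 - exp (- 2 * \<i> * w * of_real t))) has_integral
     (of_real (pi / 4) * imp_fun w)) {0..1}"
proof -
  have "(\<lambda>t. of_real (sqrt (1 - t\<^sup>2)) * (1 - exp (- 2 * \<i> * w * of_real t))) integrable_on {0..1}"
    by (intro integrable_continuous_real continuous_intros)
  moreover have "of_real (pi / 4) * imp_fun w = integral {0..1} (\<lambda>t. of_real (sqrt (1 - t\<^sup>2)) * (1 - exp (- 2 * \<i> * w * of_real t)))"
    by (simp add: imp_fun_def)
  ultimately show ?thesis by (simp only: integrable_integral)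
qed

lemma imp_fun_holomorphic: "imp_fun holomorphic_on UNIV"
proof -
  let ?f = "\<lambda>w t. of_real (sqrt (1 - t\<^sup>2)) * (1 - exp (- 2 * \<i> * w * of_real t))"
  have "(\<lambda>w. integral (cbox 0 1) (?f w)) holomorphic_on UNIV"
  proof (rule leibniz_rule_holomorphic)
    show "((\<lambda>w. ?f w t) has_field_derivative
      of_real (sqrt (1 - t\<^sup>2)) * (2 * \<i> * of_real t * exp (- 2 * \<i> * w * of_real t))) (at w within UNIV)" for w t
      by (auto intro!: derivative_eq_intros)
    show "?f w integrable_on cbox 0 1" for w
      by (intro integrable_continuous continuous_intros)
    show "continuous_on (UNIV \<times> cbox 0 1) (\<lambda>(w, t). of_real (sqrt (1 - t\<^sup>2)) * (2 * \<i> * of_real t * exp (- 2 * \<i> * w * of_real t)))"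
      unfolding case_prod_unfold by (intro continuous_intros)
  qed auto
  then show ?thesis unfolding imp_fun_def by (intro holomorphic_intros) simp
qed

lemma impedance_eq:
  assumes "0 < \<rho>"
  shows "impedance \<rho> k = imp_fun (of_real \<rho> * k)"
  unfolding impedance_def
proof (rule remove_sings_eqI)
  let ?g = "\<lambda>k. 1 - bessel_J 1 (2 * k * of_real \<rho>) / (k * of_real \<rho>)
            + \<i> * (struve_H 1 (2 * k * of_real \<rho>) / (k * of_real \<rho>))"
  have "eventually (\<lambda>x. x \<noteq> 0) (at k)" by (simp add: eventually_neq_at_within)
  then have "eventually (\<lambda>x. imp_fun (of_real \<rho> * x) = ?g x) (at k)"
  proof eventually_elim
    case (elim x)
    then show ?case using impedance_expr_eq[of "x * of_real \<rho>"] assms by (simp add: mult_ac)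
  qed
  moreover have "isCont (\<lambda>k. imp_fun (of_real \<rho> * k)) k"
  proof -
    have "(imp_fun \<circ> (\<lambda>k. of_real \<rho> * k)) holomorphic_on UNIV"
      by (intro holomorphic_on_compose holomorphic_intros holomorphic_on_subset[OF imp_fun_holomorphic]) auto
    then show ?thesis
      using holomorphic_on_imp_continuous_on continuous_on_eq_continuous_at[OF open_UNIV] by (fastforce simp: o_def)
  qed
  ultimately show "?g \<midarrow>k\<rightarrow> imp_fun (of_real \<rho> * k)"
    by (auto simp: isCont_def cong: filterlim_cong intro: Lim_transform_eventually)
qed

lemma imp_fun_0: "imp_fun 0 = 0"
  by (simp add: imp_fun_def)

lemma imp_fun_reflect: "imp_fun (- cnj w) = cnj (imp_fun w)"
  unfolding imp_fun_def by (simp add: integral_cnj exp_cnj)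

lemma Re_imp_fun_has_integral:
  "((\<lambda>t. sqrt (1 - t\<^sup>2) * (1 - exp (2 * t * Im w) * cos (2 * t * Re w))) has_integral
     (pi / 4 * Re (imp_fun w))) {0..1}"
proof -
  have "((\<lambda>t. Re (of_real (sqrt (1 - t\<^sup>2)) * (1 - exp (- 2 * \<i> * w * of_real t)))) has_integral
     Re (of_real (pi / 4) * imp_fun w)) {0..1}"
    using has_integral_linear[OF imp_fun_has_integral bounded_linear_Re] by (simp add: o_def)
  then show ?thesis by (simp add: Re_exp mult_ac)
qed

text \<open>In the closed lower half plane exp (2 t Im w) cos (2 t Re w) is at most 1, so the
  integrand is nonnegative. Being continuous, it would have to vanish identically for the integral
  to be 0, and a small t rules this out.\<close>

lemma Re_imp_fun_pos:
  assumes "Im w \<le> 0" "w \<noteq> 0"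
  shows "0 < Re (imp_fun w)"
proof -
  let ?f = "\<lambda>t. sqrt (1 - t\<^sup>2) * (1 - exp (2 * t * Im w) * cos (2 * t * Re w))"
  have le1: "exp (2 * t * Im w) * cos (2 * t * Re w) \<le> 1" if "0 \<le> t" for t
  proof -
    have "exp (2 * t * Im w) * cos (2 * t * Re w) \<le> exp (2 * t * Im w) * 1"
      by (intro mult_left_mono) auto
    also have "\<dots> \<le> 1" using that assms(1) by (simp add: mult_nonneg_nonpos)
    finally show ?thesis .
  qed
  have nn: "0 \<le> ?f t" if "t \<in> {0..1}" for t
    using le1[of t] that by (simp add: abs_square_le_1)
  have I: "integral {0..1} ?f = pi / 4 * Re (imp_fun w)"
    by (rule integral_unique[OF Re_imp_fun_has_integral])
  have "0 \<le> integral {0..1} ?f"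
    using nn by (intro integral_nonneg has_integral_integrable[OF Re_imp_fun_has_integral]) auto
  moreover have "integral {0..1} ?f \<noteq> 0"
  proof
    assume "integral {0..1} ?f = 0"
    moreover have "continuous_on {0..1} ?f" by (intro continuous_intros)
    ultimately have "\<forall>t\<in>{0..1}. ?f t = 0"
      by (subst (asm) integral_eq_0_iff) (use nn in simp_all)
    then have z: "?f t = 0" if "t \<in> {0..1}" for t using that by blast
    \<comment> \<open>With this t the angle 2 t Re w has modulus below 1, where the cosine takes the
      value 1 only at 0.\<close>
    define t where "t = 1 / (2 * (1 + \<bar>Re w\<bar>))"
    have t: "0 < t" "t < 1" by (auto simp: t_def field_simps)
    have "sqrt (1 - t\<^sup>2) \<noteq> 0" using t by (simp add: power2_eq_1_iff)
    then have e: "exp (2 * t * Im w) * cos (2 * t * Re w) = 1" using z[of t] t by simp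
    have e1: "exp (2 * t * Im w) \<le> 1" using assms(1) t by (simp add: mult_nonneg_nonpos)
    show False
    proof (cases "Im w = 0")
      case False
      then have "exp (2 * t * Im w) < 1" using assms(1) t by (simp add: mult_pos_neg)
      moreover have "exp (2 * t * Im w) * cos (2 * t * Re w) \<le> exp (2 * t * Im w) * 1"
        by (intro mult_left_mono) auto
      ultimately show False using e by simp
    next
      case True
      then have "Re w \<noteq> 0" using assms(2) by (simp add: complex_eq_iff)
      have "cos \<bar>2 * t * Re w\<bar> = 1" using e True by simp
      moreover have "\<bar>2 * t * Re w\<bar> < 1" by (simp add: t_def abs_mult field_simps)
      moreover have "0 < \<bar>2 * t * Re w\<bar>" using t \<open>Re w \<noteq> 0\<close> by simp
      ultimately show False using cos_monotone_0_pi[of 0 "\<bar>2 * t * Re w\<bar>"] pi_gt3 by auto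
    qed
  qed
  ultimately have "0 < pi / 4 * Re (imp_fun w)" unfolding I by linarith
  then show ?thesis by (simp add: zero_less_mult_iff)
qed

text \<open>Minus the impedance at the point i s. With this sign it is positive and exponentially
  large on the upper half of the axis.\<close>

definition imp_real :: "real \<Rightarrow> real" where
  "imp_real s = 4 / pi * integral {0..1} (\<lambda>t. sqrt (1 - t\<^sup>2) * (exp (2 * s * t) - 1))"

lemma imp_fun_imag: "imp_fun (\<i> * of_real s) = - of_real (imp_real s)"
proof -
  have i: "(\<lambda>t. sqrt (1 - t\<^sup>2) * (exp (2 * s * t) - 1)) integrable_on {0..1}"
    by (intro integrable_continuous_real continuous_intros)
  have "integral {0..1} (\<lambda>t. of_real (sqrt (1 - t\<^sup>2)) * (1 - exp (- 2 * \<i> * (\<i> * of_real s) * of_real t)))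
    = - (of_real (integral {0..1} (\<lambda>t. sqrt (1 - t\<^sup>2) * (exp (2 * s * t) - 1))) :: complex)"
  proof (rule integral_unique)
    have "((\<lambda>t. - of_real (sqrt (1 - t\<^sup>2) * (exp (2 * s * t) - 1)) :: complex) has_integral
       - of_real (integral {0..1} (\<lambda>t. sqrt (1 - t\<^sup>2) * (exp (2 * s * t) - 1)))) {0..1}"
      by (intro has_integral_neg has_integral_of_real integrable_integral i)
    moreover have "- of_real (sqrt (1 - t\<^sup>2) * (exp (2 * s * t) - 1)) =
       of_real (sqrt (1 - t\<^sup>2)) * (1 - exp (- 2 * \<i> * (\<i> * of_real s) * of_real t))" for t
    proof -
      have "- 2 * \<i> * (\<i> * of_real s) * of_real t = of_real (2 * s * t)" by simp
      then show ?thesis by (simp only: exp_of_real) (simp add: algebra_simps)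
    qed
    ultimately show "((\<lambda>t. of_real (sqrt (1 - t\<^sup>2)) * (1 - exp (- 2 * \<i> * (\<i> * of_real s) * of_real t))) has_integral
       - of_real (integral {0..1} (\<lambda>t. sqrt (1 - t\<^sup>2) * (exp (2 * s * t) - 1)))) {0..1}" by simp
  qed
  then show ?thesis by (simp add: imp_fun_def imp_real_def)
qed

section \<open>Bounds for the impedance on the imaginary axis\<close>

lemma imp_real_integrable: "(\<lambda>t. sqrt (1 - t\<^sup>2) * (exp (2 * s * t) - 1)) integrable_on {0..1}"
  by (intro integrable_continuous_real continuous_intros)

lemma imp_real_mono: "s \<le> s' \<Longrightarrow> imp_real s \<le> imp_real s'"
  unfolding imp_real_def
  by (intro mult_left_mono integral_le imp_real_integrable)
     (auto simp: abs_square_le_1 intro!: mult_left_mono mult_right_mono)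

lemma imp_real_ge: "- 1 \<le> imp_real s"
proof -
  have "integral {0..1} (\<lambda>t. - sqrt (1 - t\<^sup>2)) \<le> integral {0..1} (\<lambda>t. sqrt (1 - t\<^sup>2) * (exp (2 * s * t) - 1))"
  proof (intro integral_le imp_real_integrable)
    show "- sqrt (1 - t\<^sup>2) \<le> sqrt (1 - t\<^sup>2) * (exp (2 * s * t) - 1)" if "t \<in> {0..1}" for t
      using that by (simp add: right_diff_distrib abs_square_le_1)
  qed (intro integrable_continuous_real continuous_intros)
  moreover have "integral {0..1} (\<lambda>t. - sqrt (1 - t\<^sup>2)) = - (pi / 4)"
    using circ_moment_0 by (simp add: circ_moment_def)
  ultimately have "4 / pi * - (pi / 4) \<le> imp_real s" unfolding imp_real_def by (intro mult_left_mono) auto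
  then show ?thesis by simp
qed

lemma imp_real_le:
  assumes "0 \<le> s" shows "imp_real s \<le> exp (2 * s)"
proof -
  have "integral {0..1} (\<lambda>t. sqrt (1 - t\<^sup>2) * (exp (2 * s * t) - 1)) \<le> integral {0..1} (\<lambda>t. sqrt (1 - t\<^sup>2) * exp (2 * s))"
  proof (intro integral_le imp_real_integrable)
    show "sqrt (1 - t\<^sup>2) * (exp (2 * s * t) - 1) \<le> sqrt (1 - t\<^sup>2) * exp (2 * s)" if "t \<in> {0..1}" for t
    proof (intro mult_left_mono)
      have "2 * s * t \<le> 2 * s" using assms that by (simp add: mult_left_le)
      then have "exp (2 * s * t) \<le> exp (2 * s)" by simp
      then show "exp (2 * s * t) - 1 \<le> exp (2 * s)" by linarith
    qed (use that in \<open>simp add: abs_square_le_1\<close>)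
  qed (intro integrable_continuous_real continuous_intros)
  also have "\<dots> = pi / 4 * exp (2 * s)"
    using circ_moment_0 by (simp add: circ_moment_def)
  finally have "imp_real s \<le> 4 / pi * (pi / 4 * exp (2 * s))" unfolding imp_real_def by (intro mult_left_mono) auto
  then show ?thesis by simp
qed

text \<open>This is exp x - 1 >= x under the integral; the constant is (4 / pi) times 2 times the
  first moment 1/3.\<close>

lemma imp_real_lower_linear:
  assumes "0 \<le> s" shows "8 / (3 * pi) * s \<le> imp_real s"
proof -
  have "integral {0..1} (\<lambda>t. 2 * s * (t ^ 1 * sqrt (1 - t\<^sup>2))) \<le> integral {0..1} (\<lambda>t. sqrt (1 - t\<^sup>2) * (exp (2 * s * t) - 1))"
  proof (intro integral_le imp_real_integrable)
    show "2 * s * (t ^ 1 * sqrt (1 - t\<^sup>2)) \<le> sqrt (1 - t\<^sup>2) * (exp (2 * s * t) - 1)" if "t \<in> {0..1}" for t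
    proof -
      have "2 * s * t \<le> exp (2 * s * t) - 1" using exp_ge_add_one_self[of "2 * s * t"] by linarith
      then have "sqrt (1 - t\<^sup>2) * (2 * s * t) \<le> sqrt (1 - t\<^sup>2) * (exp (2 * s * t) - 1)"
        using that by (intro mult_left_mono) (auto simp: abs_square_le_1)
      then show ?thesis by (simp add: mult_ac)
    qed
  qed (intro integrable_continuous_real continuous_intros)
  moreover have "integral {0..1} (\<lambda>t. 2 * s * (t ^ 1 * sqrt (1 - t\<^sup>2))) = 2 * s * (1 / 3)"
    using has_integral_mult_right[OF circ_moment[of 1], of "2 * s"] unfolding circ_moment_1 by (rule integral_unique)
  ultimately have "2 * s * (1 / 3) \<le> integral {0..1} (\<lambda>t. sqrt (1 - t\<^sup>2) * (exp (2 * s * t) - 1))" by linarith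
  then have "4 / pi * (2 * s * (1 / 3)) \<le> imp_real s" unfolding imp_real_def by (intro mult_left_mono) auto
  then show ?thesis by (simp add: mult_ac)
qed

lemma imp_real_neg:
  assumes "s < 0" shows "imp_real s < 0"
proof -
  have "0 < Re (imp_fun (\<i> * of_real s))" using assms by (intro Re_imp_fun_pos) auto
  then show ?thesis by (simp add: imp_fun_imag)
qed

text \<open>The exact growth is exp (2 s) times a power of s. Keeping only the part of the integral
  over t >= 1 - \<eta> yields every smaller exponential rate without that power, and rates are all
  that will be compared.\<close>

lemma imp_real_lower_exp:
  assumes "0 < \<eta>" "\<eta> < 1"
  obtains C where "0 < C" "\<And>s. 0 \<le> s \<Longrightarrow> C * (exp (2 * s * (1 - \<eta>)) - 1) \<le> imp_real s"
proof
  define J where "J = integral {1 - \<eta>..1} (\<lambda>t. sqrt (1 - t\<^sup>2))"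
  have cont: "continuous_on {1 - \<eta>..1} (\<lambda>t. sqrt (1 - t\<^sup>2))" by (intro continuous_intros)
  have nn: "0 \<le> sqrt (1 - t\<^sup>2)" if "t \<in> {0..1}" for t :: real using that by (simp add: abs_square_le_1)
  have "0 \<le> J" unfolding J_def by (intro integral_nonneg integrable_continuous_real cont nn) (use assms in auto)
  moreover have "J \<noteq> 0"
  proof
    assume "J = 0"
    then have "sqrt (1 - (1 - \<eta>)\<^sup>2) = 0"
      using integral_eq_0_iff[OF cont] assms nn unfolding J_def by auto
    then have "(1 - \<eta>)\<^sup>2 = 1" by simp
    then show False using assms by (simp add: power2_eq_1_iff)
  qed
  ultimately have "0 < J" by simp
  then show "0 < 4 / pi * J" by simp
  fix s :: real assume s: "0 \<le> s"
  let ?f = "\<lambda>t. sqrt (1 - t\<^sup>2) * (exp (2 * s * t) - 1)"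
  have "(exp (2 * s * (1 - \<eta>)) - 1) * J = integral {1 - \<eta>..1} (\<lambda>t. (exp (2 * s * (1 - \<eta>)) - 1) * sqrt (1 - t\<^sup>2))"
    unfolding J_def by simp
  also have "\<dots> \<le> integral {1 - \<eta>..1} ?f"
  proof (intro integral_le)
    show "(exp (2 * s * (1 - \<eta>)) - 1) * sqrt (1 - t\<^sup>2) \<le> ?f t" if "t \<in> {1 - \<eta>..1}" for t
    proof -
      have "exp (2 * s * (1 - \<eta>)) \<le> exp (2 * s * t)" using that s by (auto intro: mult_left_mono)
      then show ?thesis using nn[of t] that assms by (simp add: mult.commute[of _ "sqrt (1 - t\<^sup>2)"] mult_left_mono)
    qed
  qed (intro integrable_continuous_real continuous_intros)+
  also have "\<dots> \<le> integral {0..1} ?f"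
    by (rule integral_subset_le)
       (use assms s nn in \<open>auto intro!: integrable_continuous_real continuous_intros mult_nonneg_nonneg\<close>)
  finally have "4 / pi * ((exp (2 * s * (1 - \<eta>)) - 1) * J) \<le> imp_real s"
    unfolding imp_real_def by (intro mult_left_mono) auto
  then show "4 / pi * J * (exp (2 * s * (1 - \<eta>)) - 1) \<le> imp_real s" by (simp add: mult_ac)
qed

lemma exp_type_imp_fun: "exp_type imp_fun"
proof (rule exp_typeI[OF imp_fun_holomorphic])
  fix w
  have "norm (integral {0..1} (\<lambda>t. of_real (sqrt (1 - t\<^sup>2)) * (1 - exp (- 2 * \<i> * w * of_real t))))
    \<le> 2 * exp (2 * cmod w) * (1 - 0)"
  proof (rule integral_bound)
    show "norm (of_real (sqrt (1 - t\<^sup>2)) * (1 - exp (- 2 * \<i> * w * of_real t))) \<le> 2 * exp (2 * cmod w)" if "t \<in> {0..1}" for t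
    proof -
      have "norm (exp (- 2 * \<i> * w * of_real t)) \<le> exp (norm (- 2 * \<i> * w * of_real t))" by (rule norm_exp)
      also have "\<dots> \<le> exp (2 * cmod w)" using that by (simp add: norm_mult mult_left_le)
      finally have "norm (1 - exp (- 2 * \<i> * w * of_real t)) \<le> 1 + exp (2 * cmod w)"
        using norm_triangle_ineq4[of 1 "exp (- 2 * \<i> * w * of_real t)"] unfolding norm_one by linarith
      also have "\<dots> \<le> 2 * exp (2 * cmod w)" by simp
      finally have a: "norm (1 - exp (- 2 * \<i> * w * of_real t)) \<le> 2 * exp (2 * cmod w)" .
      have "norm (of_real (sqrt (1 - t\<^sup>2)) :: complex) \<le> 1" using that by (simp add: abs_square_le_1)
      from mult_mono[OF this a] show ?thesis by (simp add: norm_mult)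
    qed
  qed (auto intro!: continuous_intros)
  moreover have "cmod (of_real (4 / pi)) = 4 / pi" unfolding norm_of_real by simp
  ultimately have "cmod (imp_fun w) \<le> 4 / pi * (2 * exp (2 * cmod w) * (1 - 0))"
    unfolding imp_fun_def norm_mult by (intro mult_mono) auto
  then show "cmod (imp_fun w) \<le> 8 / pi * exp (2 * cmod w)" by simp
qed

text \<open>The linear lower bound keeps the difference quotients along i / (n + 1) away from 0. So
  the impedance has a simple zero at the origin, which \<open>imp_fun_factor\<close> divides
  out.\<close>

lemma deriv_imp_fun_0: "deriv imp_fun 0 \<noteq> 0"
proof
  assume "deriv imp_fun 0 = 0"
  have "(imp_fun has_field_derivative deriv imp_fun 0) (at 0)"
    using imp_fun_holomorphic holomorphic_derivI[OF _ open_UNIV] by blast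
  then have "((\<lambda>w. imp_fun w / w) \<longlongrightarrow> 0) (at 0)"
    using \<open>deriv imp_fun 0 = 0\<close> by (simp add: has_field_derivative_iff imp_fun_0)
  moreover have "filterlim (\<lambda>n. \<i> * of_real (inverse (real (Suc n)))) (at 0) sequentially"
  proof (rule filterlim_atI)
    have "((\<lambda>n. inverse (real (Suc n))) \<longlongrightarrow> 0) sequentially" by (rule LIMSEQ_inverse_real_of_nat)
    then have "((\<lambda>n. \<i> * of_real (inverse (real (Suc n)))) \<longlongrightarrow> \<i> * of_real 0) sequentially" by (intro tendsto_intros)
    then show "((\<lambda>n. \<i> * of_real (inverse (real (Suc n)))) \<longlongrightarrow> 0) sequentially" by simp
    have "\<i> * of_real (inverse (real (Suc n))) \<noteq> 0" for n by (simp del: of_nat_Suc)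
    then show "\<forall>\<^sub>F n in sequentially. \<i> * of_real (inverse (real (Suc n))) \<noteq> 0" by simp
  qed
  ultimately have "((\<lambda>n. imp_fun (\<i> * of_real (inverse (real (Suc n)))) / (\<i> * of_real (inverse (real (Suc n))))) \<longlongrightarrow> 0) sequentially"
    by (rule filterlim_compose)
  then have "((\<lambda>n. norm (imp_fun (\<i> * of_real (inverse (real (Suc n)))) / (\<i> * of_real (inverse (real (Suc n)))))) \<longlongrightarrow> 0) sequentially"
    by (rule tendsto_norm_zero)
  moreover have "8 / (3 * pi) \<le> norm (imp_fun (\<i> * of_real (inverse (real (Suc n)))) / (\<i> * of_real (inverse (real (Suc n)))))" for n
  proof -
    define s where "s = inverse (real (Suc n))"
    have "0 < s" by (simp add: s_def)
    then have "8 / (3 * pi) \<le> imp_real s / s" using imp_real_lower_linear[of s] by (simp only: pos_le_divide_eq)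
    also have "\<dots> \<le> norm (imp_fun (\<i> * of_real s) / (\<i> * of_real s))"
      using \<open>0 < s\<close> by (simp add: imp_fun_imag norm_divide norm_mult divide_right_mono)
    finally show ?thesis by (simp add: s_def)
  qed
  ultimately have "8 / (3 * pi) \<le> (0::real)"
    by (intro LIMSEQ_le_const) auto
  then show False using pi_gt_zero by (simp add: divide_le_0_iff)
qed

section \<open>Solutions of the pressure equation\<close>

text \<open>Coefficients of a solution as a power series in - k^2: the recursion says (p y_(n+1)')'
  = p y_n, with zero value and zero flux at 0 for every later coefficient.\<close>

primrec iter_sol :: "(real \<Rightarrow> real) \<Rightarrow> (real \<Rightarrow> real) \<Rightarrow> nat \<Rightarrow> real \<Rightarrow> real" where
  "iter_sol p g 0 = g"
| "iter_sol p g (Suc n) = (\<lambda>x. integral {0..x} (\<lambda>y. integral {0..y} (\<lambda>s. p s * iter_sol p g n s) / p y))"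

text \<open>Note the shift of index: this is p times the derivative of coefficient n + 1. Therefore
  the flux of \<open>series_sol\<close> is - k^2 times \<open>series_flux\<close>, plus the flux of
  \<open>g\<close>.\<close>

definition iter_flux :: "(real \<Rightarrow> real) \<Rightarrow> (real \<Rightarrow> real) \<Rightarrow> nat \<Rightarrow> real \<Rightarrow> real" where
  "iter_flux p g n x = integral {0..x} (\<lambda>s. p s * iter_sol p g n s)"

definition series_sol :: "(real \<Rightarrow> real) \<Rightarrow> (real \<Rightarrow> real) \<Rightarrow> complex \<Rightarrow> real \<Rightarrow> complex" where
  "series_sol p g k x = (\<Sum>n. of_real (iter_sol p g n x) * (- k\<^sup>2) ^ n)"

definition series_flux :: "(real \<Rightarrow> real) \<Rightarrow> (real \<Rightarrow> real) \<Rightarrow> complex \<Rightarrow> real \<Rightarrow> complex" where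
  "series_flux p g k x = (\<Sum>n. of_real (iter_flux p g n x) * (- k\<^sup>2) ^ n)"

text \<open>The equation \<open>(p y')' + k\<^sup>2 p y = 0\<close> as a first order system with \<open>w = p y'\<close>.\<close>

definition ode_sol :: "real \<Rightarrow> (real \<Rightarrow> real) \<Rightarrow> complex \<Rightarrow> (real \<Rightarrow> complex) \<Rightarrow> (real \<Rightarrow> complex) \<Rightarrow> bool" where
  "ode_sol l p k y w \<longleftrightarrow> (\<forall>x\<in>{0..l}.
     (y has_vector_derivative w x / of_real (p x)) (at x within {0..l}) \<and>
     (w has_vector_derivative - k\<^sup>2 * of_real (p x) * y x) (at x within {0..l}))"

section \<open>Termwise differentiation\<close>

lemma has_vector_derivative_series:
  fixes f :: "nat \<Rightarrow> real \<Rightarrow> 'a :: banach"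
  assumes "convex S"
    and "\<And>n x. x \<in> S \<Longrightarrow> (f n has_vector_derivative f' n x) (at x within S)"
    and "uniform_limit S (\<lambda>n x. \<Sum>i<n. f' i x) g' sequentially"
    and "x0 \<in> S" "summable (\<lambda>n. f n x0)"
  shows "\<exists>g. \<forall>x\<in>S. (\<lambda>n. f n x) sums g x \<and> (g has_vector_derivative g' x) (at x within S)"
  unfolding has_vector_derivative_def
proof (rule has_derivative_series)
  show "\<forall>\<^sub>F n in sequentially.
       \<forall>x\<in>S. \<forall>h. norm ((\<Sum>i<n. h *\<^sub>R f' i x) - h *\<^sub>R g' x) \<le> e * norm h" if "e > 0" for e
    unfolding eventually_sequentially
  proof -
    from that assms(3) obtain N where N: "\<And>n x. n \<ge> N \<Longrightarrow> x \<in> S \<Longrightarrow> norm ((\<Sum>i<n. f' i x) - g' x) < e"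
      unfolding uniform_limit_iff eventually_at_top_linorder dist_norm by blast
    have "norm ((\<Sum>i<n. h *\<^sub>R f' i x) - h *\<^sub>R g' x) \<le> e * norm h" if "n \<ge> N" "x \<in> S" for n x h
    proof -
      have "norm ((\<Sum>i<n. h *\<^sub>R f' i x) - h *\<^sub>R g' x) = norm ((\<Sum>i<n. f' i x) - g' x) * \<bar>h\<bar>"
        by (simp flip: scaleR_sum_right scaleR_diff_right)
      also have "\<dots> \<le> e * norm h" using N[OF that] by (simp add: mult_right_mono less_imp_le)
      finally show ?thesis .
    qed
    then show "\<exists>N. \<forall>n\<ge>N. \<forall>x\<in>S. \<forall>h. norm ((\<Sum>i<n. h *\<^sub>R f' i x) - h *\<^sub>R g' x) \<le> e * norm h" by blast
  qed
qed (use assms in \<open>auto simp: has_vector_derivative_def\<close>)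

lemma power_series_derivative:
  fixes h h' :: "nat \<Rightarrow> real \<Rightarrow> real" and a :: complex
  assumes d: "\<And>n x. x \<in> {0..l} \<Longrightarrow> (h n has_real_derivative h' n x) (at x within {0..l})"
    and b: "\<And>n x. x \<in> {0..l} \<Longrightarrow> \<bar>h' n x\<bar> \<le> C n"
    and C: "\<And>A. 0 \<le> A \<Longrightarrow> summable (\<lambda>n. C n * A ^ n)"
    and s0: "summable (\<lambda>n. of_real (h n 0) * a ^ n)"
    and x: "x \<in> {0..l}"
  shows "((\<lambda>x. \<Sum>n. of_real (h n x) * a ^ n) has_vector_derivative (\<Sum>n. of_real (h' n x) * a ^ n)) (at x within {0..l})"
proof -
  have "uniform_limit {0..l} (\<lambda>n x. \<Sum>i<n. of_real (h' i x) * a ^ i) (\<lambda>x. \<Sum>n. of_real (h' n x) * a ^ n) sequentially"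
  proof (rule Weierstrass_m_test)
    show "norm (of_real (h' n x) * a ^ n) \<le> C n * cmod a ^ n" if "x \<in> {0..l}" for n x
      using b[OF that] by (simp add: norm_mult norm_power mult_right_mono)
  qed (simp add: C)
  moreover have "((\<lambda>x. of_real (h n x) * a ^ n) has_vector_derivative of_real (h' n x) * a ^ n) (at x within {0..l})"
    if "x \<in> {0..l}" for n x
    using d[OF that] by (intro has_vector_derivative_mult_left has_vector_derivative_of_real)
       (simp add: has_real_derivative_iff_has_vector_derivative)
  ultimately have "\<exists>g. \<forall>x\<in>{0..l}. (\<lambda>n. of_real (h n x) * a ^ n) sums g x \<and> (g has_vector_derivative (\<Sum>n. of_real (h' n x) * a ^ n)) (at x within {0..l})"
    by (intro has_vector_derivative_series[of "{0..l}" _ "\<lambda>n x. of_real (h' n x) * a ^ n" _ 0])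
       (use s0 x in auto)
  then obtain g where g: "\<And>x. x \<in> {0..l} \<Longrightarrow> (\<lambda>n. of_real (h n x) * a ^ n) sums g x \<and> (g has_vector_derivative (\<Sum>n. of_real (h' n x) * a ^ n)) (at x within {0..l})"
    by (elim exE) (rule that, erule bspec)
  show ?thesis
    by (rule has_vector_derivative_transform[OF x _ conjunct2[OF g[OF x]]]) (use g in \<open>auto simp: sums_iff\<close>)
qed

section \<open>Series solutions for a general weight\<close>

locale weight =
  fixes l :: real and p :: "real \<Rightarrow> real"
  assumes l_pos: "0 < l" and p_cont: "continuous_on {0..l} p" and p_pos: "\<And>x. x \<in> {0..l} \<Longrightarrow> 0 < p x"
begin

lemma weight_bounds:
  obtains L \<delta> where "0 < \<delta>" "0 < L" "\<And>x. x \<in> {0..l} \<Longrightarrow> \<delta> \<le> p x" "\<And>x. x \<in> {0..l} \<Longrightarrow> p x \<le> L"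
proof -
  have ne: "{0..l} \<noteq> {}" using l_pos by simp
  obtain x1 where x1: "x1 \<in> {0..l}" "\<And>x. x \<in> {0..l} \<Longrightarrow> p x1 \<le> p x"
    using continuous_attains_inf[OF compact_Icc ne p_cont] by blast
  obtain x2 where x2: "x2 \<in> {0..l}" "\<And>x. x \<in> {0..l} \<Longrightarrow> p x \<le> p x2"
    using continuous_attains_sup[OF compact_Icc ne p_cont] by blast
  show ?thesis using that[of "p x1" "p x2"] x1 x2 p_pos by auto
qed

context
  fixes g :: "real \<Rightarrow> real" assumes g_cont: "continuous_on {0..l} g"
begin

lemma iter_cont: "continuous_on {0..l} (iter_sol p g n)" "continuous_on {0..l} (iter_flux p g n)"
proof -
  have fl: "continuous_on {0..l} (iter_flux p g n)" if "continuous_on {0..l} (iter_sol p g n)" for n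
    unfolding iter_flux_def
    by (intro indefinite_integral_continuous_1 integrable_continuous_real continuous_intros p_cont that)
  have "continuous_on {0..l} (iter_sol p g n)" for n
  proof (induction n)
    case (Suc n)
    have "continuous_on {0..l} (\<lambda>y. iter_flux p g n y / p y)"
      using p_pos by (intro continuous_intros fl Suc p_cont) force
    then have "continuous_on {0..l} (\<lambda>x. integral {0..x} (\<lambda>y. iter_flux p g n y / p y))"
      by (intro indefinite_integral_continuous_1 integrable_continuous_real)
    then show ?case by (simp add: iter_flux_def)
  qed (simp add: g_cont)
  then show "continuous_on {0..l} (iter_sol p g n)" "continuous_on {0..l} (iter_flux p g n)"
    using fl by auto
qed

lemma iter_flux_deriv:
  assumes "x \<in> {0..l}"
  shows "(iter_flux p g n has_real_derivative p x * iter_sol p g n x) (at x within {0..l})"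
  unfolding iter_flux_def[abs_def]
  by (intro integral_has_real_derivative continuous_intros p_cont iter_cont assms)

lemma iter_sol_deriv:
  assumes "x \<in> {0..l}"
  shows "(iter_sol p g (Suc n) has_real_derivative iter_flux p g n x / p x) (at x within {0..l})"
proof -
  have "continuous_on {0..l} (\<lambda>y. iter_flux p g n y / p y)"
    using p_pos by (intro continuous_intros iter_cont p_cont) force
  from integral_has_real_derivative[OF this assms] show ?thesis by (simp add: iter_flux_def)
qed

text \<open>With \<delta> <= p <= L, the inner integral costs at most l L and the division by p at
  most 1 / \<delta>, which together give the constant l L / \<delta>. The outer integration supplies
  x / (n + 1), hence the factorial.\<close>

lemma iter_bounds:
  obtains G c K where "0 \<le> G" "0 \<le> c" "0 \<le> K"
    "\<And>n x. x \<in> {0..l} \<Longrightarrow> \<bar>iter_sol p g n x\<bar> \<le> G * (c ^ n / fact n)"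
    "\<And>n x. x \<in> {0..l} \<Longrightarrow> \<bar>iter_flux p g n x\<bar> \<le> K * (c ^ n / fact n)"
proof -
  obtain L \<delta> where L: "0 < \<delta>" "0 < L" "\<And>x. x \<in> {0..l} \<Longrightarrow> \<delta> \<le> p x" "\<And>x. x \<in> {0..l} \<Longrightarrow> p x \<le> L"
    using weight_bounds by metis
  have "bounded (g ` {0..l})" using compact_continuous_image[OF g_cont compact_Icc] compact_imp_bounded by blast
  then obtain G where G: "0 < G" "\<And>x. x \<in> {0..l} \<Longrightarrow> \<bar>g x\<bar> \<le> G"
    unfolding bounded_pos by auto
  define c where "c = l * L / \<delta>"
  have c: "0 \<le> c" using L l_pos by (simp add: c_def)
  have flux: "\<bar>iter_flux p g n y\<bar> \<le> l * L * (G * ((c * y) ^ n / fact n))"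
    if y: "y \<in> {0..l}" and IH: "\<And>x. x \<in> {0..l} \<Longrightarrow> \<bar>iter_sol p g n x\<bar> \<le> G * ((c * x) ^ n / fact n)" for n y
  proof -
    have "norm (iter_flux p g n y) \<le> L * (G * ((c * y) ^ n / fact n)) * (y - 0)"
      unfolding iter_flux_def
    proof (rule integral_bound)
      show "continuous_on {0..y} (\<lambda>s. p s * iter_sol p g n s)"
        using continuous_on_subset[OF continuous_on_mult[OF p_cont iter_cont(1)]] y by auto
      show "norm (p s * iter_sol p g n s) \<le> L * (G * ((c * y) ^ n / fact n))" if s: "s \<in> {0..y}" for s
      proof -
        have "\<bar>iter_sol p g n s\<bar> \<le> G * ((c * s) ^ n / fact n)" using IH s y by auto
        also have "\<dots> \<le> G * ((c * y) ^ n / fact n)"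
          using s c G(1) by (intro mult_left_mono divide_right_mono power_mono) auto
        finally have "\<bar>iter_sol p g n s\<bar> \<le> G * ((c * y) ^ n / fact n)" .
        moreover have "\<bar>p s\<bar> \<le> L" using L(4)[of s] p_pos[of s] s y by auto
        ultimately show ?thesis using L(2) by (simp only: real_norm_def abs_mult) (intro mult_mono; simp)
      qed
    qed (use y in auto)
    also have "\<dots> \<le> L * (G * ((c * y) ^ n / fact n)) * l"
      using y L c G by (intro mult_left_mono) auto
    finally show ?thesis by (simp add: mult_ac)
  qed
  have sol: "\<bar>iter_sol p g n x\<bar> \<le> G * ((c * x) ^ n / fact n)" if "x \<in> {0..l}" for n x
    using that
  proof (induction n arbitrary: x)
    case (Suc n)
    have e: "iter_sol p g (Suc n) x = integral {0..x} (\<lambda>y. iter_flux p g n y / p y)"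
      by (simp add: iter_flux_def)
    have i: "((\<lambda>y. G * (c * (c * y) ^ n / fact n)) has_integral
        (G * ((c * x) ^ Suc n / fact (Suc n)) - G * ((c * 0) ^ Suc n / fact (Suc n)))) {0..x}"
    proof (rule fundamental_theorem_of_calculus)
      show "((\<lambda>x. G * ((c * x) ^ Suc n / fact (Suc n))) has_vector_derivative G * (c * (c * y) ^ n / fact n)) (at y within {0..x})" for y
      proof -
        have "((\<lambda>x. G * ((c * x) ^ Suc n / fact (Suc n))) has_real_derivative
           G * ((real (Suc n) * (c * y) ^ n * c) / fact (Suc n))) (at y within {0..x})"
          by (rule derivative_eq_intros refl | simp)+
        moreover have "(real (Suc n) * (c * y) ^ n * c) / fact (Suc n) = c * (c * y) ^ n / fact n"
          by (simp add: field_simps del: of_nat_Suc)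
        ultimately show ?thesis by (simp only: has_real_derivative_iff_has_vector_derivative)
      qed
    qed (use Suc.prems in auto)
    have "norm (integral {0..x} (\<lambda>y. iter_flux p g n y / p y)) \<le> integral {0..x} (\<lambda>y. G * (c * (c * y) ^ n / fact n))"
    proof (rule integral_norm_bound_integral)
      show "(\<lambda>y. iter_flux p g n y / p y) integrable_on {0..x}"
      proof (rule integrable_continuous_real, rule continuous_on_subset)
        show "continuous_on {0..l} (\<lambda>y. iter_flux p g n y / p y)"
          using p_pos by (intro continuous_intros iter_cont p_cont) force
      qed (use Suc.prems in auto)
      show "norm (iter_flux p g n y / p y) \<le> G * (c * (c * y) ^ n / fact n)" if "y \<in> {0..x}" for y
      proof -
        have y: "y \<in> {0..l}" using that Suc.prems by auto
        have "norm (iter_flux p g n y / p y) = \<bar>iter_flux p g n y\<bar> / p y" using p_pos[OF y] by simp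
        also have "\<dots> \<le> (l * L * (G * ((c * y) ^ n / fact n))) / \<delta>"
          using flux[OF y Suc.IH] L(1) L(3)[OF y] l_pos L(2) G(1) c y by (intro frac_le) auto
        finally show ?thesis by (simp add: c_def field_simps)
      qed
    qed (use i in blast)
    also have "\<dots> = G * ((c * x) ^ Suc n / fact (Suc n))" unfolding integral_unique[OF i] by simp
    finally show ?case unfolding e by simp
  qed (use G in simp)
  have mono: "(c * x) ^ n / fact n \<le> (c * l) ^ n / fact n" if "x \<in> {0..l}" for n x
    using that c by (intro divide_right_mono power_mono mult_left_mono) auto
  show ?thesis
  proof (rule that[of G "c * l" "l * L * G"])
    show "\<bar>iter_sol p g n x\<bar> \<le> G * ((c * l) ^ n / fact n)" if "x \<in> {0..l}" for n x
      using sol[OF that, of n] mult_left_mono[OF mono[OF that, of n], of G] G(1) by linarith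
    show "\<bar>iter_flux p g n x\<bar> \<le> l * L * G * ((c * l) ^ n / fact n)" if "x \<in> {0..l}" for n x
      using flux[OF that sol, of n] mult_left_mono[OF mono[OF that, of n], of "l * L * G"] G(1) l_pos L(2)
      by (simp add: mult_ac)
  qed (use G c l_pos L in auto)
qed

lemma summable_exp_bound: "summable (\<lambda>n. K * (c ^ n / fact n) * A ^ n :: real)"
proof -
  have "summable (\<lambda>n. K * ((c * A) ^ n /\<^sub>R fact n))" by (intro summable_mult summable_exp_generic)
  then show ?thesis by (simp add: power_mult_distrib field_simps)
qed

lemma bounded_coeff_summable:
  assumes "\<And>n. \<bar>h n\<bar> \<le> K * (c ^ n / fact n)"
  shows "summable (\<lambda>n. of_real (h n) * (a::complex) ^ n)"
proof (rule summable_comparison_test)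
  show "\<exists>N. \<forall>n\<ge>N. norm (of_real (h n) * a ^ n) \<le> K * (c ^ n / fact n) * cmod a ^ n"
    unfolding norm_mult norm_power norm_of_real
    by (intro exI[of _ 0] allI impI mult_right_mono assms zero_le_power norm_ge_zero)
qed (rule summable_exp_bound)

lemma series_summable:
  assumes "x \<in> {0..l}"
  shows "summable (\<lambda>n. of_real (iter_sol p g n x) * (a::complex) ^ n)"
    "summable (\<lambda>n. of_real (iter_flux p g n x) * (a::complex) ^ n)"
  by (rule iter_bounds; rule bounded_coeff_summable; use assms in blast)+

lemma bounded_coeff_holomorphic:
  assumes "\<And>n. \<bar>h n\<bar> \<le> K * (c ^ n / fact n)"
  shows "(\<lambda>k. \<Sum>n. of_real (h n) * (- k\<^sup>2 :: complex) ^ n) holomorphic_on UNIV"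
proof (rule holomorphic_uniform_sequence)
  fix z :: complex
  define R where "R = cmod z + 1"
  have K: "0 \<le> K" using assms[of 0] by simp
  have "uniform_limit (cball z 1) (\<lambda>n k. \<Sum>i<n. of_real (h i) * (- k\<^sup>2) ^ i) (\<lambda>k. \<Sum>n. of_real (h n) * (- k\<^sup>2) ^ n) sequentially"
  proof (rule Weierstrass_m_test)
    show "norm (of_real (h n) * (- k\<^sup>2) ^ n) \<le> K * (c ^ n / fact n) * (R\<^sup>2) ^ n" if "k \<in> cball z 1" for n k
    proof -
      have "cmod k \<le> R" using that norm_triangle_sub[of k z] by (simp add: R_def dist_norm norm_minus_commute)
      then have "cmod (- k\<^sup>2) \<le> R\<^sup>2" by (simp add: norm_power power_mono)
      then have "cmod (- k\<^sup>2) ^ n \<le> (R\<^sup>2) ^ n" by (intro power_mono) auto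
      moreover have "0 \<le> K * (c ^ n / fact n)" using assms[of n] by linarith
      ultimately show ?thesis using assms[of n] unfolding norm_mult norm_power norm_of_real
        by (intro mult_mono) (auto simp: norm_power)
    qed
  qed (rule summable_exp_bound)
  then show "\<exists>d>0. cball z d \<subseteq> UNIV \<and> uniform_limit (cball z d) (\<lambda>n k. \<Sum>i<n. of_real (h i) * (- k\<^sup>2) ^ i) (\<lambda>k. \<Sum>n. of_real (h n) * (- k\<^sup>2) ^ n) sequentially"
    by (intro exI[of _ 1]) auto
qed (auto intro!: holomorphic_intros)

lemma series_holomorphic:
  assumes "x \<in> {0..l}"
  shows "(\<lambda>k. series_sol p g k x) holomorphic_on UNIV" "(\<lambda>k. series_flux p g k x) holomorphic_on UNIV"
  unfolding series_sol_def series_flux_def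
  by (rule iter_bounds; rule bounded_coeff_holomorphic; use assms in blast)+

lemma series_flux_deriv:
  assumes "x \<in> {0..l}"
  shows "(series_flux p g k has_vector_derivative of_real (p x) * series_sol p g k x) (at x within {0..l})"
proof -
  obtain G c K where B: "0 \<le> G" "0 \<le> c" "\<And>n x. x \<in> {0..l} \<Longrightarrow> \<bar>iter_sol p g n x\<bar> \<le> G * (c ^ n / fact n)"
    by (rule iter_bounds) blast
  obtain L \<delta> where L: "0 < \<delta>" "0 < L" "\<And>x. x \<in> {0..l} \<Longrightarrow> \<delta> \<le> p x" "\<And>x. x \<in> {0..l} \<Longrightarrow> p x \<le> L"
    using weight_bounds by metis
  have "((\<lambda>x. \<Sum>n. of_real (iter_flux p g n x) * (- k\<^sup>2) ^ n) has_vector_derivative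
     (\<Sum>n. of_real (p x * iter_sol p g n x) * (- k\<^sup>2) ^ n)) (at x within {0..l})"
  proof (rule power_series_derivative)
    show "\<bar>p y * iter_sol p g n y\<bar> \<le> L * G * (c ^ n / fact n)" if "y \<in> {0..l}" for n y
    proof -
      have "\<bar>p y\<bar> \<le> L" using L(4)[OF that] p_pos[OF that] by simp
      from mult_mono[OF this B(3)[OF that, of n]] L(2) show ?thesis by (simp add: abs_mult mult_ac)
    qed
    show "summable (\<lambda>n. L * G * (c ^ n / fact n) * A ^ n)" for A by (rule summable_exp_bound)
    show "summable (\<lambda>n. of_real (iter_flux p g n 0) * (- k\<^sup>2) ^ n)" using series_summable(2)[of 0] l_pos by simp
  qed (use iter_flux_deriv assms in auto)
  moreover have "(\<Sum>n. of_real (p x * iter_sol p g n x) * (- k\<^sup>2) ^ n) = of_real (p x) * series_sol p g k x"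
    unfolding series_sol_def
    by (subst suminf_mult[OF series_summable(1)[OF assms], symmetric]) (simp add: mult.assoc)
  ultimately show ?thesis by (simp add: series_flux_def[abs_def])
qed

text \<open>The starting function has constant flux \<beta>, so it solves the equation for k = 0.
  The value \<beta> = 0 yields the Neumann and \<beta> = 1 the Dirichlet solution.\<close>

lemma series_sol_deriv:
  assumes "x \<in> {0..l}" and g': "\<And>x. x \<in> {0..l} \<Longrightarrow> (g has_real_derivative \<beta> / p x) (at x within {0..l})"
  shows "(series_sol p g k has_vector_derivative (of_real \<beta> - k\<^sup>2 * series_flux p g k x) / of_real (p x)) (at x within {0..l})"
proof -
  obtain G c K where B: "0 \<le> c" "0 \<le> K" "\<And>n x. x \<in> {0..l} \<Longrightarrow> \<bar>iter_flux p g n x\<bar> \<le> K * (c ^ n / fact n)"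
    by (rule iter_bounds) blast
  obtain L \<delta> where L: "0 < \<delta>" "0 < L" "\<And>x. x \<in> {0..l} \<Longrightarrow> \<delta> \<le> p x" "\<And>x. x \<in> {0..l} \<Longrightarrow> p x \<le> L"
    using weight_bounds by metis
  \<comment> \<open>Derivatives of the coefficients: the zeroth one is \<open>g\<close> itself, and
    coefficient m + 1 has flux number m.\<close>
  define h' where "h' n y = (case n of 0 \<Rightarrow> \<beta> / p y | Suc m \<Rightarrow> iter_flux p g m y / p y)" for n y
  define C where "C n = (case n of 0 \<Rightarrow> \<bar>\<beta>\<bar> / \<delta> | Suc m \<Rightarrow> K / \<delta> * (c ^ m / fact m))" for n
  have "((\<lambda>x. \<Sum>n. of_real (iter_sol p g n x) * (- k\<^sup>2) ^ n) has_vector_derivative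
     (\<Sum>n. of_real (h' n x) * (- k\<^sup>2) ^ n)) (at x within {0..l})"
  proof (rule power_series_derivative)
    show "(iter_sol p g n has_real_derivative h' n y) (at y within {0..l})" if "y \<in> {0..l}" for n y
      using iter_sol_deriv[OF that] g'[OF that] by (cases n) (auto simp: h'_def simp del: iter_sol.simps(2))
    show "\<bar>h' n y\<bar> \<le> C n" if "y \<in> {0..l}" for n y
    proof (cases n)
      case 0
      have "\<bar>\<beta>\<bar> / p y \<le> \<bar>\<beta>\<bar> / \<delta>" using L(1) L(3)[OF that] by (intro frac_le) auto
      then show ?thesis using 0 p_pos[OF that] by (simp add: h'_def C_def)
    next
      case (Suc m)
      have "\<bar>iter_flux p g m y\<bar> / p y \<le> (K * (c ^ m / fact m)) / \<delta>"
        using B(3)[OF that, of m] L(1) L(3)[OF that] B by (intro frac_le) auto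
      also have "\<dots> = C n" using Suc by (simp add: C_def field_simps)
      finally show ?thesis using Suc p_pos[OF that] by (simp add: h'_def)
    qed
    show "summable (\<lambda>n. C n * A ^ n)" for A
    proof (subst summable_Suc_iff[symmetric])
      have "summable (\<lambda>n. A * (K / \<delta> * (c ^ n / fact n) * A ^ n))" by (intro summable_mult summable_exp_bound)
      then show "summable (\<lambda>n. C (Suc n) * A ^ Suc n)" by (simp add: C_def mult_ac)
    qed
    show "summable (\<lambda>n. of_real (iter_sol p g n 0) * (- k\<^sup>2) ^ n)" using series_summable(1)[of 0] l_pos by simp
  qed (use assms in auto)
  moreover have "(\<lambda>n. of_real (h' n x) * (- k\<^sup>2) ^ n) sums ((of_real \<beta> - k\<^sup>2 * series_flux p g k x) / of_real (p x))"
  proof -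
    have "(\<lambda>n. (- k\<^sup>2 / of_real (p x)) * (of_real (iter_flux p g n x) * (- k\<^sup>2) ^ n)) sums ((- k\<^sup>2 / of_real (p x)) * series_flux p g k x)"
      unfolding series_flux_def by (intro sums_mult summable_sums series_summable assms)
    then have "(\<lambda>n. of_real (h' (Suc n) x) * (- k\<^sup>2) ^ Suc n) sums ((- k\<^sup>2 / of_real (p x)) * series_flux p g k x)"
      by (simp add: h'_def mult_ac)
    then have "(\<lambda>n. of_real (h' n x) * (- k\<^sup>2) ^ n) sums ((- k\<^sup>2 / of_real (p x)) * series_flux p g k x + of_real (h' 0 x) * (- k\<^sup>2) ^ 0)"
      by (subst (asm) sums_Suc_iff) simp
    then show ?thesis by (simp add: h'_def diff_divide_distrib)
  qed
  ultimately show ?thesis by (simp add: series_sol_def[abs_def] sums_iff)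
qed

lemma series_ode_sol:
  assumes g': "\<And>x. x \<in> {0..l} \<Longrightarrow> (g has_real_derivative \<beta> / p x) (at x within {0..l})"
  shows "ode_sol l p k (series_sol p g k) (\<lambda>x. of_real \<beta> - k\<^sup>2 * series_flux p g k x)"
  unfolding ode_sol_def
proof (intro ballI conjI)
  fix x assume x: "x \<in> {0..l}"
  show "(series_sol p g k has_vector_derivative (of_real \<beta> - k\<^sup>2 * series_flux p g k x) / of_real (p x)) (at x within {0..l})"
    by (rule series_sol_deriv[OF x g'])
  have "((\<lambda>x. of_real \<beta> - k\<^sup>2 * series_flux p g k x) has_vector_derivative 0 - k\<^sup>2 * (of_real (p x) * series_sol p g k x)) (at x within {0..l})"
    by (intro derivative_intros series_flux_deriv x)
  then show "((\<lambda>x. of_real \<beta> - k\<^sup>2 * series_flux p g k x) has_vector_derivative - k\<^sup>2 * of_real (p x) * series_sol p g k x) (at x within {0..l})"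
    by (simp add: mult_ac)
qed

lemma series_flux_0: "series_flux p g k 0 = 0"
  by (simp add: series_flux_def iter_flux_def)

lemma series_sol_0: "series_sol p g k 0 = of_real (g 0)"
proof -
  have "(\<Sum>n. of_real (iter_sol p g n 0) * (- k\<^sup>2) ^ n) = (\<Sum>n\<in>{0}. of_real (iter_sol p g n 0) * (- k\<^sup>2) ^ n)"
  proof (rule suminf_finite)
    show "of_real (iter_sol p g n 0) * (- k\<^sup>2) ^ n = 0" if "n \<notin> {0}" for n using that by (cases n) auto
  qed auto
  then show ?thesis by (simp add: series_sol_def)
qed

text \<open>The coefficients are real, and (- cnj k)^2 = cnj (k^2).\<close>

lemma series_cnj:
  assumes "x \<in> {0..l}"
  shows "series_sol p g (- cnj k) x = cnj (series_sol p g k x)" "series_flux p g (- cnj k) x = cnj (series_flux p g k x)"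
proof -
  have 1: "(\<lambda>n. cnj (of_real (iter_sol p g n x) * (- k\<^sup>2) ^ n)) sums cnj (series_sol p g k x)"
    unfolding series_sol_def by (subst sums_cnj) (intro summable_sums series_summable assms)
  then show "series_sol p g (- cnj k) x = cnj (series_sol p g k x)"
    by (simp add: series_sol_def sums_iff)
  have 1: "(\<lambda>n. cnj (of_real (iter_flux p g n x) * (- k\<^sup>2) ^ n)) sums cnj (series_flux p g k x)"
    unfolding series_flux_def by (subst sums_cnj) (intro summable_sums series_summable assms)
  then show "series_flux p g (- cnj k) x = cnj (series_flux p g k x)"
    by (simp add: series_flux_def sums_iff)
qed

end

lemma series_even: "series_sol p g (- k) x = series_sol p g k x" "series_flux p g (- k) x = series_flux p g k x"
  by (simp_all add: series_sol_def series_flux_def)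

lemma series_at_0: "series_sol p g 0 x = of_real (g x)"
proof -
  have "(\<Sum>n. of_real (iter_sol p g n x) * (- 0\<^sup>2 :: complex) ^ n) = (\<Sum>n\<in>{0}. of_real (iter_sol p g n x) * (- 0\<^sup>2) ^ n)"
    by (rule suminf_finite) auto
  then show ?thesis by (simp add: series_sol_def)
qed

lemma iter_one_nonneg:
  assumes "x \<in> {0..l}"
  shows "0 \<le> iter_sol p (\<lambda>_. 1) n x \<and> 0 \<le> iter_flux p (\<lambda>_. 1) n x"
  using assms
proof (induction n arbitrary: x)
  have fl: "0 \<le> iter_flux p (\<lambda>_. 1) n x" if "\<And>x. x \<in> {0..l} \<Longrightarrow> 0 \<le> iter_sol p (\<lambda>_. 1) n x" "x \<in> {0..l}" for n x
    unfolding iter_flux_def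
  proof (rule integral_nonneg)
    show "(\<lambda>s. p s * iter_sol p (\<lambda>_. 1) n s) integrable_on {0..x}"
      using that(2) by (intro integrable_continuous_real continuous_on_subset[OF continuous_on_mult[OF p_cont iter_cont(1)]]) auto
    show "0 \<le> p s * iter_sol p (\<lambda>_. 1) n s" if "s \<in> {0..x}" for s
      using that \<open>x \<in> {0..l}\<close> \<open>\<And>x. x \<in> {0..l} \<Longrightarrow> 0 \<le> iter_sol p (\<lambda>_. 1) n x\<close> p_pos by (simp add: less_imp_le)
  qed
  {
    case 0
    show ?case using fl[of 0 x] 0 by simp
  next
    case (Suc n)
    have s: "0 \<le> iter_sol p (\<lambda>_. 1) (Suc n) y" if "y \<in> {0..l}" for y
    proof -
      have "0 \<le> integral {0..y} (\<lambda>y. iter_flux p (\<lambda>_. 1) n y / p y)"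
      proof (rule integral_nonneg)
        have "continuous_on {0..l} (\<lambda>y. iter_flux p (\<lambda>_. 1) n y / p y)"
          using p_pos by (intro continuous_intros iter_cont p_cont) force+
        then show "(\<lambda>y. iter_flux p (\<lambda>_. 1) n y / p y) integrable_on {0..y}"
          using that by (intro integrable_continuous_real) (auto elim: continuous_on_subset)
        show "0 \<le> iter_flux p (\<lambda>_. 1) n z / p z" if "z \<in> {0..y}" for z
          using Suc.IH[of z] p_pos[of z] that \<open>y \<in> {0..l}\<close> by auto
      qed
      then show ?thesis by (simp add: iter_flux_def)
    qed
    show ?case using s[OF Suc.prems] fl[OF s Suc.prems] by blast
  }
qed

text \<open>For k = i s the power series in - k^2 = s^2 has nonnegative terms only, so it is real
  and at least its first term, which is 1 for the solution and the integral of p for the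
  flux.\<close>

lemma series_one_imag:
  assumes "x \<in> {0<..l}"
  shows "1 \<le> Re (series_sol p (\<lambda>_. 1) (\<i> * of_real s) x)" "0 < Re (series_flux p (\<lambda>_. 1) (\<i> * of_real s) x)"
    "Im (series_sol p (\<lambda>_. 1) (\<i> * of_real s) x) = 0" "Im (series_flux p (\<lambda>_. 1) (\<i> * of_real s) x) = 0"
proof -
  have x: "x \<in> {0..l}" using assms by auto
  have k2: "- (\<i> * of_real s)\<^sup>2 = (of_real (s\<^sup>2) :: complex)" by (simp add: power_mult_distrib)
  have t: "of_real c * (- (\<i> * of_real s)\<^sup>2) ^ n = (of_real (c * (s\<^sup>2) ^ n) :: complex)" for c :: real and n
    unfolding k2 by simp
  have 1: "(\<lambda>n. of_real (iter_sol p (\<lambda>_. 1) n x * (s\<^sup>2) ^ n)) sums (series_sol p (\<lambda>_. 1) (\<i> * of_real s) x)"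
  proof -
    have "(\<lambda>n. of_real (iter_sol p (\<lambda>_. 1) n x) * (- (\<i> * of_real s)\<^sup>2) ^ n) sums (series_sol p (\<lambda>_. 1) (\<i> * of_real s) x)"
      unfolding series_sol_def by (rule summable_sums, rule series_summable(1)[OF continuous_on_const x])
    then show ?thesis by (simp only: t)
  qed
  have 2: "(\<lambda>n. of_real (iter_flux p (\<lambda>_. 1) n x * (s\<^sup>2) ^ n)) sums (series_flux p (\<lambda>_. 1) (\<i> * of_real s) x)"
  proof -
    have "(\<lambda>n. of_real (iter_flux p (\<lambda>_. 1) n x) * (- (\<i> * of_real s)\<^sup>2) ^ n) sums (series_flux p (\<lambda>_. 1) (\<i> * of_real s) x)"
      unfolding series_flux_def by (rule summable_sums, rule series_summable(2)[OF continuous_on_const x])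
    then show ?thesis by (simp only: t)
  qed
  show "Im (series_sol p (\<lambda>_. 1) (\<i> * of_real s) x) = 0"
    using sums_Im[OF 1] by (simp add: sums_iff)
  show "Im (series_flux p (\<lambda>_. 1) (\<i> * of_real s) x) = 0"
    using sums_Im[OF 2] by (simp add: sums_iff)
  have r1: "(\<lambda>n. iter_sol p (\<lambda>_. 1) n x * (s\<^sup>2) ^ n) sums Re (series_sol p (\<lambda>_. 1) (\<i> * of_real s) x)"
    using sums_Re[OF 1] by simp
  have r2: "(\<lambda>n. iter_flux p (\<lambda>_. 1) n x * (s\<^sup>2) ^ n) sums Re (series_flux p (\<lambda>_. 1) (\<i> * of_real s) x)"
    using sums_Re[OF 2] by simp
  have "(\<Sum>n\<in>{0}. iter_sol p (\<lambda>_. 1) n x * (s\<^sup>2) ^ n) \<le> (\<Sum>n. iter_sol p (\<lambda>_. 1) n x * (s\<^sup>2) ^ n)"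
    by (rule sum_le_suminf) (use r1 iter_one_nonneg[OF x] in \<open>auto simp: sums_iff\<close>)
  then show "1 \<le> Re (series_sol p (\<lambda>_. 1) (\<i> * of_real s) x)" using r1 by (simp add: sums_iff)
  have "(\<Sum>n\<in>{0}. iter_flux p (\<lambda>_. 1) n x * (s\<^sup>2) ^ n) \<le> (\<Sum>n. iter_flux p (\<lambda>_. 1) n x * (s\<^sup>2) ^ n)"
    by (rule sum_le_suminf) (use r2 iter_one_nonneg[OF x] in \<open>auto simp: sums_iff\<close>)
  moreover have "0 < iter_flux p (\<lambda>_. 1) 0 x"
  proof -
    have c: "continuous_on {0..x} p" using p_cont continuous_on_subset x by fastforce
    have "0 \<le> integral {0..x} p" using iter_one_nonneg[OF x, of 0] by (simp add: iter_flux_def)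
    moreover have "integral {0..x} p \<noteq> 0"
    proof
      assume "integral {0..x} p = 0"
      then have "\<forall>y\<in>{0..x}. p y = 0"
        by (subst (asm) integral_eq_0_iff[OF c]) (use assms p_pos in \<open>auto simp: less_imp_le\<close>)
      then show False using p_pos[of 0] assms l_pos by auto
    qed
    ultimately show ?thesis by (simp add: iter_flux_def)
  qed
  ultimately show "0 < Re (series_flux p (\<lambda>_. 1) (\<i> * of_real s) x)" using r2 by (simp add: sums_iff)
qed

lemma wronskian_const:
  assumes "ode_sol l p k y w" "ode_sol l p k z v" "x \<in> {0..l}"
  shows "y x * v x - z x * w x = y 0 * v 0 - z 0 * w 0"
proof -
  have "((\<lambda>x. y x * v x - z x * w x) has_vector_derivative 0) (at t within {0..l})" if t: "t \<in> {0..l}" for t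
  proof -
    have p0: "complex_of_real (p t) \<noteq> 0" using p_pos[OF t] by simp
    have "((\<lambda>x. y x * v x - z x * w x) has_vector_derivative
      (y t * (- k\<^sup>2 * of_real (p t) * z t) + (w t / of_real (p t)) * v t -
      (z t * (- k\<^sup>2 * of_real (p t) * y t) + (v t / of_real (p t)) * w t))) (at t within {0..l})"
      using assms(1,2) t unfolding ode_sol_def
      by (intro has_vector_derivative_diff has_vector_derivative_mult) auto
    then show ?thesis using p0 by (simp add: mult_ac)
  qed
  from has_vector_derivative_zero_constant[OF convex_closed_interval this]
  obtain c where c: "\<And>x. x \<in> {0..l} \<Longrightarrow> y x * v x - z x * w x = c" by blast
  show ?thesis using c[OF assms(3)] c[of 0] l_pos by simp
qed

lemma ode_sol_reflect:
  assumes "ode_sol l p k y w"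
  shows "ode_sol l (\<lambda>x. p (l - x)) k (\<lambda>x. y (l - x)) (\<lambda>x. - w (l - x))"
  unfolding ode_sol_def
proof (intro ballI conjI)
  fix x assume x: "x \<in> {0..l}"
  have img: "(\<lambda>x. l - x) ` {0..l} = {0..l}" by (auto simp: image_iff intro!: bexI[of _ "l - _"])
  have lx: "l - x \<in> {0..l}" using x by auto
  have d: "((\<lambda>x. l - x) has_vector_derivative -1) (at x within {0..l})"
    by (auto intro!: derivative_eq_intros)
  have "((y \<circ> (\<lambda>x. l - x)) has_vector_derivative (-1) *\<^sub>R (w (l - x) / of_real (p (l - x)))) (at x within {0..l})"
    by (rule vector_diff_chain_within[OF d]) (use assms lx in \<open>auto simp: ode_sol_def img\<close>)
  then show "((\<lambda>x. y (l - x)) has_vector_derivative - w (l - x) / of_real (p (l - x))) (at x within {0..l})"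
    by (simp add: o_def)
  have "((w \<circ> (\<lambda>x. l - x)) has_vector_derivative (-1) *\<^sub>R (- k\<^sup>2 * of_real (p (l - x)) * y (l - x))) (at x within {0..l})"
    by (rule vector_diff_chain_within[OF d]) (use assms lx in \<open>auto simp: ode_sol_def img\<close>)
  from has_vector_derivative_minus[OF this]
  show "((\<lambda>x. - w (l - x)) has_vector_derivative - k\<^sup>2 * of_real (p (l - x)) * y (l - x)) (at x within {0..l})"
    by (simp add: o_def)
qed

end

section \<open>Growth of the solutions\<close>

lemma cmod2_deriv:
  assumes "(a has_vector_derivative a') (at x within S)"
  shows "((\<lambda>x. (cmod (a x))\<^sup>2) has_real_derivative 2 * Re (a' * cnj (a x))) (at x within S)"
proof -
  have "((\<lambda>x. Re (a x)) has_real_derivative Re a') (at x within S)" "((\<lambda>x. Im (a x)) has_real_derivative Im a') (at x within S)"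
    using bounded_linear.has_vector_derivative[OF bounded_linear_Re assms]
      bounded_linear.has_vector_derivative[OF bounded_linear_Im assms]
    by (simp_all add: has_real_derivative_iff_has_vector_derivative)
  then have "((\<lambda>x. (Re (a x))\<^sup>2 + (Im (a x))\<^sup>2) has_real_derivative 2 * Re (a x) * Re a' + 2 * Im (a x) * Im a') (at x within S)"
    by (rule DERIV_cong[OF DERIV_add[OF DERIV_power[where n = 2] DERIV_power[where n = 2]]]) simp
  then show ?thesis by (simp add: cmod_power2 algebra_simps)
qed

lemma nondecreasing_within:
  fixes f :: "real \<Rightarrow> real"
  assumes "\<And>x. x \<in> {0..l} \<Longrightarrow> (f has_real_derivative f' x) (at x within {0..l})"
    "\<And>x. x \<in> {0..l} \<Longrightarrow> 0 \<le> f' x" "x \<in> {0..l}"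
  shows "f 0 \<le> f x"
proof (rule DERIV_nonneg_imp_increasing_open[of 0 x f])
  show "\<exists>d. (f has_real_derivative d) (at y) \<and> 0 \<le> d" if "0 < y" "y < x" for y
  proof -
    have "y \<in> {0..l}" "at y within {0..l} = at y" using that assms(3) by (auto intro!: at_within_interior)
    then show ?thesis using assms(1,2)[of y] by auto
  qed
  have "continuous_on {0..l} f" using assms(1) by (rule DERIV_continuous_on)
  then show "continuous_on {0..x} f" by (rule continuous_on_subset) (use assms(3) in auto)
  show "0 \<le> x" using assms(3) by simp
qed

lemma exp_growth_lower:
  fixes f :: "real \<Rightarrow> real"
  assumes "\<And>x. x \<in> {0..l} \<Longrightarrow> (f has_real_derivative f' x) (at x within {0..l})"
    "\<And>x. x \<in> {0..l} \<Longrightarrow> c * f x \<le> f' x" "x \<in> {0..l}"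
  shows "f 0 * exp (c * x) \<le> f x"
proof -
  have "f 0 * exp (- c * 0) \<le> f x * exp (- c * x)"
  proof (rule nondecreasing_within[of l "\<lambda>x. f x * exp (- c * x)"])
    show "((\<lambda>x. f x * exp (- c * x)) has_real_derivative (f' x - c * f x) * exp (- c * x)) (at x within {0..l})" if "x \<in> {0..l}" for x
      by (rule derivative_eq_intros assms(1) that refl | simp add: algebra_simps)+
    show "0 \<le> (f' x - c * f x) * exp (- c * x)" if "x \<in> {0..l}" for x
      using assms(2)[OF that] by simp
  qed fact
  then show ?thesis by (simp add: exp_minus field_simps)
qed

lemma exp_growth_upper:
  fixes f :: "real \<Rightarrow> real"
  assumes "\<And>x. x \<in> {0..l} \<Longrightarrow> (f has_real_derivative f' x) (at x within {0..l})"
    "\<And>x. x \<in> {0..l} \<Longrightarrow> f' x \<le> c * f x" "x \<in> {0..l}"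
  shows "f x \<le> f 0 * exp (c * x)"
  using exp_growth_lower[of l "\<lambda>x. - f x" "\<lambda>x. - f' x" c x] assms by (auto intro!: derivative_intros)

lemma cmod_parallelogram: "(cmod (a + b))\<^sup>2 + (cmod (a - b))\<^sup>2 = 2 * ((cmod a)\<^sup>2 + (cmod b)\<^sup>2)"
  unfolding cmod_power2 by (simp add: power2_eq_square algebra_simps)

definition neumann :: "(real \<Rightarrow> real) \<Rightarrow> complex \<Rightarrow> real \<Rightarrow> complex" where
  "neumann r = series_sol (\<lambda>x. (r x)\<^sup>2) (\<lambda>_. 1)"

text \<open>Without the factor \<open>-k\<^sup>2\<close>: the flux \<open>r\<^sup>2 u'\<close> is \<open>- k\<^sup>2 * neumann_flux r k x\<close>.\<close>

definition neumann_flux :: "(real \<Rightarrow> real) \<Rightarrow> complex \<Rightarrow> real \<Rightarrow> complex" where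
  "neumann_flux r = series_flux (\<lambda>x. (r x)\<^sup>2) (\<lambda>_. 1)"

text \<open>The starting function is the solution for k = 0 with value 0 and flux 1 at the left end.
  Its appearance at k = 0 is what finally gives access to r.\<close>

definition dirichlet :: "(real \<Rightarrow> real) \<Rightarrow> complex \<Rightarrow> real \<Rightarrow> complex" where
  "dirichlet r = series_sol (\<lambda>x. (r x)\<^sup>2) (\<lambda>x. integral {0..x} (\<lambda>y. 1 / (r y)\<^sup>2))"

definition dirichlet_flux :: "(real \<Rightarrow> real) \<Rightarrow> complex \<Rightarrow> real \<Rightarrow> complex" where
  "dirichlet_flux r k x = 1 - k\<^sup>2 * series_flux (\<lambda>x. (r x)\<^sup>2) (\<lambda>x. integral {0..x} (\<lambda>y. 1 / (r y)\<^sup>2)) k x"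

text \<open>With \<open>\<kappa> = i k\<close> and \<open>\<kappa> = - i k\<close> these are the two travelling waves. They solve a system that is diagonal
  up to the bounded function \<open>r' / r\<close>.\<close>

definition wave :: "(real \<Rightarrow> real) \<Rightarrow> complex \<Rightarrow> (real \<Rightarrow> complex) \<Rightarrow> (real \<Rightarrow> complex) \<Rightarrow> real \<Rightarrow> complex" where
  "wave r \<kappa> y w x = w x / of_real (r x) + \<kappa> * (of_real (r x) * y x)"

section \<open>Solutions for the weight r^2 and their travelling waves\<close>

locale tract =
  fixes l :: real and r r' :: "real \<Rightarrow> real"
  assumes l_pos: "0 < l" and r_pos: "\<And>x. x \<in> {0..l} \<Longrightarrow> 0 < r x"
    and r_deriv: "\<And>x. x \<in> {0..l} \<Longrightarrow> (r has_real_derivative r' x) (at x within {0..l})"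
    and r'_cont: "continuous_on {0..l} r'"
begin

lemma r_cont: "continuous_on {0..l} r"
  using r_deriv DERIV_continuous_on by blast

sublocale weight l "\<lambda>x. (r x)\<^sup>2"
proof
  show "0 < (r x)\<^sup>2" if "x \<in> {0..l}" for x using r_pos[OF that] by simp
qed (auto intro!: continuous_intros r_cont l_pos)

lemma log_deriv_bound: obtains Q where "0 \<le> Q" "\<And>x. x \<in> {0..l} \<Longrightarrow> \<bar>r' x / r x\<bar> \<le> Q"
proof -
  have "continuous_on {0..l} (\<lambda>x. r' x / r x)"
    by (intro continuous_intros r_cont r'_cont) (use r_pos in force)
  then have "bounded ((\<lambda>x. r' x / r x) ` {0..l})"
    using compact_continuous_image[OF _ compact_Icc] compact_imp_bounded by blast
  then obtain Q where "0 < Q" "\<And>x. x \<in> {0..l} \<Longrightarrow> \<bar>r' x / r x\<bar> \<le> Q"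
    unfolding bounded_pos by auto
  then show ?thesis using that[of Q] by auto
qed

lemma inv_cont: "continuous_on {0..l} (\<lambda>y. 1 / (r y)\<^sup>2)"
  by (intro continuous_intros r_cont) (use r_pos in force)

lemma inv_int_deriv:
  "x \<in> {0..l} \<Longrightarrow> ((\<lambda>x. integral {0..x} (\<lambda>y. 1 / (r y)\<^sup>2)) has_real_derivative 1 / (r x)\<^sup>2) (at x within {0..l})"
  by (intro integral_has_real_derivative inv_cont)

lemma inv_int_cont: "continuous_on {0..l} (\<lambda>x. integral {0..x} (\<lambda>y. 1 / (r y)\<^sup>2))"
  by (rule DERIV_continuous_on) (rule inv_int_deriv)

lemma neumann_ode: "ode_sol l (\<lambda>x. (r x)\<^sup>2) k (neumann r k) (\<lambda>x. - k\<^sup>2 * neumann_flux r k x)"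
  using series_ode_sol[of "\<lambda>_. 1" 0 k] by (simp add: neumann_def neumann_flux_def)

lemma dirichlet_ode: "ode_sol l (\<lambda>x. (r x)\<^sup>2) k (dirichlet r k) (dirichlet_flux r k)"
  using series_ode_sol[OF inv_int_cont inv_int_deriv, of k]
  by (simp add: dirichlet_def dirichlet_flux_def[abs_def])

lemma neumann_0 [simp]: "neumann r k 0 = 1" "neumann_flux r k 0 = 0"
  by (simp_all add: neumann_def neumann_flux_def series_sol_0[OF continuous_on_const] series_flux_0[OF continuous_on_const])

lemma dirichlet_0 [simp]: "dirichlet r k 0 = 0" "dirichlet_flux r k 0 = 1"
  by (simp_all add: dirichlet_def dirichlet_flux_def series_sol_0[OF inv_int_cont] series_flux_0[OF inv_int_cont])

lemma neumann_even: "neumann r (- k) x = neumann r k x" "neumann_flux r (- k) x = neumann_flux r k x"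
  by (simp_all add: neumann_def neumann_flux_def series_even)

lemma neumann_at_0: "neumann r 0 x = 1"
  by (simp add: neumann_def series_at_0)

lemma dirichlet_at_0: "dirichlet r 0 x = of_real (integral {0..x} (\<lambda>y. 1 / (r y)\<^sup>2))"
  by (simp add: dirichlet_def series_at_0)

lemma neumann_holomorphic:
  assumes "x \<in> {0..l}"
  shows "(\<lambda>k. neumann r k x) holomorphic_on UNIV" "(\<lambda>k. neumann_flux r k x) holomorphic_on UNIV"
    "(\<lambda>k. dirichlet r k x) holomorphic_on UNIV"
  using series_holomorphic[OF continuous_on_const assms] series_holomorphic[OF inv_int_cont assms]
  by (simp_all add: neumann_def neumann_flux_def dirichlet_def)

lemma neumann_cnj:
  assumes "x \<in> {0..l}"
  shows "neumann r (- cnj k) x = cnj (neumann r k x)" "neumann_flux r (- cnj k) x = cnj (neumann_flux r k x)"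
  using series_cnj[OF continuous_on_const assms]
  by (simp_all add: neumann_def neumann_flux_def)

text \<open>The derivatives of 1 / r and of r enter with opposite signs, which makes their joint
  contribution - r' / r times the other wave.\<close>

lemma wave_deriv:
  assumes sol: "ode_sol l (\<lambda>x. (r x)\<^sup>2) k y w" and x: "x \<in> {0..l}" and \<kappa>: "\<kappa>\<^sup>2 = - k\<^sup>2"
  shows "(wave r \<kappa> y w has_vector_derivative \<kappa> * wave r \<kappa> y w x - of_real (r' x / r x) * wave r (- \<kappa>) y w x) (at x within {0..l})"
proof -
  have r0: "r x > 0" using r_pos[OF x] .
  have dr: "((\<lambda>x. of_real (r x) :: complex) has_vector_derivative of_real (r' x)) (at x within {0..l})"
    by (intro has_vector_derivative_of_real r_deriv x)
  have di: "((\<lambda>x. of_real (1 / r x) :: complex) has_vector_derivative of_real (- (r' x / (r x)\<^sup>2))) (at x within {0..l})"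
  proof (rule has_vector_derivative_of_real)
    show "((\<lambda>x. 1 / r x) has_real_derivative - (r' x / (r x)\<^sup>2)) (at x within {0..l})"
      using r_deriv[OF x] r0 by (auto intro!: derivative_eq_intros simp: power2_eq_square)
  qed
  have dy: "(y has_vector_derivative w x / of_real ((r x)\<^sup>2)) (at x within {0..l})"
    and dw: "(w has_vector_derivative \<kappa>\<^sup>2 * of_real ((r x)\<^sup>2) * y x) (at x within {0..l})"
    using sol x \<kappa> by (auto simp: ode_sol_def)
  define R where "R = complex_of_real (r x)"
  define R' where "R' = complex_of_real (r' x)"
  have R: "R \<noteq> 0" using r0 by (simp add: R_def)
  have 1: "((\<lambda>x. w x * of_real (1 / r x)) has_vector_derivative
      (w x * of_real (- (r' x / (r x)\<^sup>2)) + \<kappa>\<^sup>2 * of_real ((r x)\<^sup>2) * y x * of_real (1 / r x))) (at x within {0..l})"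
    by (rule has_vector_derivative_mult[OF dw di])
  have 2: "((\<lambda>x. \<kappa> * (of_real (r x) * y x)) has_vector_derivative
      \<kappa> * (of_real (r x) * (w x / of_real ((r x)\<^sup>2)) + of_real (r' x) * y x)) (at x within {0..l})"
    by (rule has_vector_derivative_mult_right[OF has_vector_derivative_mult[OF dr dy]])
  have a: "wave r \<kappa> y w = (\<lambda>x. w x * of_real (1 / r x) + \<kappa> * (of_real (r x) * y x))"
    by (simp add: wave_def fun_eq_iff divide_inverse)
  have ea: "(w x * of_real (- (r' x / (r x)\<^sup>2)) + \<kappa>\<^sup>2 * of_real ((r x)\<^sup>2) * y x * of_real (1 / r x)) +
     \<kappa> * (of_real (r x) * (w x / of_real ((r x)\<^sup>2)) + of_real (r' x) * y x)
    = \<kappa> * wave r \<kappa> y w x - of_real (r' x / r x) * wave r (- \<kappa>) y w x"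
    unfolding wave_def using R
    by (simp add: R_def[symmetric] R'_def[symmetric] field_simps power2_eq_square)
  show ?thesis
    using has_vector_derivative_add[OF 1 2] unfolding ea a[symmetric] .
qed

text \<open>The coupling term e = - 2 (r' / r) Re (b cnj a) is the same for both squared moduli. One
  e serves both because it then cancels in |a|^2 - |b|^2.\<close>

lemma modulus_deriv:
  assumes sol: "ode_sol l (\<lambda>x. (r x)\<^sup>2) k y w" and x: "x \<in> {0..l}" and \<kappa>: "\<kappa>\<^sup>2 = - k\<^sup>2"
    and Q: "\<bar>r' x / r x\<bar> \<le> Q"
  shows "\<exists>e. \<bar>e\<bar> \<le> 2 * Q * (cmod (wave r \<kappa> y w x) * cmod (wave r (- \<kappa>) y w x)) \<and>
    ((\<lambda>x. (cmod (wave r \<kappa> y w x))\<^sup>2) has_real_derivative 2 * Re \<kappa> * (cmod (wave r \<kappa> y w x))\<^sup>2 + e) (at x within {0..l}) \<and>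
    ((\<lambda>x. (cmod (wave r (- \<kappa>) y w x))\<^sup>2) has_real_derivative - 2 * Re \<kappa> * (cmod (wave r (- \<kappa>) y w x))\<^sup>2 + e) (at x within {0..l})"
proof -
  define q where "q = r' x / r x"
  define a where "a = wave r \<kappa> y w"
  define b where "b = wave r (- \<kappa>) y w"
  define e where "e = - 2 * (q * Re (b x * cnj (a x)))"
  have "\<bar>Re (b x * cnj (a x))\<bar> \<le> cmod (a x) * cmod (b x)"
    using abs_Re_le_cmod[of "b x * cnj (a x)"] unfolding norm_mult complex_mod_cnj by (simp only: mult.commute)
  from mult_mono[OF Q[folded q_def] this] Q have "\<bar>q\<bar> * \<bar>Re (b x * cnj (a x))\<bar> \<le> Q * (cmod (a x) * cmod (b x))"
    by linarith
  then have e: "\<bar>e\<bar> \<le> 2 * Q * (cmod (a x) * cmod (b x))"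
    unfolding e_def abs_mult by simp
  have \<kappa>': "(- \<kappa>)\<^sup>2 = - k\<^sup>2" using \<kappa> by simp
  have d1: "(a has_vector_derivative \<kappa> * a x - of_real q * b x) (at x within {0..l})"
    using wave_deriv[OF sol x \<kappa>] by (simp only: a_def b_def q_def)
  have d2: "(b has_vector_derivative - \<kappa> * b x - of_real q * a x) (at x within {0..l})"
    using wave_deriv[OF sol x \<kappa>'] by (simp only: a_def b_def q_def minus_minus)
  have 1: "2 * Re ((\<kappa> * a x - of_real q * b x) * cnj (a x)) = 2 * Re \<kappa> * (cmod (a x))\<^sup>2 + e"
    unfolding e_def cmod_power2 by (simp add: power2_eq_square algebra_simps)
  have 2: "2 * Re ((- \<kappa> * b x - of_real q * a x) * cnj (b x)) = - 2 * Re \<kappa> * (cmod (b x))\<^sup>2 + e"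
    unfolding e_def cmod_power2 by (simp add: power2_eq_square algebra_simps)
  show ?thesis
    using e cmod2_deriv[OF d1] cmod2_deriv[OF d2] unfolding 1 2 unfolding a_def b_def by blast
qed

text \<open>By the parallelogram law |a|^2 + |b|^2 is twice the energy. Its logarithmic derivative
  is at most 2 |Im k| from the diagonal part plus 2 Q from the coupling.\<close>

lemma energy_bound:
  assumes Q: "\<And>x. x \<in> {0..l} \<Longrightarrow> \<bar>r' x / r x\<bar> \<le> Q"
    and sol: "ode_sol l (\<lambda>x. (r x)\<^sup>2) k y w" and x: "x \<in> {0..l}"
  shows "(cmod (w x) / r x)\<^sup>2 + (cmod k * r x * cmod (y x))\<^sup>2 \<le>
    ((cmod (w 0) / r 0)\<^sup>2 + (cmod k * r 0 * cmod (y 0))\<^sup>2) * exp (2 * (\<bar>Im k\<bar> + Q) * x)"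
proof -
  define \<kappa> where "\<kappa> = \<i> * k"
  have \<kappa>: "\<kappa>\<^sup>2 = - k\<^sup>2" by (simp add: \<kappa>_def power_mult_distrib)
  define a where "a = wave r \<kappa> y w"
  define b where "b = wave r (- \<kappa>) y w"
  have b: "b x = w x / of_real (r x) - \<kappa> * (of_real (r x) * y x)" for x by (simp add: b_def wave_def)
  have N: "(cmod (a x))\<^sup>2 + (cmod (b x))\<^sup>2 = 2 * ((cmod (w x) / r x)\<^sup>2 + (cmod k * r x * cmod (y x))\<^sup>2)" if "x \<in> {0..l}" for x
    unfolding a_def b wave_def cmod_parallelogram using r_pos[OF that] by (simp add: norm_mult norm_divide \<kappa>_def mult_ac)
  have "\<exists>d. ((\<lambda>x. (cmod (a x))\<^sup>2 + (cmod (b x))\<^sup>2) has_real_derivative d) (at x within {0..l}) \<and>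
     d \<le> 2 * (\<bar>Im k\<bar> + Q) * ((cmod (a x))\<^sup>2 + (cmod (b x))\<^sup>2)" if x: "x \<in> {0..l}" for x
  proof -
    obtain e where e: "\<bar>e\<bar> \<le> 2 * Q * (cmod (a x) * cmod (b x))"
      "((\<lambda>x. (cmod (a x))\<^sup>2) has_real_derivative 2 * Re \<kappa> * (cmod (a x))\<^sup>2 + e) (at x within {0..l})"
      "((\<lambda>x. (cmod (b x))\<^sup>2) has_real_derivative - 2 * Re \<kappa> * (cmod (b x))\<^sup>2 + e) (at x within {0..l})"
      using modulus_deriv[OF sol x \<kappa> Q[OF x], folded a_def b_def] by blast
    have Q0: "0 \<le> Q" using Q[OF x] by linarith
    have "2 * (cmod (a x) * cmod (b x)) \<le> (cmod (a x))\<^sup>2 + (cmod (b x))\<^sup>2"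
      using sum_squares_bound[of "cmod (a x)" "cmod (b x)"] by simp
    from mult_left_mono[OF this Q0] e(1) have e2: "2 * e \<le> 2 * Q * ((cmod (a x))\<^sup>2 + (cmod (b x))\<^sup>2)" by simp
    have R: "Re \<kappa> \<le> \<bar>Im k\<bar>" "- Re \<kappa> \<le> \<bar>Im k\<bar>" by (auto simp: \<kappa>_def)
    have "2 * Re \<kappa> * (cmod (a x))\<^sup>2 \<le> 2 * \<bar>Im k\<bar> * (cmod (a x))\<^sup>2" "- 2 * Re \<kappa> * (cmod (b x))\<^sup>2 \<le> 2 * \<bar>Im k\<bar> * (cmod (b x))\<^sup>2"
      by (rule mult_right_mono; use R in simp)+
    then have "2 * Re \<kappa> * (cmod (a x))\<^sup>2 + e + (- 2 * Re \<kappa> * (cmod (b x))\<^sup>2 + e) \<le> 2 * (\<bar>Im k\<bar> + Q) * ((cmod (a x))\<^sup>2 + (cmod (b x))\<^sup>2)"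
      using e2 unfolding distrib_left distrib_right by linarith
    with DERIV_add[OF e(2,3)] show ?thesis by blast
  qed
  then have "\<exists>d. \<forall>x\<in>{0..l}. ((\<lambda>x. (cmod (a x))\<^sup>2 + (cmod (b x))\<^sup>2) has_real_derivative d x) (at x within {0..l}) \<and>
     d x \<le> 2 * (\<bar>Im k\<bar> + Q) * ((cmod (a x))\<^sup>2 + (cmod (b x))\<^sup>2)" by (intro bchoice ballI)
  then obtain d where d': "\<forall>x\<in>{0..l}. ((\<lambda>x. (cmod (a x))\<^sup>2 + (cmod (b x))\<^sup>2) has_real_derivative d x) (at x within {0..l}) \<and>
     d x \<le> 2 * (\<bar>Im k\<bar> + Q) * ((cmod (a x))\<^sup>2 + (cmod (b x))\<^sup>2)" ..
  have d: "((\<lambda>x. (cmod (a x))\<^sup>2 + (cmod (b x))\<^sup>2) has_real_derivative d x) (at x within {0..l})"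
     "d x \<le> 2 * (\<bar>Im k\<bar> + Q) * ((cmod (a x))\<^sup>2 + (cmod (b x))\<^sup>2)" if "x \<in> {0..l}" for x
    using bspec[OF d' that] by blast+
  have "(cmod (a x))\<^sup>2 + (cmod (b x))\<^sup>2 \<le> ((cmod (a 0))\<^sup>2 + (cmod (b 0))\<^sup>2) * exp (2 * (\<bar>Im k\<bar> + Q) * x)"
    by (rule exp_growth_upper[OF d x])
  moreover have "0 \<in> {0..l}" using l_pos by simp
  moreover have "X \<le> Y * E" if "2 * X \<le> 2 * Y * E" for X Y E :: real using that by simp
  ultimately show ?thesis unfolding N[OF x] by (metis N)
qed

text \<open>The energy of the Neumann solution starts at (|k| r(0))^2, that of the Dirichlet
  solution at 1 / r(0)^2. The latter is therefore smaller by a factor of order |k|, and this decay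
  is what makes the Wronskian in \<open>cauchy_data_unique\<close> vanish at infinity.\<close>

lemma solution_bounds:
  obtains K where "1 \<le> K"
    "\<And>k x. x \<in> {0..l} \<Longrightarrow> cmod (neumann r k x) \<le> K * exp (\<bar>Im k\<bar> * x)"
    "\<And>k x. x \<in> {0..l} \<Longrightarrow> cmod (k\<^sup>2 * neumann_flux r k x) \<le> K * (cmod k * exp (\<bar>Im k\<bar> * x))"
    "\<And>k x. x \<in> {0..l} \<Longrightarrow> cmod k * cmod (dirichlet r k x) \<le> K * exp (\<bar>Im k\<bar> * x)"
proof -
  obtain Q where Q: "0 \<le> Q" "\<And>x. x \<in> {0..l} \<Longrightarrow> \<bar>r' x / r x\<bar> \<le> Q" using log_deriv_bound by blast
  obtain L \<delta> where L0: "0 < \<delta>" "0 < L" "\<And>x. x \<in> {0..l} \<Longrightarrow> \<delta> \<le> (r x)\<^sup>2" "\<And>x. x \<in> {0..l} \<Longrightarrow> (r x)\<^sup>2 \<le> L"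
    using weight_bounds by metis
  define m where "m = sqrt \<delta>"
  define M where "M = sqrt L"
  have m: "0 < m" "0 < M" "\<And>x. x \<in> {0..l} \<Longrightarrow> m \<le> r x" "\<And>x. x \<in> {0..l} \<Longrightarrow> r x \<le> M"
    using L0 r_pos by (auto simp: m_def M_def real_le_lsqrt real_le_rsqrt less_imp_le)
  have sq: "exp (2 * (\<bar>Im k\<bar> + Q) * x) = (exp ((\<bar>Im k\<bar> + Q) * x))\<^sup>2" for k x
    by (simp add: power2_eq_square mult_exp_exp)
  have le: "exp ((\<bar>Im k\<bar> + Q) * x) \<le> exp (Q * l) * exp (\<bar>Im k\<bar> * x)" if "x \<in> {0..l}" for k x
    using that Q(1) by (simp add: exp_add[symmetric] algebra_simps mult_left_mono)
  \<comment> \<open>The three summands serve the Neumann solution, its flux and the Dirichlet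
    solution, in this order. The factor exp (Q l) removes Q from the exponent.\<close>
  define K where "K = 1 + (M / m + M * M + 1 / (m * m)) * exp (Q * l)"
  have pos: "0 < M / m" "0 < M * M" "0 < 1 / (m * m)" using m by auto
  have K: "1 \<le> K" using pos by (simp add: K_def)
  have K2: "M / m * exp (Q * l) \<le> K" "M * M * exp (Q * l) \<le> K" "1 / (m * m) * exp (Q * l) \<le> K"
  proof -
    have S: "t * exp (Q * l) \<le> K" if "t \<le> M / m + M * M + 1 / (m * m)" for t
      using mult_right_mono[OF that, of "exp (Q * l)"] unfolding K_def by (smt (verit) exp_gt_zero)
    show "M / m * exp (Q * l) \<le> K" "M * M * exp (Q * l) \<le> K" "1 / (m * m) * exp (Q * l) \<le> K"
      by (rule S; use pos in linarith)+
  qed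
  have n: "((cmod k)\<^sup>2 * cmod (neumann_flux r k x) / r x)\<^sup>2 + (cmod k * r x * cmod (neumann r k x))\<^sup>2 \<le> (cmod k * r 0 * exp ((\<bar>Im k\<bar> + Q) * x))\<^sup>2" if "x \<in> {0..l}" for k x
    using energy_bound[OF Q(2) neumann_ode[of k] that] unfolding sq by (simp add: norm_mult power_mult_distrib norm_power)
  have r0: "0 < r 0" "r 0 \<le> M" "m \<le> r 0" using r_pos[of 0] m(3,4)[of 0] l_pos by auto
  show ?thesis
  proof (rule that[OF K])
    fix k x assume x: "x \<in> {0..l}"
    note mx = m(3)[OF x] m(4)[OF x] r_pos[OF x]
    have fin: "X \<le> K * exp (\<bar>Im k\<bar> * x)" if "X \<le> c * exp ((\<bar>Im k\<bar> + Q) * x)" "0 \<le> c" "c * exp (Q * l) \<le> K" for X c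
    proof -
      have "X \<le> c * (exp (Q * l) * exp (\<bar>Im k\<bar> * x))" using that(1) mult_left_mono[OF le[OF x, of k] that(2)] by linarith
      also have "\<dots> \<le> K * exp (\<bar>Im k\<bar> * x)" using mult_right_mono[OF that(3), of "exp (\<bar>Im k\<bar> * x)"] by (simp add: mult_ac)
      finally show ?thesis .
    qed
    show "cmod (neumann r k x) \<le> K * exp (\<bar>Im k\<bar> * x)"
    proof (cases "k = 0")
      case True
      then show ?thesis using K neumann_at_0 by simp
    next
      case False
      have "(cmod k * r x * cmod (neumann r k x))\<^sup>2 \<le> (cmod k * r 0 * exp ((\<bar>Im k\<bar> + Q) * x))\<^sup>2"
        using n[OF x, of k] by (smt (verit) zero_le_power2)
      then have "cmod k * r x * cmod (neumann r k x) \<le> cmod k * r 0 * exp ((\<bar>Im k\<bar> + Q) * x)"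
        by (rule power2_le_imp_le) (use r0 in simp)
      then have "cmod (neumann r k x) \<le> r 0 / r x * exp ((\<bar>Im k\<bar> + Q) * x)"
        using False mx by (simp add: field_simps)
      also have "\<dots> \<le> M / m * exp ((\<bar>Im k\<bar> + Q) * x)"
        using mx r0 m by (intro mult_right_mono frac_le) auto
      finally show ?thesis by (rule fin) (use K2 m in auto)
    qed
    show "cmod (k\<^sup>2 * neumann_flux r k x) \<le> K * (cmod k * exp (\<bar>Im k\<bar> * x))"
    proof -
      have "((cmod k)\<^sup>2 * cmod (neumann_flux r k x) / r x)\<^sup>2 \<le> (cmod k * r 0 * exp ((\<bar>Im k\<bar> + Q) * x))\<^sup>2"
        using n[OF x, of k] by (smt (verit) zero_le_power2)
      then have "(cmod k)\<^sup>2 * cmod (neumann_flux r k x) / r x \<le> cmod k * r 0 * exp ((\<bar>Im k\<bar> + Q) * x)"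
        by (rule power2_le_imp_le) (use r0 in simp)
      then have "(cmod k)\<^sup>2 * cmod (neumann_flux r k x) \<le> cmod k * ((r 0 * r x) * exp ((\<bar>Im k\<bar> + Q) * x))"
        using mx by (simp add: field_simps)
      also have "\<dots> \<le> cmod k * (K * exp (\<bar>Im k\<bar> * x))"
      proof (intro mult_left_mono norm_ge_zero, rule fin)
        show "(r 0 * r x) * exp ((\<bar>Im k\<bar> + Q) * x) \<le> (M * M) * exp ((\<bar>Im k\<bar> + Q) * x)"
          using mx r0 m by (intro mult_right_mono mult_mono) auto
      qed (use K2 m in auto)
      finally show ?thesis by (simp add: norm_mult norm_power mult_ac)
    qed
    show "cmod k * cmod (dirichlet r k x) \<le> K * exp (\<bar>Im k\<bar> * x)"
    proof -
      have "(cmod k * r x * cmod (dirichlet r k x))\<^sup>2 \<le> (1 / r 0 * exp ((\<bar>Im k\<bar> + Q) * x))\<^sup>2"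
        using energy_bound[OF Q(2) dirichlet_ode[of k] x] unfolding sq by (simp add: power_mult_distrib power_divide) (smt (verit) zero_le_power2 zero_le_divide_iff)
      then have "cmod k * r x * cmod (dirichlet r k x) \<le> 1 / r 0 * exp ((\<bar>Im k\<bar> + Q) * x)"
        by (rule power2_le_imp_le) (use r0 in simp)
      then have "cmod k * cmod (dirichlet r k x) \<le> 1 / (r 0 * r x) * exp ((\<bar>Im k\<bar> + Q) * x)"
        using mx r0 by (simp add: field_simps)
      also have "\<dots> \<le> 1 / (m * m) * exp ((\<bar>Im k\<bar> + Q) * x)"
        using mx r0 m by (intro mult_right_mono divide_left_mono mult_mono mult_pos_pos) auto
      finally show ?thesis by (rule fin) (use K2 m in auto)
    qed
  qed
qed

text \<open>The waves \<open>a\<close> and \<open>b\<close> start with equal modulus, and \<open>|a|\<^sup>2 - 4 |b|\<^sup>2\<close> grows at least linearly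
  with slope \<open>(-2 Im k - 5 Q) |a(0)|\<^sup>2\<close>, so that \<open>a\<close> dominates at the right end.\<close>

lemma neumann_waves_lower:
  assumes Q0: "0 \<le> Q" and Qb: "\<forall>x\<in>{0..l}. \<bar>r' x / r x\<bar> \<le> Q" and k: "Im k < 0"
  defines "w \<equiv> \<lambda>x. - k\<^sup>2 * neumann_flux r k x"
  defines "a \<equiv> wave r (\<i> * k) (neumann r k) w" and "b \<equiv> wave r (- (\<i> * k)) (neumann r k) w"
  shows "(r 0 * cmod k)\<^sup>2 * exp (2 * (- Im k - Q) * l) \<le> (cmod (a l))\<^sup>2" "cmod (b l) < cmod (a l)"
    "\<lbrakk>Q \<le> - Im k; 3 \<le> (2 * (- Im k) - 5 * Q) * l\<rbrakk> \<Longrightarrow> 2 * cmod (b l) \<le> cmod (a l)"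
proof -
  have Q: "0 \<le> Q" "\<And>x. x \<in> {0..l} \<Longrightarrow> \<bar>r' x / r x\<bar> \<le> Q" using Q0 Qb by auto
  define \<kappa> where "\<kappa> = \<i> * k"
  have R: "Re \<kappa> = - Im k" by (simp add: \<kappa>_def)
  have \<kappa>: "\<kappa>\<^sup>2 = - k\<^sup>2" by (simp add: \<kappa>_def power_mult_distrib)
  have b': "b = wave r (- \<kappa>) (neumann r k) w" and a': "a = wave r \<kappa> (neumann r k) w"
    by (simp_all add: a_def b_def \<kappa>_def)
  define A where "A x = (cmod (a x))\<^sup>2" for x
  define B where "B x = (cmod (b x))\<^sup>2" for x
  have "\<exists>e. \<bar>e\<bar> \<le> 2 * Q * (cmod (a x) * cmod (b x)) \<and>
      (A has_real_derivative 2 * (- Im k) * A x + e) (at x within {0..l}) \<and>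
      (B has_real_derivative - 2 * (- Im k) * B x + e) (at x within {0..l})" if x: "x \<in> {0..l}" for x
    using modulus_deriv[OF neumann_ode x \<kappa> Q(2)[OF x], folded w_def, folded a' b']
    unfolding A_def[abs_def] B_def[abs_def] R .
  then have "\<exists>e. \<forall>x\<in>{0..l}. \<bar>e x\<bar> \<le> 2 * Q * (cmod (a x) * cmod (b x)) \<and>
      (A has_real_derivative 2 * (- Im k) * A x + e x) (at x within {0..l}) \<and>
      (B has_real_derivative - 2 * (- Im k) * B x + e x) (at x within {0..l})" by (intro bchoice ballI)
  then obtain e where e: "\<And>x. x \<in> {0..l} \<Longrightarrow> \<bar>e x\<bar> \<le> 2 * Q * (cmod (a x) * cmod (b x))"
      "\<And>x. x \<in> {0..l} \<Longrightarrow> (A has_real_derivative 2 * (- Im k) * A x + e x) (at x within {0..l})"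
      "\<And>x. x \<in> {0..l} \<Longrightarrow> (B has_real_derivative - 2 * (- Im k) * B x + e x) (at x within {0..l})"
    by blast
  have AB0: "A x \<ge> 0" "B x \<ge> 0" for x by (simp_all add: A_def B_def)
  have r0: "0 < r 0" using r_pos[of 0] l_pos by simp
  have init: "A 0 = (r 0 * cmod k)\<^sup>2" "B 0 = (r 0 * cmod k)\<^sup>2"
    using r0 by (simp_all add: A_def B_def a_def b_def wave_def w_def norm_mult mult_ac)
  have dAB: "((\<lambda>x. A x - B x) has_real_derivative 2 * (- Im k) * (A x + B x)) (at x within {0..l})" if "x \<in> {0..l}" for x
    using DERIV_diff[OF e(2,3)[OF that]] by (simp add: algebra_simps)
  have AB: "B x \<le> A x" if "x \<in> {0..l}" for x
  proof -
    have "A 0 - B 0 \<le> A x - B x"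
    proof (rule nondecreasing_within[OF dAB _ that])
      show "0 \<le> 2 * (- Im k) * (A x + B x)" for x
        by (intro mult_nonneg_nonneg add_nonneg_nonneg AB0) (use k in auto)
    qed
    then show ?thesis using init by simp
  qed
  have ab: "cmod (b x) \<le> cmod (a x)" if "x \<in> {0..l}" for x
    using AB[OF that] by (simp add: A_def B_def)
  have eA: "\<bar>e x\<bar> \<le> 2 * Q * A x" if "x \<in> {0..l}" for x
  proof -
    have "cmod (a x) * cmod (b x) \<le> A x" using mult_left_mono[OF ab[OF that], of "cmod (a x)"] by (simp add: A_def power2_eq_square)
    from mult_left_mono[OF this, of "2 * Q"] e(1)[OF that] Q(1) show ?thesis by simp
  qed
  have Al: "A 0 * exp (2 * (- Im k - Q) * x) \<le> A x" if "x \<in> {0..l}" for x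
  proof (rule exp_growth_lower[OF e(2) _ that])
    fix x assume "x \<in> {0..l}"
    from eA[OF this] show "2 * (- Im k - Q) * A x \<le> 2 * (- Im k) * A x + e x" by (simp add: algebra_simps)
  qed
  have ll: "l \<in> {0..l}" using l_pos by simp
  from Al[OF ll] show "(r 0 * cmod k)\<^sup>2 * exp (2 * (- Im k - Q) * l) \<le> (cmod (a l))\<^sup>2"
    unfolding init(1) unfolding A_def .
  have k0: "cmod k > 0" using k by auto
  have Apos: "0 < A x" if "x \<in> {0..l}" for x
  proof -
    have "0 < A 0 * exp (2 * (- Im k - Q) * x)" using k0 r0 by (simp add: init)
    with Al[OF that] show ?thesis by linarith
  qed
  have "A 0 - B 0 < A l - B l"
  proof (rule DERIV_pos_imp_increasing_open[OF l_pos])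
    show "\<exists>d. ((\<lambda>x. A x - B x) has_real_derivative d) (at y) \<and> 0 < d" if "0 < y" "y < l" for y
    proof -
      have "y \<in> {0..l}" "at y within {0..l} = at y" using that by (auto intro!: at_within_interior)
      moreover from this have "0 < 2 * (- Im k) * (A y + B y)"
        using Apos[of y] AB0(2)[of y] k by (intro mult_pos_pos add_pos_nonneg) auto
      ultimately show ?thesis using dAB[of y] by (intro exI[of _ "2 * (- Im k) * (A y + B y)"]) simp
    qed
    show "continuous_on {0..l} (\<lambda>x. A x - B x)" by (rule DERIV_continuous_on) (rule dAB)
  qed
  then have "B l < A l" using init by simp
  then show "cmod (b l) < cmod (a l)" by (simp add: A_def B_def power2_less_imp_less)
  assume kQ: "Q \<le> - Im k" and big: "3 \<le> (2 * (- Im k) - 5 * Q) * l"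
  define c where "c = 2 * (- Im k) - 5 * Q"
  have c0: "0 \<le> c" using big l_pos unfolding c_def by (smt (verit) mult_nonpos_nonneg)
  have A1: "A 0 \<le> A x" if "x \<in> {0..l}" for x
  proof -
    have "A 0 * 1 \<le> A 0 * exp (2 * (- Im k - Q) * x)" using kQ that AB0(1)[of 0] by (intro mult_left_mono) auto
    with Al[OF that] show ?thesis by linarith
  qed
  \<comment> \<open>The derivative of A - 4 B is - 2 Im k (A + 4 B) - 3 e. The inequality 4 |a| |b|
    <= A + 4 B gives |3 e| <= (3 Q / 2) (A + 4 B). As A - 4 B starts at - 3 A(0), the slope c A(0)
    with c l >= 3 is enough to reach 0.\<close>
  have "A 0 - 4 * B 0 - c * A 0 * 0 \<le> A l - 4 * B l - c * A 0 * l"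
  proof (rule nondecreasing_within[of l "\<lambda>x. A x - 4 * B x - c * A 0 * x"])
    show "((\<lambda>x. A x - 4 * B x - c * A 0 * x) has_real_derivative
      (2 * (- Im k) * A x + e x - 4 * (- 2 * (- Im k) * B x + e x) - c * A 0)) (at x within {0..l})" if "x \<in> {0..l}" for x
      by (rule derivative_eq_intros e(2,3)[OF that] refl | simp)+
    show "0 \<le> 2 * (- Im k) * A x + e x - 4 * (- 2 * (- Im k) * B x + e x) - c * A 0" if x: "x \<in> {0..l}" for x
    proof -
      have "- 3 * e x \<ge> - 3 * (Q * (2 * (cmod (a x) * cmod (b x))))" using e(1)[OF x] by simp
      moreover have "2 * (cmod (a x) * cmod (b x)) \<le> (A x + 4 * B x) / 2"
        using sum_squares_bound[of "cmod (a x)" "2 * cmod (b x)"] by (simp add: A_def B_def power_mult_distrib)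
      from mult_left_mono[OF this Q(1)] have "Q * (2 * (cmod (a x) * cmod (b x))) \<le> Q * ((A x + 4 * B x) / 2)" .
      ultimately have 1: "- 3 * e x \<ge> - 3 * (Q * ((A x + 4 * B x) / 2))" by linarith
      have "c * (A x + 4 * B x) \<le> (2 * (- Im k) - 3 * Q / 2) * (A x + 4 * B x)"
        using AB0[of x] Q(1) by (intro mult_right_mono) (auto simp: c_def)
      moreover have "c * A 0 \<le> c * (A x + 4 * B x)"
        using A1[OF x] AB0(2)[of x] c0 by (intro mult_left_mono) auto
      ultimately have "c * A 0 \<le> (2 * (- Im k) - 3 * Q / 2) * (A x + 4 * B x)" by linarith
      with 1 show ?thesis by (simp add: algebra_simps)
    qed
  qed fact
  moreover have "3 * A 0 \<le> c * l * A 0" using big AB0(1)[of 0] unfolding c_def by (intro mult_right_mono)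
  ultimately have "4 * B l \<le> A l" using init by (simp add: algebra_simps)
  then have "(2 * cmod (b l))\<^sup>2 \<le> (cmod (a l))\<^sup>2" by (simp add: A_def B_def power_mult_distrib)
  then show "2 * cmod (b l) \<le> cmod (a l)" by (rule power2_le_imp_le) simp
qed

text \<open>At a zero both waves equal the flux divided by r(l), so neither dominates. The upper
  half plane follows because the solution is even in k.\<close>

lemma neumann_nonzero:
  assumes "Im k \<noteq> 0" shows "neumann r k l \<noteq> 0"
proof -
  have *: "neumann r k l \<noteq> 0" if "Im k < 0" for k
  proof
    obtain Q where Q': "0 \<le> Q" "\<And>x. x \<in> {0..l} \<Longrightarrow> \<bar>r' x / r x\<bar> \<le> Q" using log_deriv_bound by blast
    then have Q: "0 \<le> Q" "\<forall>x\<in>{0..l}. \<bar>r' x / r x\<bar> \<le> Q" by auto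
    assume "neumann r k l = 0"
    with neumann_waves_lower(2)[OF Q that] show False by (simp add: wave_def)
  qed
  from *[of k] *[of "- k"] assms show ?thesis by (cases "Im k < 0") (auto simp: neumann_even)
qed

text \<open>The difference of the waves is 2 i k r u and their sum is twice the flux divided by r.
  Once |a| >= 2 |b|, both combinations are at least |a| / 2, and |a| has the required
  growth.\<close>

lemma neumann_lower:
  obtains K c where "0 \<le> K" "0 < c"
    "\<And>k. K \<le> \<bar>Im k\<bar> \<Longrightarrow> c * exp (\<bar>Im k\<bar> * l) \<le> cmod (neumann r k l)"
    "\<And>k. K \<le> \<bar>Im k\<bar> \<Longrightarrow> c * (cmod k * exp (\<bar>Im k\<bar> * l)) \<le> cmod (k\<^sup>2 * neumann_flux r k l)"
proof -
  obtain Q where Q': "0 \<le> Q" "\<And>x. x \<in> {0..l} \<Longrightarrow> \<bar>r' x / r x\<bar> \<le> Q" using log_deriv_bound by blast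
  then have Q: "0 \<le> Q" "\<forall>x\<in>{0..l}. \<bar>r' x / r x\<bar> \<le> Q" by auto
  \<comment> \<open>Chosen so that both conditions of the third part of
    \<open>neumann_waves_lower\<close> hold: K >= Q, and 2 K - 5 Q >= 3 / l.\<close>
  define K where "K = 3 * Q + 3 / (2 * l)"
  have K0: "0 < K" using Q(1) l_pos by (simp add: K_def add_nonneg_pos)
  have r: "0 < r 0" "0 < r l" using r_pos[of 0] r_pos[of l] l_pos by auto
  have main: "r 0 / (4 * r l) * exp (- Q * l) * exp (- Im k * l) \<le> cmod (neumann r k l)"
     "r 0 * r l / 4 * exp (- Q * l) * (cmod k * exp (- Im k * l)) \<le> cmod (k\<^sup>2 * neumann_flux r k l)" if k: "K \<le> - Im k" for k
  proof -
    define w where "w = (\<lambda>x. - k\<^sup>2 * neumann_flux r k x)"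
    define a where "a = wave r (\<i> * k) (neumann r k) w"
    define b where "b = wave r (- (\<i> * k)) (neumann r k) w"
    have k0: "Im k < 0" using k K0 by simp
    then have kn: "0 < cmod k" by auto
    have c1: "Q \<le> - Im k" using k Q(1) l_pos by (smt (verit) K_def divide_nonneg_pos)
    have "3 = (2 * (3 / (2 * l))) * l" using l_pos by simp
    also have "\<dots> \<le> (2 * (- Im k) - 5 * Q) * l" using k Q(1) l_pos unfolding K_def by (intro mult_right_mono) linarith+
    finally have c2: "3 \<le> (2 * (- Im k) - 5 * Q) * l" .
    note aux = neumann_waves_lower[OF Q k0, folded w_def, folded a_def b_def]
    have "(r 0 * cmod k * exp ((- Im k - Q) * l))\<^sup>2 \<le> (cmod (a l))\<^sup>2"
    proof -
      have "exp (2 * (- Im k - Q) * l) = (exp ((- Im k - Q) * l))\<^sup>2" by (simp add: power2_eq_square mult_exp_exp)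
      then show ?thesis using aux(1) by (simp only: power_mult_distrib)
    qed
    then have al: "r 0 * cmod k * exp ((- Im k - Q) * l) \<le> cmod (a l)" by (rule power2_le_imp_le) simp
    have bl: "2 * cmod (b l) \<le> cmod (a l)" by (rule aux(3)[OF c1 c2])
    have ex: "exp ((- Im k - Q) * l) = exp (- Q * l) * exp (- Im k * l)" by (simp add: mult_exp_exp algebra_simps)
    have "cmod (a l) \<le> 2 * cmod (a l - b l)" using norm_triangle_ineq2[of "a l" "b l"] bl by linarith
    also have "a l - b l = 2 * (\<i> * k) * (of_real (r l) * neumann r k l)" by (simp add: a_def b_def wave_def)
    finally have "cmod (a l) \<le> cmod k * (4 * r l * cmod (neumann r k l))" using r by (simp add: norm_mult mult_ac)
    with al have "cmod k * (r 0 * exp ((- Im k - Q) * l)) \<le> cmod k * (4 * r l * cmod (neumann r k l))" by (simp add: mult_ac)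
    then have "r 0 * exp ((- Im k - Q) * l) \<le> 4 * r l * cmod (neumann r k l)" using kn by (simp only: mult_le_cancel_left_pos)
    then show "r 0 / (4 * r l) * exp (- Q * l) * exp (- Im k * l) \<le> cmod (neumann r k l)"
      unfolding ex using r by (simp add: field_simps)
    have "cmod (a l) \<le> 2 * cmod (a l + b l)" using norm_triangle_ineq2[of "a l" "- b l"] bl by simp
    also have "a l + b l = 2 * w l / of_real (r l)" by (simp add: a_def b_def wave_def)
    finally have "cmod (a l) \<le> 4 * cmod (k\<^sup>2 * neumann_flux r k l) / r l" using r by (simp add: norm_mult norm_divide w_def)
    with al have "r 0 * cmod k * exp ((- Im k - Q) * l) \<le> 4 * cmod (k\<^sup>2 * neumann_flux r k l) / r l" by linarith
    then show "r 0 * r l / 4 * exp (- Q * l) * (cmod k * exp (- Im k * l)) \<le> cmod (k\<^sup>2 * neumann_flux r k l)"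
      unfolding ex using r by (simp add: field_simps)
  qed
  define c where "c = min (r 0 / (4 * r l) * exp (- Q * l)) (r 0 * r l / 4 * exp (- Q * l))"
  have c: "0 < c" "c \<le> r 0 / (4 * r l) * exp (- Q * l)" "c \<le> r 0 * r l / 4 * exp (- Q * l)" using r by (simp_all add: c_def)
  have m1: "c * exp (- Im k * l) \<le> cmod (neumann r k l)" if "K \<le> - Im k" for k
    by (rule order_trans[OF mult_right_mono[OF c(2)] main(1)[OF that]]) simp
  have m2: "c * (cmod k * exp (- Im k * l)) \<le> cmod (k\<^sup>2 * neumann_flux r k l)" if "K \<le> - Im k" for k
    by (rule order_trans[OF mult_right_mono[OF c(3)] main(2)[OF that]]) simp
  show ?thesis
  proof (rule that[of K c])
    fix k assume k: "K \<le> \<bar>Im k\<bar>"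
    show "c * exp (\<bar>Im k\<bar> * l) \<le> cmod (neumann r k l)"
      using m1[of k] m1[of "- k"] k K0 by (cases "Im k < 0") (auto simp: neumann_even)
    show "c * (cmod k * exp (\<bar>Im k\<bar> * l)) \<le> cmod (k\<^sup>2 * neumann_flux r k l)"
      using m2[of k] m2[of "- k"] k K0 by (cases "Im k < 0") (auto simp: neumann_even)
  qed (use K0 c in auto)
qed

end

section \<open>The pressure at the lips\<close>

text \<open>This is F with u' = - k^2 \<open>neumann_flux\<close> / r^2 inserted: the division by k
  disappears, and the value at k = 0 is right without any extension.\<close>

definition jost :: "real \<Rightarrow> (real \<Rightarrow> real) \<Rightarrow> complex \<Rightarrow> complex" where
  "jost l r k = neumann r k l + \<i> * k * imp_fun (of_real (r l) * k) * neumann_flux r k l / of_real ((r l)\<^sup>2)"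

definition pressure_quot :: "real \<Rightarrow> real \<Rightarrow> real \<Rightarrow> (real \<Rightarrow> real) \<Rightarrow> complex \<Rightarrow> complex" where
  "pressure_quot c \<mu> l r k = of_real (c * \<mu> / (pi * (r l)\<^sup>2)) * imp_fun (of_real (r l) * k) / jost l r k"

lemma imp_fun_nonzero_I: "imp_fun (- \<i>) \<noteq> 0"
  using Re_imp_fun_pos[of "- \<i>"] by force

lemma imp_fun_eventually_nonzero:
  assumes "0 < \<rho>" shows "\<forall>\<^sub>F k in at z. imp_fun (of_real \<rho> * k) \<noteq> 0"
proof (rule exp_type_eventually_nonzero[OF exp_type_scale[OF exp_type_imp_fun]])
  show "imp_fun (of_real \<rho> * (- \<i> / of_real \<rho>)) \<noteq> 0" using imp_fun_nonzero_I assms by simp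
qed

section \<open>Zeros and growth of the denominator\<close>

context tract
begin

lemma l_mem: "l \<in> {0..l}" and zero_mem: "0 \<in> {0..l}" using l_pos by auto

lemma r_l_pos: "0 < r l" using r_pos[OF l_mem] .

lemma exp_type_neumann: "exp_type (\<lambda>k. neumann r k l)" "exp_type (\<lambda>k. k * neumann_flux r k l)"
proof -
  obtain K where K: "1 \<le> K"
    "\<And>k x. x \<in> {0..l} \<Longrightarrow> cmod (neumann r k x) \<le> K * exp (\<bar>Im k\<bar> * x)"
    "\<And>k x. x \<in> {0..l} \<Longrightarrow> cmod (k\<^sup>2 * neumann_flux r k x) \<le> K * (cmod k * exp (\<bar>Im k\<bar> * x))"
    using solution_bounds by metis
  have le: "K * exp (\<bar>Im k\<bar> * l) \<le> K * exp (l * cmod k)" for k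
    using K(1) l_pos abs_Im_le_cmod[of k] by (simp add: mult.commute)
  show "exp_type (\<lambda>k. neumann r k l)"
    by (rule exp_typeI[OF neumann_holomorphic(1)[OF l_mem] order_trans[OF K(2)[OF l_mem] le]])
  show "exp_type (\<lambda>k. k * neumann_flux r k l)"
  proof (rule exp_typeI)
    show "cmod (k * neumann_flux r k l) \<le> K * exp (l * cmod k)" for k
    proof (cases "k = 0")
      case False
      have "cmod k * cmod (k * neumann_flux r k l) \<le> cmod k * (K * exp (\<bar>Im k\<bar> * l))"
      proof -
        have "cmod k * cmod (k * neumann_flux r k l) = cmod (k\<^sup>2 * neumann_flux r k l)"
          by (simp add: norm_mult power2_eq_square)
        moreover have "K * (cmod k * exp (\<bar>Im k\<bar> * l)) = cmod k * (K * exp (\<bar>Im k\<bar> * l))" by simp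
        ultimately show ?thesis using K(3)[OF l_mem, of k] by metis
      qed
      then have "cmod (k * neumann_flux r k l) \<le> K * exp (\<bar>Im k\<bar> * l)"
        using False by simp
      then show ?thesis using le[of k] by linarith
    qed (use K in simp)
  qed (intro holomorphic_intros neumann_holomorphic(2)[OF l_mem])
qed

lemma exp_type_jost: "exp_type (jost l r)"
proof -
  have "exp_type (\<lambda>k. neumann r k l + \<i> / of_real ((r l)\<^sup>2) * (imp_fun (of_real (r l) * k) * (k * neumann_flux r k l)))"
    by (rule exp_type_add[OF exp_type_neumann(1) exp_type_mult[OF exp_type_const
        exp_type_mult[OF exp_type_scale[OF exp_type_imp_fun] exp_type_neumann(2)]]])
  moreover have "(\<lambda>k. neumann r k l + \<i> / of_real ((r l)\<^sup>2) * (imp_fun (of_real (r l) * k) * (k * neumann_flux r k l))) = jost l r"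
    by (simp add: jost_def fun_eq_iff mult_ac)
  ultimately show ?thesis by simp
qed

lemma jost_0: "jost l r 0 = 1"
  by (simp add: jost_def neumann_at_0)

lemma jost_eventually_nonzero: "\<forall>\<^sub>F k in at a. jost l r k \<noteq> 0"
  by (rule exp_type_eventually_nonzero[OF exp_type_jost, of 0]) (simp add: jost_0)

lemma jost_reflect: "jost l r (- cnj k) = cnj (jost l r k)"
proof -
  have "imp_fun (of_real (r l) * - cnj k) = cnj (imp_fun (of_real (r l) * k))"
    using imp_fun_reflect[of "of_real (r l) * k"] by simp
  then show ?thesis by (simp add: jost_def neumann_cnj[OF l_mem])
qed

lemma neumann_wronskian:
  assumes "x \<in> {0..l}"
  shows "neumann r k x * dirichlet_flux r k x + dirichlet r k x * (k\<^sup>2 * neumann_flux r k x) = 1"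
  using wronskian_const[OF neumann_ode dirichlet_ode assms, of k] by simp

lemma neumann_real:
  assumes "k \<in> \<real>"
  shows "neumann r k l \<in> \<real>" "neumann_flux r k l \<in> \<real>"
  using neumann_cnj[OF l_mem, of k] assms neumann_even[of k l] by (simp_all add: Reals_cnj_iff)

text \<open>On the real axis u and its flux are real, so Im F is the flux times t Re z / r^2. If F
  vanished, positivity of Re z would force first the flux and then u to be 0, against the Wronskian
  identity.\<close>

lemma jost_real_nonzero:
  assumes "k \<in> \<real>" shows "jost l r k \<noteq> 0"
proof (cases "k = 0")
  case False
  obtain t where t: "k = of_real t" using assms by (elim Reals_cases)
  obtain a where a: "neumann r k l = of_real a" using neumann_real(1)[OF assms] by (elim Reals_cases)
  obtain b where b: "neumann_flux r k l = of_real b" using neumann_real(2)[OF assms] by (elim Reals_cases)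
  define z where "z = imp_fun (of_real (r l) * k)"
  have z: "0 < Re z" unfolding z_def using t False r_l_pos by (intro Re_imp_fun_pos) auto
  show ?thesis
  proof
    assume 0: "jost l r k = 0"
    have eq: "jost l r k = of_real a + \<i> * of_real (t * b / (r l)\<^sup>2) * z"
      unfolding jost_def a b z_def[symmetric] by (simp add: t)
    have "Im (jost l r k) = t * b / (r l)\<^sup>2 * Re z"
      unfolding eq by simp
    then have "b = 0" using 0 z t False r_l_pos by simp
    with 0 eq have "a = 0" by simp
    with \<open>b = 0\<close> show False using neumann_wronskian[OF l_mem, of k] by (simp add: a b)
  qed
qed (simp add: jost_0)

lemma jost_imag:
  "jost l r (\<i> * of_real s) = of_real (Re (neumann r (\<i> * of_real s) l) +
     s * imp_real (r l * s) * Re (neumann_flux r (\<i> * of_real s) l) / (r l)\<^sup>2)"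
proof -
  have m: "l \<in> {0<..l}" using l_pos by simp
  define a where "a = Re (neumann r (\<i> * of_real s) l)"
  define b where "b = Re (neumann_flux r (\<i> * of_real s) l)"
  have ab: "neumann r (\<i> * of_real s) l = of_real a" "neumann_flux r (\<i> * of_real s) l = of_real b"
    using series_one_imag(3,4)[OF m, of s] by (simp_all add: a_def b_def neumann_def neumann_flux_def complex_eq_iff)
  have "imp_fun (of_real (r l) * (\<i> * of_real s)) = - of_real (imp_real (r l * s))"
    using imp_fun_imag[of "r l * s"] by (simp add: mult_ac)
  then show ?thesis unfolding a_def[symmetric] b_def[symmetric] by (simp add: jost_def ab mult_ac)
qed

lemma neumann_imag_pos: "1 \<le> Re (neumann r (\<i> * of_real s) l)" "0 < Re (neumann_flux r (\<i> * of_real s) l)"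
  using series_one_imag(1,2)[of l s] l_pos by (simp_all add: neumann_def neumann_flux_def)

lemma imp_real_sign: "0 \<le> s * imp_real (r l * s)"
proof (cases "s < 0")
  case True
  then have "imp_real (r l * s) < 0" using r_l_pos by (intro imp_real_neg) (simp add: mult_pos_neg)
  with True show ?thesis by (simp add: mult_nonpos_nonpos)
next
  case False
  then have "0 \<le> 8 / (3 * pi) * (r l * s)" using r_l_pos by simp
  also have "\<dots> \<le> imp_real (r l * s)" using False r_l_pos by (intro imp_real_lower_linear) simp
  finally show ?thesis using False by simp
qed

text \<open>Both summands in \<open>jost_imag\<close> are nonnegative and the first is at least 1.
  Besides excluding zeros on this axis, it later fixes the phase of an exponential factor.\<close>

lemma jost_imag_ge: "1 \<le> Re (jost l r (\<i> * of_real s))" "Im (jost l r (\<i> * of_real s)) = 0"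
proof -
  have "0 \<le> s * imp_real (r l * s) * Re (neumann_flux r (\<i> * of_real s) l) / (r l)\<^sup>2"
    using imp_real_sign[of s] neumann_imag_pos(2)[of s] by simp
  then show "1 \<le> Re (jost l r (\<i> * of_real s))" "Im (jost l r (\<i> * of_real s)) = 0"
    using neumann_imag_pos(1)[of s] unfolding jost_imag by simp_all
qed

text \<open>If z vanished as well, F would reduce to u, which has no zeros off the real axis. So
  numerator and denominator of the pressure never cancel.\<close>

lemma jost_zero:
  assumes "jost l r k = 0"
  shows "Re k \<noteq> 0" "Im k \<noteq> 0" "imp_fun (of_real (r l) * k) \<noteq> 0"
proof -
  show I: "Im k \<noteq> 0" using jost_real_nonzero[of k] assms by (auto simp: complex_is_Real_iff)
  show "Re k \<noteq> 0"
  proof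
    assume "Re k = 0"
    then have "k = \<i> * of_real (Im k)" by (simp add: complex_eq_iff)
    then have "1 \<le> Re (jost l r k)" using jost_imag_ge(1)[of "Im k"] by simp
    then show False using assms by simp
  qed
  show "imp_fun (of_real (r l) * k) \<noteq> 0"
    using neumann_nonzero[OF I] assms by (auto simp: jost_def)
qed

text \<open>On the lower half axis \<open>imp_real\<close> lies between -1 and 0, so z does not
  change the rate l of u. On the upper half it multiplies a flux term of rate l; the lower bound
  keeps it as a factor, to be combined with \<open>imp_real_lower_exp\<close>.\<close>

lemma jost_imag_bounds:
  obtains K A c where "0 < K" "0 < A" "0 < c"
    "\<And>s. K \<le> s \<Longrightarrow> c * exp (l * s) \<le> Re (jost l r (- \<i> * of_real s))"
    "\<And>s. K \<le> s \<Longrightarrow> Re (jost l r (- \<i> * of_real s)) \<le> A * exp (l * s)"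
    "\<And>s. K \<le> s \<Longrightarrow> c * exp (l * s) * imp_real (r l * s) \<le> Re (jost l r (\<i> * of_real s))"
    "\<And>s. K \<le> s \<Longrightarrow> Re (jost l r (\<i> * of_real s)) \<le> A * exp ((l + 2 * r l) * s)"
proof -
  obtain B where B: "1 \<le> B"
    "\<And>k x. x \<in> {0..l} \<Longrightarrow> cmod (neumann r k x) \<le> B * exp (\<bar>Im k\<bar> * x)"
    "\<And>k x. x \<in> {0..l} \<Longrightarrow> cmod (k\<^sup>2 * neumann_flux r k x) \<le> B * (cmod k * exp (\<bar>Im k\<bar> * x))"
    using solution_bounds by metis
  obtain K0 c where K0: "0 \<le> K0" "0 < c"
    "\<And>k. K0 \<le> \<bar>Im k\<bar> \<Longrightarrow> c * exp (\<bar>Im k\<bar> * l) \<le> cmod (neumann r k l)"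
    "\<And>k. K0 \<le> \<bar>Im k\<bar> \<Longrightarrow> c * (cmod k * exp (\<bar>Im k\<bar> * l)) \<le> cmod (k\<^sup>2 * neumann_flux r k l)"
    using neumann_lower by metis
  define K where "K = K0 + 1"
  define R where "R = (r l)\<^sup>2"
  have R: "0 < R" using r_l_pos by (simp add: R_def)
  define a where "a s = Re (neumann r (\<i> * of_real s) l)" for s
  define b where "b s = Re (neumann_flux r (\<i> * of_real s) l)" for s
  have m: "l \<in> {0<..l}" using l_pos by simp
  have ab: "neumann r (\<i> * of_real s) l = of_real (a s)" "neumann_flux r (\<i> * of_real s) l = of_real (b s)" for s
    using series_one_imag(3,4)[OF m, of s] by (simp_all add: a_def b_def neumann_def neumann_flux_def complex_eq_iff)
  have pos: "1 \<le> a s" "0 < b s" for s using neumann_imag_pos by (simp_all add: a_def b_def)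
  have even: "a (- s) = a s" "b (- s) = b s" for s
    using neumann_even[of "\<i> * of_real s" l] by (simp_all add: a_def b_def)
  have bnd: "a s \<le> B * exp (l * s)" "c * exp (l * s) \<le> a s" "s * b s \<le> B * exp (l * s)" "c * exp (l * s) \<le> s * b s" if "K \<le> s" for s
  proof -
    have s: "0 < s" "K0 \<le> s" using that K0(1) by (auto simp: K_def)
    have na: "cmod (neumann r (\<i> * of_real s) l) = a s" using pos(1)[of s] by (simp add: ab)
    have nb: "cmod ((\<i> * of_real s)\<^sup>2 * neumann_flux r (\<i> * of_real s) l) = s * (s * b s)"
      using pos(2)[of s] s by (simp add: ab norm_mult power2_eq_square)
    show "a s \<le> B * exp (l * s)" using B(2)[OF l_mem, of "\<i> * of_real s"] s unfolding na by (simp add: mult.commute)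
    show "c * exp (l * s) \<le> a s" using K0(3)[of "\<i> * of_real s"] s unfolding na by (simp add: mult.commute)
    have "s * (s * b s) \<le> s * (B * exp (l * s))"
      using B(3)[OF l_mem, of "\<i> * of_real s"] s unfolding nb by (simp add: norm_mult mult_ac)
    then show "s * b s \<le> B * exp (l * s)" using s by simp
    have "s * (c * exp (l * s)) \<le> s * (s * b s)"
      using K0(4)[of "\<i> * of_real s"] s unfolding nb by (simp add: norm_mult mult_ac)
    then show "c * exp (l * s) \<le> s * b s" using s by simp
  qed
  have up: "Re (jost l r (\<i> * of_real s)) = a s + s * b s * imp_real (r l * s) / R" for s
    unfolding jost_imag a_def b_def R_def by (simp add: mult_ac)
  have dn: "Re (jost l r (- \<i> * of_real s)) = a s + s * b s * (- imp_real (- (r l * s))) / R" for s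
    using up[of "- s"] by (simp add: even)
  define A where "A = B * (1 + 1 / R)"
  show ?thesis
  proof (rule that[of K A "min c (c / R)"])
    show "0 < K" using K0 by (simp add: K_def)
    show "0 < A" using B R by (simp add: A_def add_pos_pos)
    show "0 < min c (c / R)" using K0 R by simp
    fix s assume Ks: "K \<le> s"
    then have s: "0 < s" using K0(1) by (simp add: K_def)
    note bn = bnd[OF Ks]
    have sb: "0 < s * b s" using s pos by simp
    have i: "imp_real (- (r l * s)) < 0" "- 1 \<le> imp_real (- (r l * s))"
      using s r_l_pos by (auto intro!: imp_real_neg imp_real_ge)
    have "min c (c / R) * exp (l * s) \<le> c * exp (l * s)" by (intro mult_right_mono) auto
    moreover have "0 \<le> s * b s * (- imp_real (- (r l * s))) / R"
      using mult_nonneg_nonneg[OF less_imp_le[OF sb], of "- imp_real (- (r l * s))"] i R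
      by (intro divide_nonneg_pos) auto
    ultimately show "min c (c / R) * exp (l * s) \<le> Re (jost l r (- \<i> * of_real s))"
      unfolding dn using bn(2) by linarith
    have "s * b s * (- imp_real (- (r l * s))) \<le> s * b s * 1" using sb i by (intro mult_left_mono) auto
    then have "s * b s * (- imp_real (- (r l * s))) / R \<le> B * exp (l * s) / R"
      using bn(3) R by (intro divide_right_mono) auto
    then show "Re (jost l r (- \<i> * of_real s)) \<le> A * exp (l * s)"
      unfolding dn A_def using bn(1) by (simp add: algebra_simps)
    have i2: "0 \<le> imp_real (r l * s)" using imp_real_sign[of s] s by (simp add: zero_le_mult_iff)
    have "min c (c / R) * exp (l * s) * imp_real (r l * s) \<le> c / R * exp (l * s) * imp_real (r l * s)"
      using i2 by (intro mult_right_mono) auto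
    also have "\<dots> = c * exp (l * s) * imp_real (r l * s) / R" by simp
    also have "\<dots> \<le> s * b s * imp_real (r l * s) / R"
      using bn(4) i2 R by (intro divide_right_mono mult_right_mono) auto
    finally show "min c (c / R) * exp (l * s) * imp_real (r l * s) \<le> Re (jost l r (\<i> * of_real s))"
      unfolding up using pos(1)[of s] by linarith
    have "s * b s * imp_real (r l * s) \<le> (B * exp (l * s)) * exp (2 * (r l * s))"
      by (rule mult_mono[OF bn(3) imp_real_le]) (use sb i2 bn(3) s r_l_pos in auto)
    also have "\<dots> = B * exp ((l + 2 * r l) * s)" by (simp add: mult_exp_exp algebra_simps)
    finally have "s * b s * imp_real (r l * s) / R \<le> B * exp ((l + 2 * r l) * s) / R"
      using R by (intro divide_right_mono) auto
    moreover have "B * exp (l * s) \<le> B * exp ((l + 2 * r l) * s)"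
      using B(1) s r_l_pos by (simp add: mult_right_mono)
    ultimately show "Re (jost l r (\<i> * of_real s)) \<le> A * exp ((l + 2 * r l) * s)"
      unfolding up A_def using bn(1) by (simp add: algebra_simps)
  qed
qed

text \<open>The boundary value problem supplies the derivative of r^2 P' only in the interior.
  Continuity up to the ends, with 0 and l as exceptional points, still makes the Wronskian
  constant.\<close>

lemma bvp_wronskian:
  assumes bvp: "pressure_bvp c \<mu> l r k P P'" and sol: "ode_sol l (\<lambda>x. (r x)\<^sup>2) k z v" and x: "x \<in> {0..l}"
  shows "P x * v x - z x * (of_real ((r x)\<^sup>2) * P' x) = P 0 * v 0 - z 0 * (of_real ((r 0)\<^sup>2) * P' 0)"
proof (rule has_derivative_zero_unique_strong_interval[of "{0, l}" 0 l, OF _ _ refl _ x])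
  have Pd: "(P has_vector_derivative P' t) (at t within {0..l})" if "t \<in> {0..l}" for t
    using bvp that by (simp add: pressure_bvp_def)
  have cP: "continuous_on {0..l} P" using Pd by (rule continuous_on_vector_derivative)
  have "(z has_vector_derivative v t / of_real ((r t)\<^sup>2)) (at t within {0..l})"
    "(v has_vector_derivative - k\<^sup>2 * of_real ((r t)\<^sup>2) * z t) (at t within {0..l})" if "t \<in> {0..l}" for t
    using sol that by (auto simp: ode_sol_def)
  note zd = this
  have cz: "continuous_on {0..l} z" "continuous_on {0..l} v"
    by (rule continuous_on_vector_derivative, erule zd)+
  show "continuous_on {0..l} (\<lambda>x. P x * v x - z x * (of_real ((r x)\<^sup>2) * P' x))"
    using bvp by (intro continuous_intros cP cz r_cont) (simp add: pressure_bvp_def)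
  show "((\<lambda>x. P x * v x - z x * (of_real ((r x)\<^sup>2) * P' x)) has_derivative (\<lambda>h. 0)) (at t within {0..l})" if "t \<in> {0..l} - {0, l}" for t
  proof -
    have t: "t \<in> {0<..<l}" "t \<in> {0..l}" using that by auto
    have p0: "complex_of_real (r t) \<noteq> 0" using r_pos[OF t(2)] by simp
    obtain D where D: "((\<lambda>y. of_real ((r y)\<^sup>2) * P' y) has_vector_derivative D) (at t)" "D + k\<^sup>2 * of_real ((r t)\<^sup>2) * P t = 0"
      using bvp t(1) unfolding pressure_bvp_def by blast
    have D': "((\<lambda>y. of_real ((r y)\<^sup>2) * P' y) has_vector_derivative D) (at t within {0..l})"
      using D(1) by (rule has_vector_derivative_at_within)
    have "((\<lambda>x. P x * v x - z x * (of_real ((r x)\<^sup>2) * P' x)) has_vector_derivative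
       (P t * (- k\<^sup>2 * of_real ((r t)\<^sup>2) * z t) + P' t * v t) -
       (z t * D + (v t / of_real ((r t)\<^sup>2)) * (of_real ((r t)\<^sup>2) * P' t))) (at t within {0..l})"
      by (intro has_vector_derivative_diff has_vector_derivative_mult Pd zd D' t)
    moreover have "D = - (k\<^sup>2 * of_real ((r t)\<^sup>2) * P t)" using D(2) by (simp add: add_eq_0_iff2)
    ultimately have "((\<lambda>x. P x * v x - z x * (of_real ((r x)\<^sup>2) * P' x)) has_vector_derivative 0) (at t within {0..l})"
      using p0 by (simp add: mult_ac)
    then show ?thesis by (simp add: has_vector_derivative_def)
  qed
qed simp

text \<open>Take the Wronskian with the Neumann solution: at 0 the first boundary condition gives
  its value, and at l the second one turns it into P(l) times a multiple of
  \<open>jost\<close>.\<close>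

lemma bvp_solution:
  assumes bvp: "pressure_bvp c \<mu> l r k P P'" and z: "imp_fun (of_real (r l) * k) \<noteq> 0" and j: "jost l r k \<noteq> 0"
  shows "P l = pressure_quot c \<mu> l r k"
    "P' l = - (\<i> * k / imp_fun (of_real (r l) * k) * pressure_quot c \<mu> l r k)"
proof -
  define Z where "Z = imp_fun (of_real (r l) * k)"
  have imp: "impedance (r l) k = Z" by (simp add: impedance_eq[OF r_l_pos] Z_def)
  have k: "k \<noteq> 0" using z by (auto simp: imp_fun_0)
  have ends: "P' 0 = - (\<i> * k * of_real (c * \<mu>) / of_real (pi * (r 0)\<^sup>2))" "P' l = - (\<i> * k / Z * P l)"
    using bvp by (simp_all add: pressure_bvp_def imp add_eq_0_iff2)
  define R where "R = (complex_of_real (r l))\<^sup>2"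
  have R: "R \<noteq> 0" using r_l_pos by (simp add: R_def)
  have r0: "complex_of_real ((r 0)\<^sup>2) \<noteq> 0" using r_pos[OF zero_mem] by simp
  have "P l * (- k\<^sup>2 * neumann_flux r k l) - neumann r k l * (R * P' l) = \<i> * k * of_real (c * \<mu>) / of_real pi"
    using bvp_wronskian[OF bvp neumann_ode l_mem] r0 unfolding ends(1) by (simp add: R_def)
  moreover have "P l * (- k\<^sup>2 * neumann_flux r k l) - neumann r k l * (R * P' l) =
      P l * (\<i> * k * R / Z * neumann r k l - k\<^sup>2 * neumann_flux r k l)"
    unfolding ends(2) by (simp add: algebra_simps)
  moreover have "\<i> * k * R / Z * neumann r k l - k\<^sup>2 * neumann_flux r k l =
      (\<i> * k * R / Z) * (neumann r k l + \<i> * k * Z * neumann_flux r k l / R)"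
    using z[folded Z_def] R by (simp add: distrib_left power2_eq_square mult_ac)
  ultimately have "P l * (\<i> * k * R / Z) * (neumann r k l + \<i> * k * Z * neumann_flux r k l / R) = \<i> * k * of_real (c * \<mu>) / of_real pi"
    by (simp only: mult.assoc)
  then have e: "P l * (\<i> * k * R / Z) * jost l r k = \<i> * k * of_real (c * \<mu>) / of_real pi"
    by (simp add: jost_def Z_def R_def)
  have "P l = (\<i> * k * of_real (c * \<mu>) / of_real pi) / ((\<i> * k * R / Z) * jost l r k)"
    using e k R z[folded Z_def] j by (simp add: field_simps)
  also have "\<dots> = pressure_quot c \<mu> l r k"
    unfolding pressure_quot_def Z_def[symmetric] using k R z[folded Z_def] j by (simp add: R_def field_simps)
  finally show P: "P l = pressure_quot c \<mu> l r k" .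
  show "P' l = - (\<i> * k / imp_fun (of_real (r l) * k) * pressure_quot c \<mu> l r k)"
    using ends(2) unfolding P Z_def .
qed

lemma bvp_exists:
  assumes z: "imp_fun (of_real (r l) * k) \<noteq> 0" and j: "jost l r k \<noteq> 0"
  shows "\<exists>P P'. pressure_bvp c \<mu> l r k P P'"
proof -
  define Z where "Z = imp_fun (of_real (r l) * k)"
  have imp: "impedance (r l) k = Z" by (simp add: impedance_eq[OF r_l_pos] Z_def)
  have k: "k \<noteq> 0" using z by (auto simp: imp_fun_0)
  define R where "R = (complex_of_real (r l))\<^sup>2"
  have R: "R \<noteq> 0" using r_l_pos by (simp add: R_def)
  define B where "B = - (\<i> * k * of_real (c * \<mu>) / of_real pi)"
  define w where "w = (\<lambda>x. - k\<^sup>2 * neumann_flux r k x)"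
  \<comment> \<open>\<open>B\<close> is the flux prescribed at 0. \<open>A\<close> solves the
    condition at l, in which its coefficient is (i k / Z) times \<open>jost\<close>.\<close>
  define A where "A = - (B * dirichlet_flux r k l / R + \<i> * k / Z * (B * dirichlet r k l)) / (\<i> * k / Z * jost l r k)"
  define P where "P x = A * neumann r k x + B * dirichlet r k x" for x
  define W where "W x = A * w x + B * dirichlet_flux r k x" for x
  have nd: "(neumann r k has_vector_derivative w x / of_real ((r x)\<^sup>2)) (at x within {0..l})"
    "(w has_vector_derivative - k\<^sup>2 * of_real ((r x)\<^sup>2) * neumann r k x) (at x within {0..l})"
    "(dirichlet r k has_vector_derivative dirichlet_flux r k x / of_real ((r x)\<^sup>2)) (at x within {0..l})"
    "(dirichlet_flux r k has_vector_derivative - k\<^sup>2 * of_real ((r x)\<^sup>2) * dirichlet r k x) (at x within {0..l})" if "x \<in> {0..l}" for x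
    using neumann_ode[of k] dirichlet_ode[of k] that unfolding ode_sol_def w_def by blast+
  have Pd: "(P has_vector_derivative W x / of_real ((r x)\<^sup>2)) (at x within {0..l})" if "x \<in> {0..l}" for x
  proof -
    have "(P has_vector_derivative A * (w x / of_real ((r x)\<^sup>2)) + B * (dirichlet_flux r k x / of_real ((r x)\<^sup>2))) (at x within {0..l})"
      unfolding P_def[abs_def] by (intro has_vector_derivative_add has_vector_derivative_mult_right nd that)
    then show ?thesis by (simp add: W_def add_divide_distrib)
  qed
  have Wd: "(W has_vector_derivative - (k\<^sup>2 * of_real ((r x)\<^sup>2) * P x)) (at x within {0..l})" if "x \<in> {0..l}" for x
  proof -
    have "(W has_vector_derivative A * (- k\<^sup>2 * of_real ((r x)\<^sup>2) * neumann r k x) + B * (- k\<^sup>2 * of_real ((r x)\<^sup>2) * dirichlet r k x)) (at x within {0..l})"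
      unfolding W_def[abs_def] by (intro has_vector_derivative_add has_vector_derivative_mult_right nd that)
    moreover have "A * (- k\<^sup>2 * of_real ((r x)\<^sup>2) * neumann r k x) + B * (- k\<^sup>2 * of_real ((r x)\<^sup>2) * dirichlet r k x) = - (k\<^sup>2 * of_real ((r x)\<^sup>2) * P x)"
      by (simp add: P_def algebra_simps)
    ultimately show ?thesis by simp
  qed
  have cW: "continuous_on {0..l} W" using Wd by (rule continuous_on_vector_derivative)
  have "pressure_bvp c \<mu> l r k P (\<lambda>x. W x / of_real ((r x)\<^sup>2))"
    unfolding pressure_bvp_def imp
  proof (intro conjI ballI)
    show "Z \<noteq> 0" using z by (simp add: Z_def)
    show "continuous_on {0..l} (\<lambda>x. W x / of_real ((r x)\<^sup>2))"
      by (intro continuous_intros cW r_cont) (use r_pos in force)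
    show "W 0 / of_real ((r 0)\<^sup>2) = - (\<i> * k * of_real (c * \<mu>) / of_real (pi * (r 0)\<^sup>2))"
      by (simp add: W_def w_def B_def)
    have "w l / R + \<i> * k / Z * neumann r k l = \<i> * k / Z * jost l r k"
    proof -
      have "jost l r k = neumann r k l + \<i> * k * Z * neumann_flux r k l / R" by (simp add: jost_def Z_def R_def)
      moreover have "\<i> * k / Z * (\<i> * k * Z * neumann_flux r k l / R) = w l / R"
        using z[folded Z_def] by (simp add: w_def power2_eq_square mult_ac)
      ultimately show ?thesis by (simp only: distrib_left add.commute)
    qed
    then have "A * (w l / R + \<i> * k / Z * neumann r k l) = - (B * dirichlet_flux r k l / R + \<i> * k / Z * (B * dirichlet r k l))"
      using z k j unfolding A_def Z_def[symmetric] by simp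
    then have "A * (w l / R + \<i> * k / Z * neumann r k l) + (B * dirichlet_flux r k l / R + \<i> * k / Z * (B * dirichlet r k l)) = 0"
      by (simp only: eq_neg_iff_add_eq_0)
    then show "W l / of_real ((r l)\<^sup>2) + \<i> * k / Z * P l = 0"
      by (simp add: W_def P_def R_def[symmetric] distrib_left distrib_right add_divide_distrib mult_ac add_ac)
  next
    fix x assume x: "x \<in> {0<..<l}"
    then have x': "x \<in> {0..l}" "at x within {0..l} = at x" by (auto intro!: at_within_interior)
    have "((\<lambda>y. of_real ((r y)\<^sup>2) * (W y / of_real ((r y)\<^sup>2))) has_vector_derivative - (k\<^sup>2 * of_real ((r x)\<^sup>2) * P x)) (at x)"
    proof (rule has_vector_derivative_transform_within_open[OF Wd[OF x'(1), unfolded x'(2)] open_greaterThanLessThan x])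
      fix y assume "y \<in> {0<..<l}"
      then have "r y \<noteq> 0" using r_pos[of y] by force
      then show "W y = of_real ((r y)\<^sup>2) * (W y / of_real ((r y)\<^sup>2))" by simp
    qed
    then show "\<exists>D. ((\<lambda>y. of_real ((r y)\<^sup>2) * (W y / of_real ((r y)\<^sup>2))) has_vector_derivative D) (at x) \<and> D + k\<^sup>2 * of_real ((r x)\<^sup>2) * P x = 0"
      by (intro exI conjI) auto
  qed (use Pd in auto)
  then show ?thesis by blast
qed

text \<open>The end values at l are forced by \<open>bvp_solution\<close>, so two solutions have
  equal Wronskians with the Neumann and the Dirichlet solution. These have Wronskian 1 with each
  other and therefore determine the value at every x.\<close>

lemma bvp_unique:
  assumes bvp: "pressure_bvp c \<mu> l r k P P'" "pressure_bvp c \<mu> l r k S S'"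
    and z: "imp_fun (of_real (r l) * k) \<noteq> 0" and j: "jost l r k \<noteq> 0" and x: "x \<in> {0..l}"
  shows "P x = S x"
proof -
  have eq: "P x * v x - y x * (of_real ((r x)\<^sup>2) * P' x) = S x * v x - y x * (of_real ((r x)\<^sup>2) * S' x)"
    if sol: "ode_sol l (\<lambda>x. (r x)\<^sup>2) k y v" for y v
    using bvp_wronskian[OF bvp(1) sol x] bvp_wronskian[OF bvp(1) sol l_mem]
      bvp_wronskian[OF bvp(2) sol x] bvp_wronskian[OF bvp(2) sol l_mem]
      bvp_solution[OF bvp(1) z j] bvp_solution[OF bvp(2) z j] by simp
  define a where "a = P x - S x"
  define b where "b = of_real ((r x)\<^sup>2) * P' x - of_real ((r x)\<^sup>2) * S' x"
  define u where "u = neumann r k x"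
  define w where "w = k\<^sup>2 * neumann_flux r k x"
  define v where "v = dirichlet r k x"
  define f where "f = dirichlet_flux r k x"
  have 1: "a * w + u * b = 0"
    using eq[OF neumann_ode[of k]] unfolding a_def b_def u_def w_def by (simp add: algebra_simps)
  have 2: "a * f - v * b = 0"
    using eq[OF dirichlet_ode[of k]] unfolding a_def b_def v_def f_def by (simp add: algebra_simps)
  have 3: "u * f + v * w = 1"
    using neumann_wronskian[OF x, of k] unfolding u_def v_def f_def w_def by simp
  have "a = a * (u * f + v * w)" using 3 by simp
  also have "\<dots> = u * (a * f - v * b) + v * (a * w + u * b)" by (simp add: algebra_simps)
  finally show ?thesis unfolding 1 2 by (simp add: a_def)
qed

text \<open>The k at which z or \<open>jost\<close> vanishes are isolated, and
  \<open>remove_sings\<close> sees only punctured neighbourhoods.\<close>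

lemma lip_pressure_eq: "lip_pressure c \<mu> l r = remove_sings (pressure_quot c \<mu> l r)"
  unfolding lip_pressure_def
proof (rule ext, rule remove_sings_cong[OF _ refl])
  fix a
  show "\<forall>\<^sub>F k in at a. (if uniquely_solvable c \<mu> l r k then THE p. \<exists>P P'. pressure_bvp c \<mu> l r k P P' \<and> p = P l else 0)
     = pressure_quot c \<mu> l r k"
    using imp_fun_eventually_nonzero[OF r_l_pos, of a] jost_eventually_nonzero[of a]
  proof eventually_elim
    case (elim k)
    obtain P P' where P: "pressure_bvp c \<mu> l r k P P'" using bvp_exists[OF elim] by blast
    have "uniquely_solvable c \<mu> l r k"
      unfolding uniquely_solvable_def using P bvp_unique[OF _ _ elim] by blast
    moreover have "(THE p. \<exists>P P'. pressure_bvp c \<mu> l r k P P' \<and> p = P l) = pressure_quot c \<mu> l r k"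
    proof (rule the_equality)
      show "\<exists>P P'. pressure_bvp c \<mu> l r k P P' \<and> pressure_quot c \<mu> l r k = P l"
        using P bvp_solution(1)[OF P elim] by metis
    qed (use bvp_solution(1)[OF _ elim] in blast)
    ultimately show ?case by simp
  qed
qed

lemma pressure_quot_meromorphic: "pressure_quot c \<mu> l r meromorphic_on A"
  unfolding pressure_quot_def[abs_def]
  by (intro meromorphic_intros analytic_on_imp_meromorphic_on exp_type_analytic[OF exp_type_jost]
      exp_type_analytic[OF exp_type_scale[OF exp_type_imp_fun]])

lemma pressure_quot_analytic:
  assumes "jost l r k \<noteq> 0" shows "pressure_quot c \<mu> l r analytic_on {k}"
  unfolding pressure_quot_def[abs_def]
  by (intro analytic_intros exp_type_analytic[OF exp_type_jost]
    exp_type_analytic[OF exp_type_scale[OF exp_type_imp_fun]]) (use assms in auto)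

lemma lip_pressure_at:
  assumes "jost l r k \<noteq> 0" shows "lip_pressure c \<mu> l r k = pressure_quot c \<mu> l r k"
  unfolding lip_pressure_eq by (rule remove_sings_at_analytic[OF pressure_quot_analytic[OF assms]])

lemma jost_zorder_pos: "jost l r k = 0 \<longleftrightarrow> 0 < zorder (jost l r) k" "0 \<le> zorder (jost l r) k"
  using zorder_pos_iff'[OF exp_type_analytic[OF exp_type_jost] eventually_frequently[OF _ jost_eventually_nonzero]]
    zorder_ge_0[OF exp_type_analytic[OF exp_type_jost] eventually_frequently[OF _ jost_eventually_nonzero]] by auto

text \<open>By \<open>jost_zero\<close> the numerator is nonzero wherever the denominator vanishes,
  so pole order and order of the zero agree; elsewhere the quotient is analytic.\<close>

lemma lip_pressure_poles:
  assumes "0 < c" "0 < \<mu>"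
  shows "is_pole (lip_pressure c \<mu> l r) k \<longleftrightarrow> jost l r k = 0"
    "pole_mult (lip_pressure c \<mu> l r) k = nat (zorder (jost l r) k)"
proof -
  have iso: "isolated_singularity_at (pressure_quot c \<mu> l r) k"
    using pressure_quot_meromorphic[of c \<mu> "{k}"] meromorphic_at_iff by blast
  have pq: "is_pole (pressure_quot c \<mu> l r) k \<and> zorder (pressure_quot c \<mu> l r) k = - zorder (jost l r) k" if "jost l r k = 0"
  proof -
    let ?N = "\<lambda>k. of_real (c * \<mu> / (pi * (r l)\<^sup>2)) * imp_fun (of_real (r l) * k)"
    have Na: "?N analytic_on {k}" by (intro analytic_intros exp_type_analytic[OF exp_type_scale[OF exp_type_imp_fun]])
    have C: "complex_of_real (c * \<mu> / (pi * (r l)\<^sup>2)) \<noteq> 0" using assms r_l_pos by simp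
    have N0: "?N k \<noteq> 0" using jost_zero(3)[OF that] C by simp
    have "\<forall>\<^sub>F w in at k. ?N w \<noteq> 0" using imp_fun_eventually_nonzero[OF r_l_pos, of k] by eventually_elim (use C in simp)
    then have "zorder (\<lambda>k. ?N k / jost l r k) k = zorder ?N k - zorder (jost l r) k"
      using Na exp_type_analytic[OF exp_type_jost] jost_eventually_nonzero
      by (intro zorder_divide analytic_on_imp_meromorphic_on eventually_frequently) auto
    also have "zorder ?N k = 0" by (rule zorder_eq_0I[OF Na N0])
    finally have zo: "zorder (pressure_quot c \<mu> l r) k = - zorder (jost l r) k"
      by (simp add: pressure_quot_def[abs_def])
    moreover have "is_pole (pressure_quot c \<mu> l r) k"
    proof (rule zorder_neg_imp_is_pole[OF pressure_quot_meromorphic])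
      show "\<forall>\<^sub>F w in at k. pressure_quot c \<mu> l r w \<noteq> 0"
        using \<open>\<forall>\<^sub>F w in at k. ?N w \<noteq> 0\<close> jost_eventually_nonzero[of k]
        by eventually_elim (simp add: pressure_quot_def)
      show "zorder (pressure_quot c \<mu> l r) k < 0" using zo jost_zorder_pos(1)[of k] that by simp
    qed
    ultimately show ?thesis by simp
  qed
  have npq: "\<not> is_pole (pressure_quot c \<mu> l r) k" if "jost l r k \<noteq> 0"
    by (rule analytic_at_imp_no_pole[OF pressure_quot_analytic[OF that]])
  show pole: "is_pole (lip_pressure c \<mu> l r) k \<longleftrightarrow> jost l r k = 0"
    unfolding lip_pressure_eq is_pole_remove_sings_iff[OF iso] using pq npq by blast
  show "pole_mult (lip_pressure c \<mu> l r) k = nat (zorder (jost l r) k)"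
    unfolding pole_mult_def pole unfolding lip_pressure_eq zorder_remove_sings[OF iso]
    using pq jost_zorder_pos[of k] by auto
qed

end

section \<open>The radius is determined by the denominator\<close>

lemma entire_eq_on_pos_reals:
  assumes "f holomorphic_on UNIV" "g holomorphic_on UNIV" "\<And>t. 0 < t \<Longrightarrow> f (of_real t) = g (of_real t)"
  shows "f k = g k"
proof -
  let ?U = "complex_of_real ` {0<..}"
  have "1 islimpt ?U"
  proof (rule connected_imp_perfect)
    show "connected ?U" by (intro connected_continuous_image continuous_intros) auto
    have m: "complex_of_real 1 \<in> ?U" "complex_of_real 2 \<in> ?U" by (rule imageI; simp)+
    then show "1 \<in> ?U" by simp
    show "?U \<noteq> {x}" for x
    proof (rule notI)
      assume "?U = {x}"
      then have "complex_of_real 1 = complex_of_real 2" using m by (metis singletonD)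
      then show False unfolding of_real_eq_iff by simp
    qed
  qed
  then have "f k - g k = 0"
    by (rule analytic_continuation[of "\<lambda>k. f k - g k" UNIV ?U 1, rotated 5])
       (use assms in \<open>auto intro!: holomorphic_intros\<close>)
  then show ?thesis by simp
qed

lemma exp_growth_compare:
  assumes "0 < c" "\<And>s. K \<le> s \<Longrightarrow> c * exp (p * s) \<le> A * exp (q * s)"
  shows "p \<le> (q::real)"
proof (rule ccontr)
  assume "\<not> p \<le> q"
  then have d: "0 < p - q" by simp
  define s where "s = max K ((\<bar>A\<bar> / c + 1) / (p - q))"
  have "c * exp (p * s) \<le> A * exp (q * s)" by (rule assms(2)) (simp add: s_def)
  then have "c * exp (p * s) * exp (- q * s) \<le> A * exp (q * s) * exp (- q * s)" by (intro mult_right_mono) auto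
  then have "c * exp ((p - q) * s) \<le> A" by (simp add: mult.assoc mult_exp_exp algebra_simps)
  moreover have "\<bar>A\<bar> / c + 1 \<le> (p - q) * s"
  proof -
    have "(\<bar>A\<bar> / c + 1) / (p - q) \<le> s" by (simp add: s_def)
    then show ?thesis using d by (simp add: pos_divide_le_eq mult.commute)
  qed
  then have "\<bar>A\<bar> / c + 1 < exp ((p - q) * s)" using exp_ge_add_one_self[of "(p - q) * s"] by linarith
  then have "c * (\<bar>A\<bar> / c + 1) < c * exp ((p - q) * s)" using assms(1) by simp
  ultimately show False using assms(1) by (simp add: distrib_left)
qed

section \<open>Solutions normalised at the right end\<close>

context tract
begin

lemma tract_reflect: "tract l (\<lambda>x. r (l - x)) (\<lambda>x. - r' (l - x))"
proof
  show "0 < l" by (rule l_pos)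
  show "0 < r (l - x)" if "x \<in> {0..l}" for x using r_pos[of "l - x"] that by simp
  have img: "(\<lambda>x. l - x) ` {0..l} = {0..l}" by (auto simp: image_iff intro!: bexI[of _ "l - _"])
  show "((\<lambda>x. r (l - x)) has_real_derivative - r' (l - x)) (at x within {0..l})" if x: "x \<in> {0..l}" for x
  proof -
    have d: "((\<lambda>x. l - x) has_real_derivative -1) (at x within {0..l})" by (auto intro!: derivative_eq_intros)
    have "((r \<circ> (\<lambda>x. l - x)) has_real_derivative r' (l - x) * -1) (at x within {0..l})"
      by (rule DERIV_image_chain[OF _ d]) (use r_deriv[of "l - x"] x in \<open>simp add: img\<close>)
    then show ?thesis by (simp add: o_def)
  qed
  show "continuous_on {0..l} (\<lambda>x. - r' (l - x))"
    by (intro continuous_intros continuous_on_compose2[OF r'_cont]) auto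
qed

text \<open>The known Cauchy data sit at l, so u is expanded in the two solutions normalised there.
  The coefficients come out of three constant Wronskians, each evaluated at x and at l.\<close>

lemma neumann_from_right:
  assumes x: "x \<in> {0..l}"
  shows "neumann r k x = neumann (\<lambda>x. r (l - x)) k (l - x) * neumann r k l
     + dirichlet (\<lambda>x. r (l - x)) k (l - x) * (k\<^sup>2 * neumann_flux r k l)"
proof -
  interpret R: tract l "\<lambda>x. r (l - x)" "\<lambda>x. - r' (l - x)" by (rule tract_reflect)
  have C: "ode_sol l (\<lambda>x. (r x)\<^sup>2) k (\<lambda>x. neumann (\<lambda>x. r (l - x)) k (l - x)) (\<lambda>x. k\<^sup>2 * neumann_flux (\<lambda>x. r (l - x)) k (l - x))"
    using R.ode_sol_reflect[OF R.neumann_ode[of k]] by simp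
  have S: "ode_sol l (\<lambda>x. (r x)\<^sup>2) k (\<lambda>x. dirichlet (\<lambda>x. r (l - x)) k (l - x)) (\<lambda>x. - dirichlet_flux (\<lambda>x. r (l - x)) k (l - x))"
    using R.ode_sol_reflect[OF R.dirichlet_ode[of k]] by simp
  define c where "c = neumann (\<lambda>x. r (l - x)) k (l - x)"
  define wc where "wc = k\<^sup>2 * neumann_flux (\<lambda>x. r (l - x)) k (l - x)"
  define s where "s = dirichlet (\<lambda>x. r (l - x)) k (l - x)"
  define ws where "ws = - dirichlet_flux (\<lambda>x. r (l - x)) k (l - x)"
  define u where "u = neumann r k x"
  define wu where "wu = - k\<^sup>2 * neumann_flux r k x"
  define a where "a = neumann r k l"
  define b where "b = - k\<^sup>2 * neumann_flux r k l"
  have 1: "u * wc - c * wu = - b"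
    using trans[OF wronskian_const[OF neumann_ode C x] wronskian_const[OF neumann_ode C l_mem, symmetric]]
    unfolding u_def wc_def c_def wu_def b_def by simp
  have 2: "u * ws - s * wu = - a"
    using trans[OF wronskian_const[OF neumann_ode S x] wronskian_const[OF neumann_ode S l_mem, symmetric]]
    unfolding u_def ws_def s_def wu_def a_def by simp
  have 3: "s * wc - c * ws = 1"
    using trans[OF wronskian_const[OF S C x] wronskian_const[OF S C l_mem, symmetric]]
    unfolding ws_def s_def wc_def c_def by simp
  have "u = u * (s * wc - c * ws)" unfolding 3 by simp
  also have "\<dots> = s * (u * wc - c * wu) - c * (u * ws - s * wu)" by (simp add: algebra_simps)
  also have "\<dots> = c * a - s * b" unfolding 1 2 by simp
  finally show ?thesis unfolding u_def c_def a_def s_def b_def by simp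
qed

end

text \<open>If two tracts have the same Cauchy data at the right end, then \<open>S C~ - S~ C\<close>, formed with the
  solutions normalised there, equals \<open>(S u~ - S~ u) / u(l)\<close>. The exponentials cancel in the
  latter, so the entire function vanishes at infinity, and at \<open>k = 0\<close> it
  compares the integrals of \<open>1 / r\<^sup>2\<close>.\<close>

lemma cauchy_data_unique:
  assumes "tract l r r'" "tract l s s'"
    and u: "\<And>k. neumann r k l = neumann s k l" and f: "\<And>k. neumann_flux r k l = neumann_flux s k l"
    and x: "x \<in> {0..l}"
  shows "integral {0..l - x} (\<lambda>y. 1 / (r (l - y))\<^sup>2) = integral {0..l - x} (\<lambda>y. 1 / (s (l - y))\<^sup>2)"
proof -
  interpret R: tract l r r' by fact
  interpret S: tract l s s' by fact
  interpret Rr: tract l "\<lambda>x. r (l - x)" "\<lambda>x. - r' (l - x)" by (rule R.tract_reflect)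
  interpret Sr: tract l "\<lambda>x. s (l - x)" "\<lambda>x. - s' (l - x)" by (rule S.tract_reflect)
  define y where "y = l - x"
  have y: "y \<in> {0..l}" using x by (simp add: y_def)
  define C where "C k = neumann (\<lambda>x. r (l - x)) k y" for k
  define C' where "C' k = neumann (\<lambda>x. s (l - x)) k y" for k
  define D where "D k = dirichlet (\<lambda>x. r (l - x)) k y" for k
  define D' where "D' k = dirichlet (\<lambda>x. s (l - x)) k y" for k
  define W where "W k = D k * C' k - D' k * C k" for k
  have hol: "W holomorphic_on UNIV"
    unfolding W_def[abs_def] C_def C'_def D_def D'_def
    by (intro holomorphic_intros Rr.neumann_holomorphic Sr.neumann_holomorphic y)
  obtain K1 where K1: "1 \<le> K1" "\<And>k x. x \<in> {0..l} \<Longrightarrow> cmod (neumann r k x) \<le> K1 * exp (\<bar>Im k\<bar> * x)"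
    using R.solution_bounds by metis
  obtain K2 where K2: "1 \<le> K2" "\<And>k x. x \<in> {0..l} \<Longrightarrow> cmod (neumann s k x) \<le> K2 * exp (\<bar>Im k\<bar> * x)"
    using S.solution_bounds by metis
  obtain K3 where K3: "1 \<le> K3" "\<And>k x. x \<in> {0..l} \<Longrightarrow> cmod (neumann (\<lambda>x. r (l - x)) k x) \<le> K3 * exp (\<bar>Im k\<bar> * x)"
    "\<And>k x. x \<in> {0..l} \<Longrightarrow> cmod k * cmod (dirichlet (\<lambda>x. r (l - x)) k x) \<le> K3 * exp (\<bar>Im k\<bar> * x)"
    using Rr.solution_bounds by metis
  obtain K4 where K4: "1 \<le> K4" "\<And>k x. x \<in> {0..l} \<Longrightarrow> cmod (neumann (\<lambda>x. s (l - x)) k x) \<le> K4 * exp (\<bar>Im k\<bar> * x)"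
    "\<And>k x. x \<in> {0..l} \<Longrightarrow> cmod k * cmod (dirichlet (\<lambda>x. s (l - x)) k x) \<le> K4 * exp (\<bar>Im k\<bar> * x)"
    using Sr.solution_bounds by metis
  define K where "K = K1 + K2 + K3 + K4"
  have le: "K1 \<le> K" "K2 \<le> K" "K3 \<le> K" "K4 \<le> K" "1 \<le> K" using K1 K2 K3 K4 by (auto simp: K_def)
  have B: "cmod (neumann r k x) \<le> K * exp (\<bar>Im k\<bar> * x)" "cmod (neumann s k x) \<le> K * exp (\<bar>Im k\<bar> * x)"
    "cmod (C k) \<le> K * exp (\<bar>Im k\<bar> * y)" "cmod (C' k) \<le> K * exp (\<bar>Im k\<bar> * y)"
    "cmod k * cmod (D k) \<le> K * exp (\<bar>Im k\<bar> * y)" "cmod k * cmod (D' k) \<le> K * exp (\<bar>Im k\<bar> * y)" for k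
    unfolding C_def C'_def D_def D'_def
    by (rule order_trans[OF K1(2)[OF x]] order_trans[OF K2(2)[OF x]] order_trans[OF K3(2)[OF y]]
        order_trans[OF K4(2)[OF y]] order_trans[OF K3(3)[OF y]] order_trans[OF K4(3)[OF y]],
        rule mult_right_mono; use le in simp)+
  obtain K0 c where K0: "0 \<le> K0" "0 < c" "\<And>k. K0 \<le> \<bar>Im k\<bar> \<Longrightarrow> c * exp (\<bar>Im k\<bar> * l) \<le> cmod (neumann r k l)"
    using R.neumann_lower by metis
  \<comment> \<open>Expanded from the right end, both solutions have the same coefficients
    \<open>a\<close> and \<open>g\<close>; the terms with \<open>g\<close> cancel.\<close>
  have id: "neumann r k l * W k = D k * neumann s k x - D' k * neumann r k x" for k
  proof -
    define a where "a = neumann s k l"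
    define g where "g = k\<^sup>2 * neumann_flux s k l"
    have 1: "neumann r k x = C k * a + D k * g"
      using R.neumann_from_right[OF x, of k] unfolding C_def D_def y_def u f a_def g_def .
    have 2: "neumann s k x = C' k * a + D' k * g"
      using S.neumann_from_right[OF x, of k] unfolding C'_def D'_def y_def a_def g_def .
    show ?thesis unfolding 1 2 u W_def a_def[symmetric] by (simp add: algebra_simps)
  qed
  \<comment> \<open>Two regimes. For |Im k| >= K0, divide \<open>id\<close> by the lower bound for
    u(k,l); the exponentials cancel because y + x = l. In the strip |Im k| < K0 they are bounded,
    and the definition of \<open>W\<close> suffices. The factor |k| comes from the Dirichlet bounds
    in both cases.\<close>
  define M where "M = max (2 * K\<^sup>2 / c) (2 * K\<^sup>2 * (exp (K0 * l))\<^sup>2)"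
  have main: "cmod k * cmod (W k) \<le> M" for k
  proof (cases "K0 \<le> \<bar>Im k\<bar>")
    case True
    have ex: "exp (\<bar>Im k\<bar> * y) * exp (\<bar>Im k\<bar> * x) = exp (\<bar>Im k\<bar> * l)"
      by (simp add: mult_exp_exp y_def algebra_simps)
    have t: "(cmod k * d) * e \<le> K\<^sup>2 * exp (\<bar>Im k\<bar> * l)" if "cmod k * d \<le> K * exp (\<bar>Im k\<bar> * y)" "e \<le> K * exp (\<bar>Im k\<bar> * x)" "0 \<le> e" for d e
    proof -
      have "(cmod k * d) * e \<le> (K * exp (\<bar>Im k\<bar> * y)) * (K * exp (\<bar>Im k\<bar> * x))"
        by (rule mult_mono[OF that(1,2)]) (use that(3) le in auto)
      also have "\<dots> = K\<^sup>2 * (exp (\<bar>Im k\<bar> * y) * exp (\<bar>Im k\<bar> * x))" by (simp add: power2_eq_square)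
      finally show ?thesis unfolding ex .
    qed
    have "c * exp (\<bar>Im k\<bar> * l) * (cmod k * cmod (W k)) \<le> cmod (neumann r k l) * (cmod k * cmod (W k))"
      using K0(3)[OF True] by (intro mult_right_mono) auto
    also have "\<dots> = cmod k * cmod (D k * neumann s k x - D' k * neumann r k x)"
      by (simp add: id[symmetric] norm_mult)
    also have "\<dots> \<le> cmod k * (cmod (D k) * cmod (neumann s k x) + cmod (D' k) * cmod (neumann r k x))"
      by (intro mult_left_mono order_trans[OF norm_triangle_ineq4]) (simp_all add: norm_mult)
    also have "\<dots> \<le> K\<^sup>2 * exp (\<bar>Im k\<bar> * l) + K\<^sup>2 * exp (\<bar>Im k\<bar> * l)"
      using add_mono[OF t[OF B(5)[of k] B(2)[of k]] t[OF B(6)[of k] B(1)[of k]]] by (simp add: distrib_left mult.assoc)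
    finally have "exp (\<bar>Im k\<bar> * l) * (c * (cmod k * cmod (W k))) \<le> exp (\<bar>Im k\<bar> * l) * (2 * K\<^sup>2)" by (simp add: mult_ac)
    then have "c * (cmod k * cmod (W k)) \<le> 2 * K\<^sup>2" by simp
    then have "cmod k * cmod (W k) \<le> 2 * K\<^sup>2 / c" using K0(2) by (simp add: field_simps)
    then show ?thesis by (simp add: M_def)
  next
    case False
    have "\<bar>Im k\<bar> * y \<le> K0 * l" using False y K0 by (intro mult_mono) auto
    then have e: "K * exp (\<bar>Im k\<bar> * y) \<le> K * exp (K0 * l)" using le by simp
    have t: "(cmod k * d) * h \<le> K\<^sup>2 * (exp (K0 * l))\<^sup>2" if "cmod k * d \<le> K * exp (\<bar>Im k\<bar> * y)" "h \<le> K * exp (\<bar>Im k\<bar> * y)" "0 \<le> h" for d h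
    proof -
      have "(cmod k * d) * h \<le> (K * exp (K0 * l)) * (K * exp (K0 * l))"
        by (rule mult_mono[OF order_trans[OF that(1) e] order_trans[OF that(2) e]]) (use that(3) le in auto)
      then show ?thesis by (simp add: power2_eq_square mult_ac)
    qed
    have "cmod k * cmod (W k) \<le> cmod k * (cmod (D k) * cmod (C' k) + cmod (D' k) * cmod (C k))"
      unfolding W_def by (intro mult_left_mono order_trans[OF norm_triangle_ineq4]) (simp_all add: norm_mult)
    also have "\<dots> \<le> K\<^sup>2 * (exp (K0 * l))\<^sup>2 + K\<^sup>2 * (exp (K0 * l))\<^sup>2"
      using add_mono[OF t[OF B(5)[of k] B(4)[of k]] t[OF B(6)[of k] B(3)[of k]]] by (simp add: distrib_left mult.assoc)
    finally show ?thesis by (simp add: M_def)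
  qed
  have "(W \<longlongrightarrow> 0) at_infinity"
  proof (rule Lim_null_comparison)
    show "\<forall>\<^sub>F k in at_infinity. norm (W k) \<le> norm (of_real M * inverse k)"
    proof (rule eventually_at_infinityI)
      fix k :: complex assume "1 \<le> norm k"
      then have k: "0 < norm k" by linarith
      have "0 \<le> M" using main[of 0] by simp
      have "norm (W k) \<le> M / norm k" using main[of k] k by (simp add: field_simps)
      then show "norm (W k) \<le> norm (of_real M * inverse k)"
        using \<open>0 \<le> M\<close> by (simp add: norm_mult norm_inverse divide_inverse)
    qed
    have "((\<lambda>k. of_real M * inverse k) \<longlongrightarrow> of_real M * (0::complex)) at_infinity"
      by (intro tendsto_mult tendsto_const tendsto_inverse_0)
    then show "((\<lambda>k. norm (of_real M * inverse k :: complex)) \<longlongrightarrow> 0) at_infinity"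
      by (simp add: tendsto_norm_zero)
  qed
  then have "W 0 = 0" using Liouville_weak_0[OF hol] by blast
  then have "D 0 = D' 0"
    by (simp add: W_def C_def C'_def Rr.neumann_at_0 Sr.neumann_at_0)
  then show ?thesis unfolding D_def D'_def Rr.dirichlet_at_0 Sr.dirichlet_at_0 y_def of_real_eq_iff .
qed

text \<open>For k = t > 0, F is a + i (t b / r(l)^2) z with real a and b. As Re z > 0, the imaginary
  part yields b and then the real part yields a. With the Cauchy data equal at l, the integrals of 1
  / r^2 agree, and differentiation gives r^2.\<close>

lemma jost_determines_radius:
  assumes "tract l r r'" "tract l s s'" and rho: "r l = s l"
    and j: "\<And>k. jost l r k = jost l s k" and x: "x \<in> {0..l}"
  shows "r x = s x"
proof -
  interpret R: tract l r r' by fact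
  interpret S: tract l s s' by fact
  interpret Rr: tract l "\<lambda>x. r (l - x)" "\<lambda>x. - r' (l - x)" by (rule R.tract_reflect)
  interpret Sr: tract l "\<lambda>x. s (l - x)" "\<lambda>x. - s' (l - x)" by (rule S.tract_reflect)
  have real_eq: "neumann r (of_real t) l = neumann s (of_real t) l \<and> neumann_flux r (of_real t) l = neumann_flux s (of_real t) l"
    if t: "0 < t" for t
  proof -
    have tr: "complex_of_real t \<in> \<real>" by simp
    obtain a where a: "neumann r (of_real t) l = of_real a" using R.neumann_real(1)[OF tr] by (elim Reals_cases)
    obtain b where b: "neumann_flux r (of_real t) l = of_real b" using R.neumann_real(2)[OF tr] by (elim Reals_cases)
    obtain a' where a': "neumann s (of_real t) l = of_real a'" using S.neumann_real(1)[OF tr] by (elim Reals_cases)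
    obtain b' where b': "neumann_flux s (of_real t) l = of_real b'" using S.neumann_real(2)[OF tr] by (elim Reals_cases)
    define z where "z = imp_fun (of_real (s l) * of_real t)"
    have z: "0 < Re z" unfolding z_def using t S.r_l_pos by (intro Re_imp_fun_pos) auto
    have 1: "jost l r (of_real t) = of_real a + \<i> * of_real (t * b / (s l)\<^sup>2) * z"
      unfolding jost_def a b rho z_def[symmetric] by simp
    have 2: "jost l s (of_real t) = of_real a' + \<i> * of_real (t * b' / (s l)\<^sup>2) * z"
      unfolding jost_def a' b' z_def[symmetric] by simp
    have "Im (jost l r (of_real t)) = Im (jost l s (of_real t))" by (simp add: j)
    then have "t * b / (s l)\<^sup>2 * Re z = t * b' / (s l)\<^sup>2 * Re z" unfolding 1 2 by simp
    then have "b = b'" using z t S.r_l_pos by simp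
    moreover from this have "a = a'" using j[of "of_real t"] unfolding 1 2 by simp
    ultimately show ?thesis by (simp add: a b a' b')
  qed
  have u: "neumann r k l = neumann s k l" for k
    by (rule entire_eq_on_pos_reals[OF R.neumann_holomorphic(1)[OF R.l_mem] S.neumann_holomorphic(1)[OF R.l_mem]])
       (use real_eq in blast)
  have f: "neumann_flux r k l = neumann_flux s k l" for k
    by (rule entire_eq_on_pos_reals[OF R.neumann_holomorphic(2)[OF R.l_mem] S.neumann_holomorphic(2)[OF R.l_mem]])
       (use real_eq in blast)
  define y where "y = l - x"
  have y: "y \<in> {0..l}" using x by (simp add: y_def)
  have int_eq: "integral {0..t} (\<lambda>y. 1 / (r (l - y))\<^sup>2) = integral {0..t} (\<lambda>y. 1 / (s (l - y))\<^sup>2)" if "t \<in> {0..l}" for t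
    using cauchy_data_unique[OF assms(1,2) u f, of "l - t"] that by simp
  have d1: "((\<lambda>t. integral {0..t} (\<lambda>y. 1 / (r (l - y))\<^sup>2)) has_vector_derivative 1 / (r (l - y))\<^sup>2) (at y within {0..l})"
    using Rr.inv_int_deriv[OF y] by (simp add: has_real_derivative_iff_has_vector_derivative)
  have d2: "((\<lambda>t. integral {0..t} (\<lambda>y. 1 / (s (l - y))\<^sup>2)) has_vector_derivative 1 / (s (l - y))\<^sup>2) (at y within {0..l})"
    using Sr.inv_int_deriv[OF y] by (simp add: has_real_derivative_iff_has_vector_derivative)
  have d3: "((\<lambda>t. integral {0..t} (\<lambda>y. 1 / (r (l - y))\<^sup>2)) has_vector_derivative 1 / (s (l - y))\<^sup>2) (at y within {0..l})"
    by (rule has_vector_derivative_transform[OF y int_eq d2])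
  have "1 / (r (l - y))\<^sup>2 = 1 / (s (l - y))\<^sup>2"
    by (rule vector_derivative_unique_within_closed_interval[OF R.l_pos _ d1[folded box_real(2)] d3[folded box_real(2)]])
       (use y in simp)
  then have "(r x)\<^sup>2 = (s x)\<^sup>2" by (simp add: y_def)
  then show ?thesis using R.r_pos[OF x] S.r_pos[OF x] by (simp add: power2_eq_iff)
qed

text \<open>Here \<beta> stands for Im b in a factor exp (b k) with Re b = 0. The factor adds
  \<beta> to the rate on the lower half axis and subtracts it on the upper one. The upper rate is
  first obtained with 2 r(l) (1 - \<eta>) in place of 2 r(l), then \<eta> is made small.\<close>

lemma jost_type_compare:
  assumes "tract l r r'" "tract m s s'"
    and e: "\<And>t. Re (jost l r (\<i> * of_real t)) = exp (- \<beta> * t) * Re (jost m s (\<i> * of_real t))"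
  shows "l \<le> m + \<beta>" "l + 2 * r l \<le> m + 2 * s m - \<beta>"
proof -
  interpret R: tract l r r' by fact
  interpret S: tract m s s' by fact
  obtain K c where R4: "\<And>t. K \<le> t \<Longrightarrow> c * exp (l * t) \<le> Re (jost l r (- \<i> * of_real t))"
    "\<And>t. K \<le> t \<Longrightarrow> c * exp (l * t) * imp_real (r l * t) \<le> Re (jost l r (\<i> * of_real t))"
    and R1: "0 < K" "0 < c"
    by (rule R.jost_imag_bounds) (rule that; assumption)
  obtain K' A' where S: "0 < K'" "0 < A'"
    "\<And>t. K' \<le> t \<Longrightarrow> Re (jost m s (- \<i> * of_real t)) \<le> A' * exp (m * t)"
    "\<And>t. K' \<le> t \<Longrightarrow> Re (jost m s (\<i> * of_real t)) \<le> A' * exp ((m + 2 * s m) * t)"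
    by (rule S.jost_imag_bounds) (rule that; assumption)
  show "l \<le> m + \<beta>"
  proof (rule exp_growth_compare[OF R1(2)])
    fix t assume t: "max K K' \<le> t"
    have "Re (jost l r (- \<i> * of_real t)) = exp (\<beta> * t) * Re (jost m s (- \<i> * of_real t))"
      using e[of "- t"] by simp
    also have "\<dots> \<le> exp (\<beta> * t) * (A' * exp (m * t))" using S(3) t by (intro mult_left_mono) auto
    also have "\<dots> = A' * exp ((m + \<beta>) * t)" by (simp add: exp_add distrib_right)
    finally show "c * exp (l * t) \<le> A' * exp ((m + \<beta>) * t)"
      using R4(1)[of t] t by linarith
  qed
  have "l + 2 * r l * (1 - \<eta>) \<le> m + 2 * s m - \<beta>" if \<eta>: "0 < \<eta>" "\<eta> < 1" for \<eta>
  proof -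
    obtain C where C: "0 < C" "\<And>t. 0 \<le> t \<Longrightarrow> C * (exp (2 * t * (1 - \<eta>)) - 1) \<le> imp_real t"
      using imp_real_lower_exp[OF \<eta>] by metis
    define T where "T = 1 / (2 * r l * (1 - \<eta>))"
    have rl: "0 < 2 * r l * (1 - \<eta>)" using R.r_l_pos \<eta> by simp
    show ?thesis
    proof (rule exp_growth_compare)
      show "0 < c * (C / 2)" using R1(2) C by simp
      fix t assume t: "max (max K K') T \<le> t"
      have t0: "0 < t" using t R1(1) by linarith
      have "1 \<le> 2 * r l * (1 - \<eta>) * t" using t rl by (simp add: T_def field_simps)
      then have "2 \<le> exp (2 * r l * (1 - \<eta>) * t)" using exp_ge_add_one_self[of "2 * r l * (1 - \<eta>) * t"] by linarith
      then have "C * (exp (2 * r l * (1 - \<eta>) * t) / 2) \<le> C * (exp (2 * r l * (1 - \<eta>) * t) - 1)"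
        using C(1) by (intro mult_left_mono) auto
      also have "\<dots> \<le> imp_real (r l * t)" using C(2)[of "r l * t"] R.r_l_pos t0 by (simp add: mult_ac)
      finally have i: "C * (exp (2 * r l * (1 - \<eta>) * t) / 2) \<le> imp_real (r l * t)" .
      have "c * (C / 2) * exp ((l + 2 * r l * (1 - \<eta>)) * t) = c * exp (l * t) * (C * (exp (2 * r l * (1 - \<eta>) * t) / 2))"
        by (simp add: exp_add distrib_right)
      also have "\<dots> \<le> c * exp (l * t) * imp_real (r l * t)" using i R1(2) by (intro mult_left_mono) auto
      also have "\<dots> \<le> Re (jost l r (\<i> * of_real t))" using R4(2) t by simp
      also have "\<dots> \<le> exp (- \<beta> * t) * (A' * exp ((m + 2 * s m) * t))"
        unfolding e using S(4) t by (intro mult_left_mono) auto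
      also have "\<dots> = A' * exp ((m + 2 * s m - \<beta>) * t)" by (simp add: mult_exp_exp algebra_simps)
      finally show "c * (C / 2) * exp ((l + 2 * r l * (1 - \<eta>)) * t) \<le> A' * exp ((m + 2 * s m - \<beta>) * t)" .
    qed
  qed
  note ineq = this
  show "l + 2 * r l \<le> m + 2 * s m - \<beta>"
  proof (rule ccontr)
    assume n: "\<not> l + 2 * r l \<le> m + 2 * s m - \<beta>"
    define d where "d = l + 2 * r l - (m + 2 * s m - \<beta>)"
    have d: "0 < d" using n by (simp add: d_def)
    \<comment> \<open>The rate lost is 2 r(l) \<eta> <= d / 2, which is less than the assumed excess
      d.\<close>
    define \<eta> where "\<eta> = min (1 / 2) (d / (4 * r l))"
    have \<eta>: "0 < \<eta>" "\<eta> < 1" "\<eta> \<le> d / (4 * r l)" using d R.r_l_pos by (auto simp: \<eta>_def)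
    have "\<eta> * (4 * r l) \<le> d" using \<eta>(3) R.r_l_pos by (simp add: pos_le_divide_eq)
    with ineq[OF \<eta>(1,2)] d show False by (simp add: d_def algebra_simps)
  qed
qed

text \<open>If Re b were nonzero, exp (b k) would be negative at k = i pi / Re b, where both
  functions are at least 1. Comparing rates in both directions gives l - m = Im b and r l - s m = -
  Im b, so either of the two equalities forces the other and b = 0.\<close>

lemma jost_ratio_unique:
  assumes "tract l r r'" "tract m s s'"
    and e: "\<And>k. jost l r k = exp (b * k) * jost m s k" and eq: "l = m \<or> r l = s m"
  shows "l = m \<and> (\<forall>x\<in>{0..l}. r x = s x)"
proof -
  interpret R: tract l r r' by fact
  interpret S: tract m s s' by fact
  have re: "Re (jost l r (\<i> * of_real t)) = exp (- Im b * t) * cos (Re b * t) * Re (jost m s (\<i> * of_real t))" for t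
    using e[of "\<i> * of_real t"] S.jost_imag_ge(2)[of t] by (simp add: Re_exp)
  have "Re b = 0"
  proof (rule ccontr)
    assume n: "Re b \<noteq> 0"
    then have "Re (jost l r (\<i> * of_real (pi / Re b))) = - exp (- Im b * (pi / Re b)) * Re (jost m s (\<i> * of_real (pi / Re b)))"
      unfolding re by simp
    also have "\<dots> < 0" using S.jost_imag_ge(1)[of "pi / Re b"] by (simp add: mult_neg_pos)
    finally show False using R.jost_imag_ge(1)[of "pi / Re b"] by linarith
  qed
  then have re': "Re (jost l r (\<i> * of_real t)) = exp (- Im b * t) * Re (jost m s (\<i> * of_real t))" for t
    unfolding re by simp
  have re'': "Re (jost m s (\<i> * of_real t)) = exp (- (- Im b) * t) * Re (jost l r (\<i> * of_real t))" for t
    unfolding re' by (simp add: mult.assoc[symmetric] mult_exp_exp)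
  note i = jost_type_compare[OF assms(1,2) re'] jost_type_compare[OF assms(2,1) re'']
  have "Im b = 0" "l = m" "r l = s m" using i eq by auto
  with \<open>Re b = 0\<close> have "b = 0" by (simp add: complex_eq_iff)
  then have "jost l r k = jost l s k" for k using e \<open>l = m\<close> by simp
  then have "r x = s x" if "x \<in> {0..l}" for x
    using jost_determines_radius[of l r r' s s' x] assms(1,2) \<open>l = m\<close> \<open>r l = s m\<close> that by simp
  then show ?thesis using \<open>l = m\<close> by simp
qed

section \<open>Pole listings and the function E\<close>

lemma eventually_not_in_finite: "finite F \<Longrightarrow> \<forall>\<^sub>F k in at (z::complex). k \<notin> F"
  using islimpt_finite[of F z] by (simp add: islimpt_iff_eventually)

lemma zorder_prod_linear:
  assumes "\<And>a. a \<in># M \<Longrightarrow> a \<noteq> 0"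
  shows "zorder (\<lambda>k. \<Prod>a\<in>#M. 1 - k / a) z = int (count M z)"
  using assms
proof (induction M)
  case (add a M)
  have "a \<noteq> 0" using add.prems by simp
  have an: "(\<lambda>k. \<Prod>a\<in>#M. 1 - k / a) analytic_on {z}" for M :: "complex multiset"
    by (induction M) (auto intro!: analytic_intros simp: divide_inverse)
  have fin: "finite (set_mset (add_mset a M))" by simp
  have "\<forall>\<^sub>F k in at z. k \<notin> set_mset (add_mset a M)"
    by (rule eventually_not_in_finite[OF fin])
  then have ev: "\<forall>\<^sub>F k in at z. (1 - k / a) * (\<Prod>a\<in>#M. 1 - k / a) \<noteq> 0"
  proof eventually_elim
    case (elim k)
    have n: "1 - k / b \<noteq> 0" if "b \<in># add_mset a M" for b
    proof
      assume "1 - k / b = 0"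
      then have "k = b" using add.prems[OF that] by (simp add: field_simps)
      then show False using elim that by simp
    qed
    have "(\<Prod>a\<in>#M. 1 - k / a) \<noteq> 0"
    proof
      assume "(\<Prod>a\<in>#M. 1 - k / a) = 0"
      then have "0 \<in># image_mset (\<lambda>a. 1 - k / a) M" by (simp only: prod_mset_zero_iff)
      then obtain b where "b \<in># M" "1 - k / b = 0" by (metis (no_types, lifting) imageE set_image_mset)
      then show False using n[of b] by (metis union_iff add_mset_add_single)
    qed
    then show ?case using n[of a] by (metis mult_eq_0_iff union_single_eq_member)
  qed
  have "zorder (\<lambda>k. (1 - k / a) * (\<Prod>a\<in>#M. 1 - k / a)) z = zorder (\<lambda>k. 1 - k / a) z + zorder (\<lambda>k. \<Prod>a\<in>#M. 1 - k / a) z"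
    by (rule zorder_times_analytic[OF _ an ev]) (use \<open>a \<noteq> 0\<close> in \<open>auto intro!: analytic_intros\<close>)
  moreover have "zorder (\<lambda>k. 1 - k / a) z = (if z = a then 1 else 0)"
  proof (cases "z = a")
    case True
    have "zorder (\<lambda>k. 1 - k / a) z = 1"
      by (rule zorder_eqI[of UNIV z "\<lambda>_. - 1 / a"]) (use True \<open>a \<noteq> 0\<close> in \<open>auto simp: field_simps\<close>)
    then show ?thesis using True by simp
  next
    case False
    have "zorder (\<lambda>k. 1 - k / a) z = 0"
      by (rule zorder_eq_0I) (use False \<open>a \<noteq> 0\<close> in \<open>auto intro!: analytic_intros simp: field_simps\<close>)
    then show ?thesis using False by simp
  qed
  ultimately show ?case using add by simp
qed auto

text \<open>In \<open>zero_extraction\<close> the bound 2 ^ size M <= A exp (3 B R) becomes linear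
  in R after taking logarithms. The multiset depends on R, but inside the disc its multiplicities
  are the orders of the zeros.\<close>

lemma zero_counting:
  assumes "exp_type g" "g 0 = 1"
  obtains C where "0 < C"
    "\<And>R. 0 < R \<Longrightarrow> \<exists>M. (\<forall>a. cmod a \<le> R \<longrightarrow> zorder g a = int (count M a)) \<and> real (size M) \<le> C * (1 + R)"
proof -
  obtain A B where AB: "1 \<le> A" "0 \<le> B" "\<And>k. cmod (g k) \<le> A * exp (B * cmod k)"
    using exp_type_bound[OF assms(1)] by metis
  define C where "C = (ln A + 3 * B + 1) / ln 2"
  have "0 < C" using AB by (simp add: C_def add_nonneg_pos)
  moreover have "\<exists>M. (\<forall>a. cmod a \<le> R \<longrightarrow> zorder g a = int (count M a)) \<and> real (size M) \<le> C * (1 + R)" if R: "0 < R" for R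
  proof -
    have K: "cmod (g k) \<le> A * exp (B * (3 * R))" if "cmod k = 3 * R" for k using AB(3)[of k] that by simp
    obtain M g1 where M: "g1 holomorphic_on UNIV" "\<And>k. g k = (\<Prod>a\<in>#M. 1 - k / a) * g1 k"
      "\<And>a. a \<in># M \<Longrightarrow> a \<noteq> 0 \<and> cmod a \<le> R" "\<And>k. cmod k \<le> R \<Longrightarrow> g1 k \<noteq> 0" "2 ^ size M \<le> A * exp (B * (3 * R))"
      using zero_extraction[OF R exp_type_holo[OF assms(1)] assms(2) K] by metis
    have "zorder g a = int (count M a)" if a: "cmod a \<le> R" for a
    proof -
      have g: "g = (\<lambda>k. (\<Prod>a\<in>#M. 1 - k / a) * g1 k)" using M(2) by blast
      have ag: "g1 analytic_on {a}" using M(1) by (meson UNIV_I analytic_at open_UNIV)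
      have ap: "(\<lambda>k. \<Prod>a\<in>#M. 1 - k / a) analytic_on {a}"
        by (induction M) (auto intro!: analytic_intros simp: divide_inverse)
      have "zorder g a = zorder (\<lambda>k. \<Prod>a\<in>#M. 1 - k / a) a + zorder g1 a"
      proof -
        have "\<forall>\<^sub>F k in at a. g k \<noteq> 0"
          using exp_type_eventually_nonzero[OF assms(1), of 0 a] assms(2) by simp
        then show ?thesis unfolding g by (rule zorder_times_analytic[OF ap ag])
      qed
      also have "zorder g1 a = 0" by (rule zorder_eq_0I[OF ag M(4)[OF a]])
      finally show ?thesis using zorder_prod_linear[of M a] M(3) by auto
    qed
    moreover have "real (size M) \<le> C * (1 + R)"
    proof -
      have "ln (2 ^ size M) \<le> ln (A * exp (B * (3 * R)))" by (rule ln_mono[OF M(5)]) (use AB in auto)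
      then have "real (size M) * ln 2 \<le> ln A + B * (3 * R)" using AB by (simp add: ln_realpow ln_mult)
      also have "\<dots> \<le> (ln A + 3 * B + 1) * (1 + R)"
      proof -
        have "0 \<le> ln A * R" using AB R by simp
        then show ?thesis using AB R by (simp add: algebra_simps)
      qed
      finally show ?thesis by (simp add: C_def field_simps)
    qed
    ultimately show ?thesis by blast
  qed
  ultimately show ?thesis using that by blast
qed

text \<open>The symmetry carries the local factorisation at a to b = - cnj a. Since - cnj w - a = -
  cnj (w - b), a sign (-1)^n appears, and it is absorbed into the nonvanishing factor.\<close>

lemma zorder_reflect:
  assumes "exp_type g" "g 0 = 1" and sym: "\<And>k. g (- cnj k) = cnj (g k)"
  shows "zorder g (- cnj a) = zorder g a"
proof -
  define n where "n = zorder g a"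
  define h where "h = zor_poly g a"
  have ana: "g analytic_on {a}" by (rule exp_type_analytic[OF assms(1)])
  have fr: "\<exists>\<^sub>F w in at a. g w \<noteq> 0"
    using exp_type_eventually_nonzero[OF assms(1), of 0 a] assms(2) by (intro eventually_frequently) auto
  obtain r where r: "h a \<noteq> 0" "r > 0" "h holomorphic_on cball a r"
      "\<And>w. w \<in> cball a r - {a} \<Longrightarrow> g w = h w * (w - a) powi n"
    using zorder_exist[OF isolated_singularity_at_analytic[OF ana] not_essential_analytic[OF ana] fr]
    unfolding n_def h_def by blast
  define b where "b = - cnj a"
  define h' where "h' w = cnj (h (- cnj w)) * (- 1) powi n" for w
  have mem: "- cnj w \<in> ball a r" if "w \<in> ball b r" for w
  proof -
    have "cmod (a - - cnj w) = cmod (cnj (a - - cnj w))" by (simp only: complex_mod_cnj)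
    also have "\<dots> = cmod (b - w)" unfolding b_def by (metis complex_cnj_add complex_cnj_cnj complex_cnj_minus diff_minus_eq_add minus_diff_eq minus_minus norm_minus_commute uminus_add_conv_diff add.commute diff_conv_add_uminus)
    finally show ?thesis using that by (simp add: dist_norm)
  qed
  show ?thesis
    unfolding n_def[symmetric] b_def[symmetric]
  proof (rule zorder_eqI[of "ball b r" b h'])
    show "h' holomorphic_on ball b r"
    proof -
      have "(h \<circ> uminus) holomorphic_on cnj ` ball b r"
      proof (rule holomorphic_on_compose)
        show "h holomorphic_on uminus ` cnj ` ball b r"
          by (rule holomorphic_on_subset[OF r(3)]) (use mem in fastforce)
      qed (auto intro!: holomorphic_intros)
      then have "(cnj \<circ> (h \<circ> uminus) \<circ> cnj) holomorphic_on ball b r"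
        by (rule holomorphic_on_compose_cnj_cnj) simp
      then show ?thesis unfolding h'_def[abs_def] o_def by (intro holomorphic_intros)
    qed
    show "h' b \<noteq> 0" using r(1) by (simp add: h'_def b_def)
    fix w assume w: "w \<in> ball b r" "w \<noteq> b"
    have "- cnj w \<noteq> a" using w(2) unfolding b_def by auto
    then have "g (- cnj w) = h (- cnj w) * (- cnj w - a) powi n"
      using r(4)[of "- cnj w"] mem[OF w(1)] by auto
    moreover have "g w = cnj (g (- cnj w))" using sym[of w] by simp
    moreover have "cnj ((- cnj w - a) powi n) = (- 1) powi n * (w - b) powi n"
    proof -
      have "cnj ((- cnj w - a) powi n) = (cnj (- cnj w - a)) powi n" by (simp add: complex_cnj_power_int)
      also have "cnj (- cnj w - a) = (- 1) * (w - b)" by (simp add: b_def)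
      also have "((- 1) * (w - b)) powi n = (- 1) powi n * (w - b) powi n" by (rule power_int_mult_distrib)
      finally show ?thesis .
    qed
    ultimately show "g w = h' w * (w - b) powi n" by (simp add: h'_def)
  qed (use r in auto)
qed

text \<open>The elements are listed by rank, where ties are broken by a counting of the set.\<close>

lemma nondecreasing_enumeration:
  fixes nm :: "'a \<Rightarrow> real"
  assumes fin: "\<And>R. finite {x\<in>A. nm x \<le> R}"
  obtains N :: enat and s :: "nat \<Rightarrow> 'a" where "bij_betw s {j. enat j < N} A"
    "\<And>i j. i \<le> j \<Longrightarrow> enat j < N \<Longrightarrow> nm (s i) \<le> nm (s j)"
proof -
  have "A = (\<Union>n. {x\<in>A. nm x \<le> real n})" using real_arch_simple by blast
  moreover have "countable (\<Union>n. {x\<in>A. nm x \<le> real n})" by (rule countable_UN[OF countableI_type countable_finite[OF fin]])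
  ultimately have "countable A" by simp
  define t where "t = to_nat_on A"
  have t: "inj_on t A" unfolding t_def by (rule inj_on_to_nat_on) fact
  define lt where "lt x y \<longleftrightarrow> nm x < nm y \<or> nm x = nm y \<and> t x < t y" for x y
  define h where "h y = card {x\<in>A. lt x y}" for y
  have finl: "finite {x\<in>A. lt x y}" for y
    by (rule finite_subset[OF _ fin[of "nm y"]]) (auto simp: lt_def)
  have hmono: "h x < h y" if "lt x y" "x \<in> A" for x y
    unfolding h_def using that by (intro psubset_card_mono finl) (auto simp: lt_def)
  have tot: "lt x y \<or> lt y x \<or> x = y" if "x \<in> A" "y \<in> A" for x y
    using inj_onD[OF t _ that] unfolding lt_def by (metis linorder_less_linear)
  have hinj: "inj_on h A"
  proof (rule inj_onI)
    fix x y assume xy: "x \<in> A" "y \<in> A" "h x = h y"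
    show "x = y" using tot[OF xy(1,2)] hmono[of x y] hmono[of y x] xy by auto
  qed
  define S where "S = h ` A"
  have hb: "bij_betw h A S" using hinj by (simp add: S_def bij_betw_def)
  define N where "N = (if finite S then enat (card S) else \<infinity>)"
  \<comment> \<open>\<open>enumerate\<close> lists the set of ranks increasingly, whether it is
    finite or infinite; this decides whether \<open>N\<close> is finite.\<close>
  have e: "bij_betw (enumerate S) {j. enat j < N} S"
  proof (cases "finite S")
    case True
    then show ?thesis using finite_bij_enumerate[OF True] by (simp add: N_def lessThan_def)
  next
    case False
    then show ?thesis using bij_enumerate[OF False] by (simp add: N_def)
  qed
  have emono: "enumerate S i \<le> enumerate S j" if "i \<le> j" "enat j < N" for i j
    using that by (cases "finite S"; cases "i = j") (auto simp: N_def intro!: less_imp_le finite_enumerate_mono)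
  define s where "s = inv_into A h \<circ> enumerate S"
  have b: "bij_betw s {j. enat j < N} A"
    unfolding s_def by (rule bij_betw_trans[OF e bij_betw_inv_into[OF hb]])
  have hs: "h (s j) = enumerate S j" if "enat j < N" for j
  proof -
    have "enumerate S j \<in> S" using e that by (auto simp: bij_betw_def)
    then show ?thesis by (simp add: s_def S_def f_inv_into_f)
  qed
  show ?thesis
  proof (rule that[OF b])
    fix i j assume ij: "i \<le> j" "enat j < N"
    then have iN: "enat i < N" by (metis enat_ord_simps(1) le_less_trans)
    have A: "s i \<in> A" "s j \<in> A" using b ij(2) iN by (auto simp: bij_betw_def)
    show "nm (s i) \<le> nm (s j)"
    proof (rule ccontr)
      assume "\<not> nm (s i) \<le> nm (s j)"
      then have "h (s j) < h (s i)" using A by (intro hmono) (auto simp: lt_def)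
      then show False using emono[OF ij] by (simp add: hs ij iN)
    qed
  qed
qed

section \<open>Existence of pole listings\<close>

context tract
begin

lemma pole_listing_exists:
  assumes "0 < c" "0 < \<mu>"
  shows "is_pole_listing (lip_pressure c \<mu> l r) Q (pole_listing (lip_pressure c \<mu> l r) Q)"
proof -
  define m where "m k = nat (zorder (jost l r) k)" for k
  \<comment> \<open>A pole of multiplicity m is represented by m pairs, so that listing with
    multiplicities becomes an enumeration of a set.\<close>
  define A where "A = (SIGMA k:Q. {..<m k})"
  have fin: "finite {x\<in>A. cmod (fst x) \<le> R}" for R
  proof -
    obtain M where M: "\<And>a. cmod a \<le> max R 1 \<Longrightarrow> zorder (jost l r) a = int (count M a)"
      using zero_counting[OF exp_type_jost jost_0] by (metis max.strict_coboundedI2 zero_less_one)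
    have "{x\<in>A. cmod (fst x) \<le> R} \<subseteq> (SIGMA k:set_mset M. {..<m k})"
    proof safe
      fix k i assume "(k, i) \<in> A" "cmod (fst (k, i)) \<le> R"
      then have "0 < m k" "cmod k \<le> max R 1" "i < m k" by (auto simp: A_def)
      then show "k \<in># M" "i < m k" using M[of k] by (auto simp: m_def)
    qed
    then show ?thesis by (rule finite_subset) auto
  qed
  obtain N and s :: "nat \<Rightarrow> complex \<times> nat" where s: "bij_betw s {j. enat j < N} A"
    "\<And>i j. i \<le> j \<Longrightarrow> enat j < N \<Longrightarrow> cmod (fst (s i)) \<le> cmod (fst (s j))"
    using nondecreasing_enumeration[of A "\<lambda>x. cmod (fst x)", OF fin] by metis
  define s' where "s' = restrict (fst \<circ> s) {j. enat j < N}"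
  have s': "s' j = fst (s j)" if "enat j < N" for j using that by (simp add: s'_def)
  have "is_pole_listing (lip_pressure c \<mu> l r) Q (N, s')"
    unfolding is_pole_listing_def split_conv
  proof (intro conjI allI impI ballI)
    show "s' \<in> extensional {j. enat j < N}" by (simp add: s'_def)
    fix j assume j: "enat j < N"
    then have "s j \<in> A" using s(1) by (auto simp: bij_betw_def)
    then have q: "fst (s j) \<in> Q" "0 < m (fst (s j))" by (auto simp: A_def)
    then show "s' j \<in> Q" by (simp add: s'[OF j])
    show "is_pole (lip_pressure c \<mu> l r) (s' j)"
      using q(2) jost_zorder_pos(1) unfolding lip_pressure_poles(1)[OF assms] s'[OF j] by (simp add: m_def)
  next
    fix i j assume "i \<le> j \<and> enat j < N"
    then have ij: "i \<le> j" "enat j < N" by auto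
    then have "enat i < N" by (metis enat_ord_simps(1) le_less_trans)
    then show "cmod (s' i) \<le> cmod (s' j)" using s(2)[OF ij] ij by (simp add: s')
  next
    fix k assume k: "k \<in> Q"
    have "bij_betw s {j. enat j < N \<and> s' j = k} ({k} \<times> {..<m k})"
    proof (rule bij_betw_subset[OF s(1)])
      show "s ` {j. enat j < N \<and> s' j = k} = {k} \<times> {..<m k}"
      proof (rule set_eqI, rule iffI)
        fix x assume "x \<in> s ` {j. enat j < N \<and> s' j = k}"
        then obtain j where j: "enat j < N" "s' j = k" "x = s j" by blast
        then have "x \<in> A" using s(1) by (auto simp: bij_betw_def)
        then show "x \<in> {k} \<times> {..<m k}" using j s'[OF j(1)] by (auto simp: A_def)
      next
        fix x assume x: "x \<in> {k} \<times> {..<m k}"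
        then have "x \<in> A" using k by (auto simp: A_def)
        then obtain j where "enat j < N" "x = s j" using s(1) unfolding bij_betw_def by blast
        then show "x \<in> s ` {j. enat j < N \<and> s' j = k}" using x s' by (auto intro!: imageI)
      qed
    qed auto
    then show "finite {j. enat j < N \<and> s' j = k}" "card {j. enat j < N \<and> s' j = k} = pole_mult (lip_pressure c \<mu> l r) k"
      by (simp_all add: bij_betw_finite bij_betw_same_card lip_pressure_poles(2)[OF assms] m_def)
  qed
  then show ?thesis unfolding pole_listing_def by (rule someI)
qed

end

text \<open>The hypothesis says |s j| >= (j + 1) / C - 1, so the squares compare with 1 / j^2. The
  exponent 2 is what a Weierstrass product of genus one requires.\<close>

lemma linear_growth_square_summable:
  assumes "0 < C" and lin: "\<And>j. real (j + 1) \<le> C * (1 + cmod (s j))" and "\<And>j. s j \<noteq> 0"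
  shows "filterlim s at_infinity sequentially" "summable (\<lambda>n. (r / norm (s n)) ^ Suc 1)"
proof -
  have lb: "real (j + 1) / C - 1 \<le> cmod (s j)" for j
    using lin[of j] assms(1) by (simp add: field_simps)
  show "filterlim s at_infinity sequentially"
  proof (rule filterlim_norm_at_top_imp_at_infinity, unfold filterlim_at_top, rule allI)
    fix Z
    show "\<forall>\<^sub>F j in sequentially. Z \<le> cmod (s j)"
      using eventually_ge_at_top[of "nat \<lceil>(Z + 1) * C\<rceil>"]
    proof eventually_elim
      case (elim j)
      then have "(Z + 1) * C \<le> real (j + 1)" by linarith
      then have "Z + 1 \<le> real (j + 1) / C" using assms(1) by (simp add: pos_le_divide_eq)
      then show ?case using lb[of j] by linarith
    qed
  qed
  show "summable (\<lambda>n. (r / norm (s n)) ^ Suc 1)"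
  proof (rule summable_comparison_test_ev)
    have "\<forall>\<^sub>F j in sequentially. 2 * C \<le> real j" using eventually_ge_at_top[of "nat \<lceil>2 * C\<rceil>"] by eventually_elim linarith
    then show "\<forall>\<^sub>F j in sequentially. norm ((r / norm (s j)) ^ Suc 1) \<le> (2 * C * r)\<^sup>2 * inverse (real j ^ 2)"
    proof eventually_elim
      case (elim j)
      have j: "0 < real j" using elim assms(1) by linarith
      have "real j / (2 * C) \<le> real j / C - 1" using elim assms(1) by (simp add: field_simps)
      also have "\<dots> \<le> real (j + 1) / C - 1" using assms(1) by (simp add: divide_right_mono)
      finally have "real j / (2 * C) \<le> cmod (s j)" using lb[of j] by linarith
      then have "real j \<le> 2 * C * cmod (s j)" using assms(1) by (simp add: field_simps)
      then have "\<bar>r\<bar> * real j \<le> \<bar>r\<bar> * (2 * C * cmod (s j))" by (intro mult_left_mono) auto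
      then have "\<bar>r\<bar> / cmod (s j) \<le> 2 * C * \<bar>r\<bar> / real j" using j assms(3)[of j] by (simp add: field_simps)
      then have "(\<bar>r\<bar> / cmod (s j))\<^sup>2 \<le> (2 * C * \<bar>r\<bar> / real j)\<^sup>2" by (intro power_mono) auto
      moreover have "norm ((r / cmod (s j)) ^ Suc 1) = (\<bar>r\<bar> / cmod (s j))\<^sup>2"
        by (simp add: power2_eq_square abs_mult)
      moreover have "(2 * C * \<bar>r\<bar> / real j)\<^sup>2 = (2 * C * r)\<^sup>2 * inverse (real j ^ 2)"
        by (simp add: power_divide power_mult_distrib divide_inverse power_inverse)
      ultimately show ?case by (simp only:)
    qed
    show "summable (\<lambda>j. (2 * C * r)\<^sup>2 * inverse (real j ^ 2))"
      by (intro summable_mult inverse_power_summable) simp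
  qed
qed

text \<open>A zero of one factor may coincide with a reflected zero of another. Excluding the points
  - cnj (s j) leaves the simple zeros of 1 - k / s j as the only contributions to the order.\<close>

lemma E_product_finite:
  assumes nz: "\<And>j. j < n \<Longrightarrow> s j \<noteq> 0"
  defines "P \<equiv> E_product (enat n, s)"
  shows "P analytic_on {z}" "P z = 0 \<longleftrightarrow> (\<exists>j<n. z = s j \<or> z = - cnj (s j))"
    "(\<And>j. j < n \<Longrightarrow> z \<noteq> - cnj (s j)) \<Longrightarrow> zorder P z = int (card {j. j < n \<and> s j = z})"
proof -
  define f where "f j k = (1 - k / s j) * exp (k / s j) * (1 + k / cnj (s j)) * exp (- k / cnj (s j))" for j and k :: complex
  have P: "P k = (\<Prod>j<n. f j k)" for k
  proof -
    have "(\<lambda>j. if j < n then f j k else 1) has_prod (\<Prod>j | j < n. f j k)" by (rule has_prod_If_finite) simp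
    then have "(\<Prod>j. if j < n then f j k else 1) = (\<Prod>j | j < n. f j k)" by (rule has_prod_unique[symmetric])
    moreover have "P k = (\<Prod>j. if j < n then f j k else 1)"
      by (simp only: P_def E_product_def f_def prod.case enat_ord_simps)
    ultimately show ?thesis by (simp add: lessThan_def)
  qed
  have Pf: "P = (\<lambda>k. \<Prod>j<n. f j k)" using P by blast
  have fan: "f j analytic_on {z}" if "j < n" for j z
    unfolding f_def[abs_def] using nz[OF that] by (intro analytic_intros) auto
  show "P analytic_on {z}" unfolding Pf by (intro analytic_on_prod fan) auto
  have lin0: "1 - k / s j = 0 \<longleftrightarrow> k = s j" "1 + k / cnj (s j) = 0 \<longleftrightarrow> k = - cnj (s j)" if "j < n" for j k
    using nz[OF that] by (auto simp: field_simps add_eq_0_iff add_eq_0_iff2)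
  have f0: "f j k = 0 \<longleftrightarrow> k = s j \<or> k = - cnj (s j)" if "j < n" for j k
    unfolding f_def mult_eq_0_iff lin0[OF that] by simp
  show P0: "P z = 0 \<longleftrightarrow> (\<exists>j<n. z = s j \<or> z = - cnj (s j))" for z
    unfolding P by (auto simp: prod_zero_iff f0)
  assume no: "\<And>j. j < n \<Longrightarrow> z \<noteq> - cnj (s j)"
  define F where "F = s ` {..<n} \<union> (\<lambda>j. - cnj (s j)) ` {..<n}"
  have fin: "finite F" by (simp add: F_def)
  have "\<forall>\<^sub>F k in at z. k \<notin> F"
    by (rule eventually_not_in_finite[OF fin])
  then have ev: "\<forall>\<^sub>F k in at z. (\<Prod>j<n. f j k) \<noteq> 0"
    by eventually_elim (use P0 P in \<open>auto simp: F_def\<close>)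
  have "zorder P z = (\<Sum>j<n. zorder (f j) z)"
    unfolding Pf by (rule zorder_prod_analytic[OF _ ev]) (use fan in auto)
  also have "\<dots> = (\<Sum>j<n. if s j = z then 1 else 0)"
  proof (rule sum.cong[OF refl])
    fix j assume "j \<in> {..<n}"
    then have j: "j < n" by simp
    show "zorder (f j) z = (if s j = z then 1 else 0)"
    proof (cases "s j = z")
      case True
      have "zorder (f j) z = 1"
      proof (rule zorder_eqI[of UNIV z "\<lambda>k. - 1 / s j * exp (k / s j) * (1 + k / cnj (s j)) * exp (- k / cnj (s j))"])
        show "(\<lambda>k. - 1 / s j * exp (k / s j) * (1 + k / cnj (s j)) * exp (- k / cnj (s j))) holomorphic_on UNIV"
          using nz[OF j] by (intro holomorphic_intros) auto
        show "- 1 / s j * exp (z / s j) * (1 + z / cnj (s j)) * exp (- z / cnj (s j)) \<noteq> 0"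
          using nz[OF j] no[OF j] unfolding mult_eq_0_iff lin0[OF j] by simp
        show "f j w = - 1 / s j * exp (w / s j) * (1 + w / cnj (s j)) * exp (- w / cnj (s j)) * (w - z) powi 1" for w
        proof -
          have "1 - w / s j = - 1 / s j * (w - z)" using nz[OF j] True by (auto simp: field_simps)
          then show ?thesis by (simp add: f_def)
        qed
      qed auto
      then show ?thesis using True by simp
    next
      case False
      then show ?thesis using f0[OF j, of z] no[OF j] zorder_eq_0I[OF fan[OF j]] by auto
    qed
  qed
  also have "\<dots> = int (card {j. j < n \<and> s j = z})"
  proof -
    have "{j. j < n \<and> s j = z} = {..<n} \<inter> {j. s j = z}" by auto
    then show ?thesis by (simp add: sum.If_cases)
  qed
  finally show "zorder P z = int (card {j. j < n \<and> s j = z})" .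
qed

text \<open>The exponential factors in E are those of Weierstrass factors of genus one, so this is
  the product of two canonical products, over s j and over - cnj (s j).\<close>

lemma E_product_infinite:
  assumes nz: "\<And>j. s j \<noteq> 0" and "0 < C" and lin: "\<And>j. real (j + 1) \<le> C * (1 + cmod (s j))"
  defines "P \<equiv> E_product (\<infinity>, s)"
  shows "P analytic_on {z}" "P z = 0 \<longleftrightarrow> (\<exists>j. z = s j \<or> z = - cnj (s j))"
    "(\<And>j. z \<noteq> - cnj (s j)) \<Longrightarrow> zorder P z = int (card {j. s j = z})"
proof -
  interpret A: weierstrass_product s "\<lambda>_. 1"
    by unfold_locales (use nz linear_growth_square_summable[OF assms(2,3) nz] in auto)
  interpret B: weierstrass_product "\<lambda>j. - cnj (s j)" "\<lambda>_. 1"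
    by unfold_locales (use nz linear_growth_square_summable[of C "\<lambda>j. - cnj (s j)"] assms(2,3) in auto)
  have P: "P k = A.f k * B.f k" for k
  proof -
    have w: "weierstrass_factor 1 (k / s j) * weierstrass_factor 1 (k / - cnj (s j)) =
       (1 - k / s j) * exp (k / s j) * (1 + k / cnj (s j)) * exp (- k / cnj (s j))" for j
      by (simp add: weierstrass_factor_def)
    have conv: "convergent_prod (\<lambda>j. weierstrass_factor 1 (k / s j) * weierstrass_factor 1 (k / - cnj (s j)))"
      by (intro convergent_prod_mult A.convergent B.convergent)
    have "(\<lambda>n. \<Prod>j\<le>n. weierstrass_factor 1 (k / s j) * weierstrass_factor 1 (k / - cnj (s j))) \<longlonglongrightarrow> P k"
      using convergent_prod_LIMSEQ[OF conv] unfolding w by (simp add: P_def E_product_def)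
    moreover have "(\<lambda>n. \<Prod>j\<le>n. weierstrass_factor 1 (k / s j) * weierstrass_factor 1 (k / - cnj (s j))) \<longlonglongrightarrow> A.f k * B.f k"
      unfolding prod.distrib A.f_def B.f_def
      by (intro tendsto_mult convergent_prod_LIMSEQ A.convergent B.convergent)
    ultimately show ?thesis by (rule LIMSEQ_unique)
  qed
  have Pf: "P = (\<lambda>k. A.f k * B.f k)" using P by blast
  show "P analytic_on {z}" unfolding Pf by (intro analytic_intros A.analytic B.analytic)
  show "P z = 0 \<longleftrightarrow> (\<exists>j. z = s j \<or> z = - cnj (s j))" unfolding P using A.zero[of z] B.zero[of z] by auto
  assume no: "\<And>j. z \<noteq> - cnj (s j)"
  have nz0: "A.f 0 \<noteq> 0" "B.f 0 \<noteq> 0" using A.zero[of 0] B.zero[of 0] nz by auto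
  note nb = non_zero_neighbour_alt[OF _ open_UNIV connected_UNIV UNIV_I UNIV_I]
  have "\<forall>\<^sub>F k in at z. A.f k \<noteq> 0 \<and> k \<in> UNIV" "\<forall>\<^sub>F k in at z. B.f k \<noteq> 0 \<and> k \<in> UNIV"
    by (rule nb[OF A.holomorphic nz0(1)] nb[OF B.holomorphic nz0(2)])+
  then have "\<forall>\<^sub>F k in at z. A.f k * B.f k \<noteq> 0" by eventually_elim simp
  then have "zorder P z = zorder A.f z + zorder B.f z"
    unfolding Pf by (intro zorder_times_analytic A.analytic B.analytic)
  also have "zorder B.f z = 0" using B.zero[of z] no by (intro zorder_eq_0I B.analytic) auto
  finally show "zorder P z = int (card {j. s j = z})" using A.zorder[of z] by (simp add: vimage_def)
qed

text \<open>By monotonicity the first j + 1 entries lie in the disc of radius |s j|. Each value is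
  repeated at most as often as its order as a zero of g, so j + 1 is at most the number of zeros
  counted in that disc.\<close>

lemma listing_linear_growth:
  assumes g: "exp_type g" "g 0 = 1" and C: "0 < C"
    "\<And>R. 0 < R \<Longrightarrow> \<exists>M. (\<forall>a. cmod a \<le> R \<longrightarrow> zorder g a = int (count M a)) \<and> real (size M) \<le> C * (1 + R)"
    and mono: "\<And>i j. i \<le> j \<Longrightarrow> cmod (s i) \<le> cmod (s j)"
    and cnt: "\<And>j. finite {i. s i = s j} \<and> int (card {i. s i = s j}) \<le> zorder g (s j)" and nz: "\<And>j. s j \<noteq> (0::complex)"
  shows "real (j + 1) \<le> C * (1 + cmod (s j))"
proof -
  define R where "R = cmod (s j)"
  have R: "0 < R" using nz by (simp add: R_def)
  obtain M where M: "\<forall>a. cmod a \<le> R \<longrightarrow> zorder g a = int (count M a)" "real (size M) \<le> C * (1 + R)"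
    using C(2)[OF R] by blast
  have "card {..j} = (\<Sum>a\<in>s ` {..j}. card {i\<in>{..j}. s i = a})"
    using sum.image_gen[of "{..j}" "\<lambda>_. 1::nat" s] by simp
  also have "\<dots> \<le> (\<Sum>a\<in>s ` {..j}. count M a)"
  proof (rule sum_mono)
    fix a assume "a \<in> s ` {..j}"
    then obtain i where i: "i \<le> j" "a = s i" by auto
    have "card {i\<in>{..j}. s i = a} \<le> card {i'. s i' = s i}"
      using cnt[of i] i by (intro card_mono) auto
    moreover have "int (card {i'. s i' = s i}) \<le> int (count M a)"
      using cnt[of i] M(1) mono[OF i(1)] i(2) by (simp add: R_def)
    ultimately show "card {i\<in>{..j}. s i = a} \<le> count M a" by linarith
  qed
  also have "\<dots> = (\<Sum>a\<in>s ` {..j} \<inter> set_mset M. count M a)"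
    by (rule sum.mono_neutral_right) (auto simp: not_in_iff)
  also have "\<dots> \<le> (\<Sum>a\<in>set_mset M. count M a)" by (rule sum_mono2) auto
  also have "\<dots> = size M" by (simp add: size_multiset_overloaded_eq)
  finally show ?thesis using M(2) by (simp add: R_def)
qed

section \<open>Zeros of E\<close>

context tract
begin

lemma E_product_listing:
  assumes cmu: "0 < c" "0 < \<mu>" and Q: "0 \<notin> Q"
  defines "f \<equiv> lip_pressure c \<mu> l r"
  defines "P \<equiv> E_product (pole_listing f Q)"
  shows "P analytic_on {z}" "P z = 0 \<Longrightarrow> z \<in> Q \<or> - cnj z \<in> Q"
    "z \<in> Q \<Longrightarrow> - cnj z \<notin> Q \<Longrightarrow> zorder P z = int (pole_mult f z)"
proof -
  obtain N s where L: "pole_listing f Q = (N, s)" by (cases "pole_listing f Q")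
  have lst: "is_pole_listing f Q (N, s)" using pole_listing_exists[OF cmu, of Q] unfolding f_def[symmetric] L .
  have sQ: "s j \<in> Q" if "enat j < N" for j using lst that by (simp add: is_pole_listing_def)
  have nz: "s j \<noteq> 0" if "enat j < N" for j using sQ[OF that] Q by auto
  have mult: "finite {j. enat j < N \<and> s j = k}" "card {j. enat j < N \<and> s j = k} = pole_mult f k" if "k \<in> Q" for k
    using lst that by (simp_all add: is_pole_listing_def)
  have iff: "z = - cnj w \<longleftrightarrow> - cnj z = w" for w by auto
  consider n where "N = enat n" | "N = \<infinity>" by (cases N) auto
  then have "P analytic_on {z} \<and> (P z = 0 \<longrightarrow> z \<in> Q \<or> - cnj z \<in> Q) \<and>
    (z \<in> Q \<longrightarrow> - cnj z \<notin> Q \<longrightarrow> zorder P z = int (pole_mult f z))"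
  proof cases
    case 1
    have nz': "s j \<noteq> 0" if "j < n" for j using nz 1 that by simp
    have "P = E_product (enat n, s)" using L 1 by (simp add: P_def)
    note E = E_product_finite[of n s, OF nz', folded this]
    have "z \<noteq> - cnj (s j)" if "- cnj z \<notin> Q" "j < n" for j using that sQ 1 iff by auto
    then show ?thesis using E[of z] mult[of z] sQ iff 1 by auto
  next
    case 2
    have nz': "s j \<noteq> 0" for j using nz 2 by simp
    have mono: "cmod (s i) \<le> cmod (s j)" if "i \<le> j" for i j using lst that 2 by (simp add: is_pole_listing_def)
    have cnt: "finite {i. s i = s j} \<and> int (card {i. s i = s j}) \<le> zorder (jost l r) (s j)" for j
      using mult[of "s j"] sQ[of j] 2 jost_zorder_pos(2)[of "s j"] lip_pressure_poles(2)[OF cmu, of "s j"] by (simp add: f_def)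
    obtain C where C: "0 < C"
    "\<And>R. 0 < R \<Longrightarrow> \<exists>M. (\<forall>a. cmod a \<le> R \<longrightarrow> zorder (jost l r) a = int (count M a)) \<and> real (size M) \<le> C * (1 + R)"
      using zero_counting[OF exp_type_jost jost_0] by blast
    note lin = listing_linear_growth[OF exp_type_jost jost_0 C mono cnt nz']
    have "P = E_product (\<infinity>, s)" using L 2 by (simp add: P_def)
    note E = E_product_infinite[of s C, OF nz' C(1) lin, folded this]
    have "z \<noteq> - cnj (s j)" if "- cnj z \<notin> Q" for j using that sQ 2 iff by auto
    then show ?thesis using E[of z] mult[of z] sQ iff 2 by auto
  qed
  then show "P analytic_on {z}" "P z = 0 \<Longrightarrow> z \<in> Q \<or> - cnj z \<in> Q"
    "z \<in> Q \<Longrightarrow> - cnj z \<notin> Q \<Longrightarrow> zorder P z = int (pole_mult f z)" by auto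
qed

text \<open>The poles in the first and fourth quadrants and their reflections occupy four disjoint
  open quadrants. At z the other product and the factor - i k are therefore nonzero, and E has the
  order of a single product.\<close>

lemma zorder_E_fun:
  assumes "0 < c" "0 < \<mu>" "z \<in> quadrant1 \<union> quadrant4"
  shows "zorder (E_fun c \<mu> l r) z = int (pole_mult (lip_pressure c \<mu> l r) z)"
proof -
  define p where "p = E_product (poles_plus c \<mu> l r)"
  define m where "m = E_product (poles_minus c \<mu> l r)"
  have q: "0 \<notin> quadrant1" "0 \<notin> quadrant4" by (auto simp: quadrant1_def quadrant4_def)
  note P = E_product_listing[OF assms(1,2) q(1), folded poles_plus_def, folded p_def]
  note M = E_product_listing[OF assms(1,2) q(2), folded poles_minus_def, folded m_def]
  have z0: "z \<noteq> 0" using assms(3) q by auto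
  have E: "zorder (E_fun c \<mu> l r) z = zorder g z" if f: "f z \<noteq> 0" and fg: "f = m \<and> g = p \<or> f = p \<and> g = m" for f g
  proof -
    have a: "f analytic_on {z}" "g analytic_on {z}" for z using P(1) M(1) fg by auto
    then have h: "g holomorphic_on UNIV" by (meson analytic_imp_holomorphic analytic_on_analytic_at)
    have "g 0 \<noteq> 0" using P(2)[of 0] M(2)[of 0] q fg by auto
    then have ev: "\<forall>\<^sub>F k in at z. g k \<noteq> 0"
      using non_zero_neighbour_alt[OF h open_UNIV connected_UNIV UNIV_I UNIV_I, of 0 z] by simp
    have F: "(\<lambda>k. - \<i> * k * f k) analytic_on {z}" by (intro analytic_intros a)
    have "\<forall>\<^sub>F k in at z. - \<i> * k * f k \<noteq> 0"
      by (rule tendsto_imp_eventually_ne[OF isContD[OF analytic_at_imp_isCont[OF F]]]) (use z0 f in simp)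
    then have "\<forall>\<^sub>F k in at z. (- \<i> * k * f k) * g k \<noteq> 0" using ev by eventually_elim simp
    then have "zorder (\<lambda>k. (- \<i> * k * f k) * g k) z = zorder (\<lambda>k. - \<i> * k * f k) z + zorder g z"
      by (intro zorder_times_analytic F a)
    also have "zorder (\<lambda>k. - \<i> * k * f k) z = 0" using z0 f by (intro zorder_eq_0I F) auto
    also have "(\<lambda>k. (- \<i> * k * f k) * g k) = E_fun c \<mu> l r"
      using fg by (auto simp: E_fun_def p_def m_def fun_eq_iff)
    finally show ?thesis by simp
  qed
  show ?thesis
  proof (cases "z \<in> quadrant1")
    case True
    then have "m z \<noteq> 0" using M(2)[of z] by (auto simp: quadrant1_def quadrant4_def)
    moreover have "zorder p z = int (pole_mult (lip_pressure c \<mu> l r) z)"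
      using P(3)[of z] True by (auto simp: quadrant1_def)
    ultimately show ?thesis using E[of m p] by simp
  next
    case False
    then have z: "z \<in> quadrant4" using assms(3) by simp
    then have "p z \<noteq> 0" using P(2)[of z] by (auto simp: quadrant1_def quadrant4_def)
    moreover have "zorder m z = int (pole_mult (lip_pressure c \<mu> l r) z)"
      using M(3)[of z] z by (auto simp: quadrant4_def)
    ultimately show ?thesis using E[of p m] by simp
  qed
qed

end

section \<open>The data sets\<close>

lemma radius_class_tract:
  assumes "0 < l" "r \<in> radius_class l"
  obtains r' where "tract l r r'"
proof -
  obtain r' where "\<forall>x\<in>{0..l}. (r has_real_derivative r' x) (at x within {0..l})" "continuous_on {0..l} r'" "\<forall>x\<in>{0..l}. 0 < r x"
    using assms(2) unfolding radius_class_def by blast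
  then have "tract l r r'" using assms(1) by unfold_locales auto
  then show ?thesis by (rule that)
qed

lemma is_pole_listing_determines_mult:
  assumes "is_pole_listing f Q L" "is_pole_listing g Q L" "k \<in> Q"
  shows "pole_mult f k = pole_mult g k"
proof -
  obtain N s where L: "L = (N, s)" by (cases L)
  show ?thesis using assms unfolding L is_pole_listing_def split_conv by metis
qed

lemma zorder_jost_eq:
  assumes "tract l r r'" "tract m s s'" "0 < c" "0 < \<mu>"
    and eq: "\<And>k. k \<in> Q \<Longrightarrow> pole_mult (lip_pressure c \<mu> l r) k = pole_mult (lip_pressure c \<mu> m s) k"
    and k: "k \<in> Q \<or> - cnj k \<in> Q"
  shows "zorder (jost l r) k = zorder (jost m s) k"
proof -
  interpret R: tract l r r' by fact
  interpret S: tract m s s' by fact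
  have *: "zorder (jost l r) k = zorder (jost m s) k" if "k \<in> Q" for k
    using eq[OF that] R.jost_zorder_pos(2)[of k] S.jost_zorder_pos(2)[of k]
    unfolding R.lip_pressure_poles(2)[OF assms(3,4)] S.lip_pressure_poles(2)[OF assms(3,4)] by simp
  show ?thesis
    using k * zorder_reflect[OF R.exp_type_jost R.jost_0 R.jost_reflect, of k]
      zorder_reflect[OF S.exp_type_jost S.jost_0 S.jost_reflect, of k] by metis
qed

lemma quadrants_cover: "Re k \<noteq> 0 \<Longrightarrow> Im k \<noteq> 0 \<Longrightarrow> k \<in> quadrant1 \<union> quadrant4 \<or> - cnj k \<in> quadrant1 \<union> quadrant4"
  unfolding quadrant1_def quadrant4_def by (cases "Re k > 0"; cases "Im k > 0") auto

lemma same_poles_jost_ratio: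
  assumes "tract l r r'" "tract m s s'" "0 < c" "0 < \<mu>"
    and eq: "\<And>k. k \<in> quadrant1 \<union> quadrant4 \<Longrightarrow> pole_mult (lip_pressure c \<mu> l r) k = pole_mult (lip_pressure c \<mu> m s) k"
  obtains b where "\<And>k. jost l r k = exp (b * k) * jost m s k"
proof -
  interpret R: tract l r r' by fact
  interpret S: tract m s s' by fact
  have z: "zorder (jost l r) k = zorder (jost m s) k" if "Re k \<noteq> 0" "Im k \<noteq> 0" for k
    by (rule zorder_jost_eq[OF assms(1-4) eq quadrants_cover[OF that]])
  have zero: "jost l r k = 0 \<longleftrightarrow> jost m s k = 0" for k
  proof (cases "Re k \<noteq> 0 \<and> Im k \<noteq> 0")
    case True
    then show ?thesis unfolding R.jost_zorder_pos(1) S.jost_zorder_pos(1) by (simp add: z)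
  next
    case False
    then show ?thesis using R.jost_zero S.jost_zero by blast
  qed
  have zo: "zorder (jost l r) k = zorder (jost m s) k" if "jost m s k = 0" for k
    using z S.jost_zero[OF that] by blast
  obtain b where "\<And>k. jost l r k = exp (b * k) * jost m s k"
    using exp_type_same_zeros[OF R.exp_type_jost S.exp_type_jost R.jost_0 S.jost_0 zero zo] by blast
  then show ?thesis by (rule that)
qed

lemma same_listings_mult:
  assumes "tract l r r'" "tract m s s'" "0 < c" "0 < \<mu>"
  shows "poles_minus c \<mu> l r = poles_minus c \<mu> m s \<Longrightarrow> k \<in> quadrant4 \<Longrightarrow>
      pole_mult (lip_pressure c \<mu> l r) k = pole_mult (lip_pressure c \<mu> m s) k"
    "poles_plus c \<mu> l r = poles_plus c \<mu> m s \<Longrightarrow> k \<in> quadrant1 \<Longrightarrow>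
      pole_mult (lip_pressure c \<mu> l r) k = pole_mult (lip_pressure c \<mu> m s) k"
  using tract.pole_listing_exists[OF assms(1,3,4)] tract.pole_listing_exists[OF assms(2,3,4)]
    is_pole_listing_determines_mult unfolding poles_minus_def poles_plus_def by metis+

lemma determined_by_poles:
  assumes "tract l r r'" "tract m s s'" "0 < c" "0 < \<mu>"
    and "\<And>k. k \<in> quadrant1 \<union> quadrant4 \<Longrightarrow> pole_mult (lip_pressure c \<mu> l r) k = pole_mult (lip_pressure c \<mu> m s) k"
    and "l = m \<or> r l = s m"
  shows "l = m \<and> (\<forall>x\<in>{0..l}. r x = s x)"
proof -
  obtain b where "\<And>k. jost l r k = exp (b * k) * jost m s k"
    using same_poles_jost_ratio[OF assms(1-5)] by blast
  from jost_ratio_unique[OF assms(1,2) this assms(6)] show ?thesis .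
qed

text \<open>The ratio of the two pressures at the lips is \<open>cross_term l r m s / cross_term m s l r\<close>.\<close>

definition cross_term :: "real \<Rightarrow> (real \<Rightarrow> real) \<Rightarrow> real \<Rightarrow> (real \<Rightarrow> real) \<Rightarrow> complex \<Rightarrow> complex" where
  "cross_term l r m s k = imp_fun (of_real (r l) * k) / of_real ((r l)\<^sup>2) * jost m s k"

section \<open>Comparison of two pressures\<close>

lemma exp_type_cross_term:
  assumes "tract l r r'" "tract m s s'"
  shows "exp_type (cross_term l r m s)"
proof -
  have "exp_type (\<lambda>k. (1 / of_real ((r l)\<^sup>2) * imp_fun (of_real (r l) * k)) * jost m s k)"
    by (rule exp_type_mult[OF exp_type_mult[OF exp_type_const exp_type_scale[OF exp_type_imp_fun]] tract.exp_type_jost[OF assms(2)]])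
  then show ?thesis by (simp add: cross_term_def[abs_def])
qed

lemma pressure_quot_real_pos:
  assumes "tract l r r'" "0 < t"
  shows "lip_pressure c \<mu> l r (of_real t) = pressure_quot c \<mu> l r (of_real t)"
    "imp_fun (of_real (r l) * of_real t) \<noteq> 0" "jost l r (of_real t) \<noteq> 0"
proof -
  interpret R: tract l r r' by fact
  show j: "jost l r (of_real t) \<noteq> 0" using R.jost_real_nonzero by simp
  then show "lip_pressure c \<mu> l r (of_real t) = pressure_quot c \<mu> l r (of_real t)" by (rule R.lip_pressure_at)
  have "0 < Re (imp_fun (of_real (r l) * of_real t))" using R.r_l_pos assms(2) by (intro Re_imp_fun_pos) auto
  then show "imp_fun (of_real (r l) * of_real t) \<noteq> 0" by auto
qed

lemma pressure_quot_ratio: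
  assumes "tract l r r'" "tract m s s'" "jost l r k \<noteq> 0" "jost m s k \<noteq> 0"
  shows "pressure_quot c \<mu> l r k * (jost l r k * jost m s k) = of_real (c * \<mu> / pi) * cross_term l r m s k"
    "pressure_quot c \<mu> m s k * (jost l r k * jost m s k) = of_real (c * \<mu> / pi) * cross_term m s l r k"
  using assms(3,4) by (simp_all add: pressure_quot_def cross_term_def)

text \<open>Far down the imaginary axis the impedances stay between a positive constant and 1. The
  two sides therefore grow like the denominators, with rates m and l.\<close>

lemma length_le_of_cross_term:
  assumes "tract l r r'" "tract m s s'" and eq: "\<And>k. cross_term l r m s k = cross_term m s l r k"
  shows "m \<le> l"
proof -
  interpret R: tract l r r' by fact
  interpret S: tract m s s' by fact
  obtain K A where R: "\<And>t. K \<le> t \<Longrightarrow> Re (jost l r (- \<i> * of_real t)) \<le> A * exp (l * t)" and K: "0 < A"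
    by (rule R.jost_imag_bounds) (rule that; assumption)
  obtain K' c where S: "\<And>t. K' \<le> t \<Longrightarrow> c * exp (m * t) \<le> Re (jost m s (- \<i> * of_real t))" and K': "0 < c"
    by (rule S.jost_imag_bounds) (rule that; assumption)
  \<comment> \<open>The impedance at k = - i. By monotonicity it is a lower bound at - i t for all t
    >= 1, hence the 1 in the threshold below.\<close>
  define q where "q = - imp_real (- r l)"
  have q: "0 < q" using imp_real_neg[of "- r l"] R.r_l_pos by (simp add: q_def)
  show ?thesis
  proof (rule exp_growth_compare)
    show "0 < q / (r l)\<^sup>2 * c" using q K' R.r_l_pos by simp
    fix t assume "max 1 (max K K') \<le> t"
    then have t: "1 \<le> t" "K \<le> t" "K' \<le> t" by auto
    have im: "imp_fun (of_real a * (- \<i> * of_real t)) = of_real (- imp_real (- (a * t)))" for a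
      using imp_fun_imag[of "- (a * t)"] by (simp add: mult_ac)
    have J: "jost l r (- \<i> * of_real t) = of_real (Re (jost l r (- \<i> * of_real t)))" "1 \<le> Re (jost l r (- \<i> * of_real t))"
      "jost m s (- \<i> * of_real t) = of_real (Re (jost m s (- \<i> * of_real t)))" "1 \<le> Re (jost m s (- \<i> * of_real t))"
      using R.jost_imag_ge[of "- t"] S.jost_imag_ge[of "- t"] by (auto simp: complex_eq_iff)
    have "complex_of_real (- imp_real (- (r l * t)) / (r l)\<^sup>2 * Re (jost m s (- \<i> * of_real t))) =
       of_real (- imp_real (- (s m * t)) / (s m)\<^sup>2 * Re (jost l r (- \<i> * of_real t)))"
      using eq[of "- \<i> * of_real t"] J(1,3) unfolding cross_term_def im by simp
    then have e: "- imp_real (- (r l * t)) / (r l)\<^sup>2 * Re (jost m s (- \<i> * of_real t)) =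
       - imp_real (- (s m * t)) / (s m)\<^sup>2 * Re (jost l r (- \<i> * of_real t))" by (simp only: of_real_eq_iff)
    have "r l * 1 \<le> r l * t" using t R.r_l_pos by (intro mult_left_mono) auto
    then have "q \<le> - imp_real (- (r l * t))" using imp_real_mono[of "- (r l * t)" "- r l"] by (simp add: q_def)
    then have "0 \<le> - imp_real (- (r l * t)) / (r l)\<^sup>2" "q / (r l)\<^sup>2 \<le> - imp_real (- (r l * t)) / (r l)\<^sup>2"
      using q by (intro divide_nonneg_nonneg divide_right_mono; simp)+
    then have "q / (r l)\<^sup>2 * (c * exp (m * t)) \<le> - imp_real (- (r l * t)) / (r l)\<^sup>2 * Re (jost m s (- \<i> * of_real t))"
      using S[OF t(3)] K' by (intro mult_mono) simp_all
    also have "\<dots> \<le> 1 / (s m)\<^sup>2 * (A * exp (l * t))"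
      unfolding e using imp_real_ge[of "- (s m * t)"] R[OF t(2)] J(2) by (intro mult_mono divide_right_mono) simp_all
    finally show "q / (r l)\<^sup>2 * c * exp (m * t) \<le> A / (s m)\<^sup>2 * exp (l * t)" by simp
  qed
qed

text \<open>The pressure on the positive axis fixes the meromorphic function and with it the poles.
  These still leave an exponential factor open, so the length is extracted separately from the
  equality of the cross terms.\<close>

lemma data1_determines:
  assumes "tract l r r'" "tract m s s'" "0 < c" "0 < \<mu>" and D: "data1 c \<mu> l r = data1 c \<mu> m s"
  shows "l = m \<and> (\<forall>x\<in>{0..l}. r x = s x)"
proof -
  interpret R: tract l r r' by fact
  interpret S: tract m s s' by fact
  have cm: "complex_of_real (c * \<mu> / pi) \<noteq> 0" using assms(3,4) by simp
  have ct: "cross_term l r m s k = cross_term m s l r k" for k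
  proof (rule entire_eq_on_pos_reals[OF exp_type_holo[OF exp_type_cross_term[OF assms(1,2)]]
        exp_type_holo[OF exp_type_cross_term[OF assms(2,1)]]])
    fix t :: real assume t: "0 < t"
    have "data1 c \<mu> l r t = data1 c \<mu> m s t" using D by simp
    then have "pressure_quot c \<mu> l r (of_real t) = pressure_quot c \<mu> m s (of_real t)"
      using t pressure_quot_real_pos(1)[OF assms(1) t] pressure_quot_real_pos(1)[OF assms(2) t] by (simp add: data1_def)
    then show "cross_term l r m s (of_real t) = cross_term m s l r (of_real t)"
      using pressure_quot_ratio[OF assms(1,2) pressure_quot_real_pos(3)[OF assms(1) t] pressure_quot_real_pos(3)[OF assms(2) t], of c \<mu>] cm
      by (metis mult_left_cancel)
  qed
  have "lip_pressure c \<mu> l r = lip_pressure c \<mu> m s"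
    unfolding R.lip_pressure_eq S.lip_pressure_eq
  proof (rule ext, rule remove_sings_cong[OF _ refl])
    fix a
    show "\<forall>\<^sub>F k in at a. pressure_quot c \<mu> l r k = pressure_quot c \<mu> m s k"
      using R.jost_eventually_nonzero[of a] S.jost_eventually_nonzero[of a]
    proof eventually_elim
      case (elim k)
      then have "pressure_quot c \<mu> l r k * (jost l r k * jost m s k) = pressure_quot c \<mu> m s k * (jost l r k * jost m s k)"
        using pressure_quot_ratio[OF assms(1,2) elim, of c \<mu>] ct[of k] by simp
      then show ?case using elim by simp
    qed
  qed
  moreover have "m \<le> l" by (rule length_le_of_cross_term[OF assms(1,2) ct])
  moreover have "l \<le> m" by (rule length_le_of_cross_term[OF assms(2,1) ct[symmetric]])
  ultimately show ?thesis by (intro determined_by_poles[OF assms(1-4)]) auto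
qed

text \<open>Splitting off the simple zero at the origin leaves a cofactor that can be normalised to
  1 at 0, as \<open>exp_type_quotient\<close> demands.\<close>

lemma imp_fun_factor:
  obtains \<zeta> where "exp_type \<zeta>" "\<And>w. imp_fun w = w * \<zeta> w" "\<zeta> 0 \<noteq> 0"
proof -
  define \<zeta> where "\<zeta> = (\<lambda>w. if w = 0 then deriv imp_fun 0 else (imp_fun w - imp_fun 0) / (w - 0))"
  have h: "\<zeta> holomorphic_on UNIV"
    unfolding \<zeta>_def by (rule pole_lemma[OF imp_fun_holomorphic]) simp
  have f: "imp_fun w = w * \<zeta> w" for w by (simp add: \<zeta>_def imp_fun_0)
  obtain A B where AB: "1 \<le> A" "0 \<le> B" "\<And>k. cmod (imp_fun k) \<le> A * exp (B * cmod k)"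
    using exp_type_bound[OF exp_type_imp_fun] by metis
  have "bounded (\<zeta> ` cball 0 1)"
    by (intro compact_imp_bounded compact_continuous_image continuous_on_subset[OF holomorphic_on_imp_continuous_on[OF h]]) auto
  then obtain C where C: "0 < C" "\<And>w. cmod w \<le> 1 \<Longrightarrow> cmod (\<zeta> w) \<le> C"
    unfolding bounded_pos by auto
  have "cmod (\<zeta> w) \<le> (A + C) * exp (B * cmod w)" for w
  proof (cases "cmod w \<le> 1")
    case True
    have "C * 1 \<le> (A + C) * exp (B * cmod w)" using AB C by (intro mult_mono) auto
    then show ?thesis using C(2)[OF True] by linarith
  next
    case False
    have "cmod (\<zeta> w) * 1 \<le> cmod (\<zeta> w) * cmod w" using False by (intro mult_left_mono) auto
    also have "\<dots> = cmod (imp_fun w)" unfolding f[of w] norm_mult by simp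
    also have "\<dots> \<le> A * exp (B * cmod w)" by (rule AB(3))
    also have "\<dots> \<le> (A + C) * exp (B * cmod w)" using C by (intro mult_right_mono) auto
    finally show ?thesis by simp
  qed
  then have "exp_type \<zeta>" by (rule exp_typeI[OF h])
  then show ?thesis using that f deriv_imp_fun_0 by (simp add: \<zeta>_def)
qed

lemma zorder_cross_term:
  assumes "tract l r r'" "tract m s s'"
  shows "zorder (cross_term l r m s) k = zorder (\<lambda>k. imp_fun (of_real (r l) * k)) k + zorder (jost m s) k"
proof -
  interpret R: tract l r r' by fact
  interpret S: tract m s s' by fact
  let ?f = "\<lambda>k. 1 / of_real ((r l)\<^sup>2) * imp_fun (of_real (r l) * k)"
  have c: "cross_term l r m s = (\<lambda>k. ?f k * jost m s k)" by (simp add: cross_term_def fun_eq_iff)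
  have R0: "1 / complex_of_real ((r l)\<^sup>2) \<noteq> 0" using R.r_l_pos by simp
  have "\<forall>\<^sub>F w in at k. ?f w * jost m s w \<noteq> 0"
    using imp_fun_eventually_nonzero[OF R.r_l_pos, of k] S.jost_eventually_nonzero[of k]
    by eventually_elim (use R.r_l_pos in simp)
  then have "zorder (cross_term l r m s) k = zorder ?f k + zorder (jost m s) k"
    unfolding c by (intro zorder_times_analytic exp_type_analytic[OF S.exp_type_jost]
       exp_type_analytic[OF exp_type_mult[OF exp_type_const exp_type_scale[OF exp_type_imp_fun]]])
  also have "zorder ?f k = zorder (\<lambda>k. imp_fun (of_real (r l) * k)) k" by (rule zorder_cmult[OF R0])
  finally show ?thesis .
qed

lemma zorder_minus_arg:
  assumes "exp_type f" shows "zorder (\<lambda>k. f (- k)) a = zorder f (- a)"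
  using zorder_scale[OF analytic_on_imp_meromorphic_on[OF exp_type_analytic[OF assms]], of "-1" a] by simp

lemma data2_determines:
  assumes "tract l r r'" "tract m s s'" "0 < c" "0 < \<mu>" and D: "data2 c \<mu> l r = data2 c \<mu> m s"
  shows "l = m \<and> (\<forall>x\<in>{0..l}. r x = s x)"
proof -
  interpret R: tract l r r' by fact
  interpret S: tract m s s' by fact
  define N where "N = cross_term l r m s"
  define M where "M = cross_term m s l r"
  have exp: "exp_type N" "exp_type M"
    unfolding N_def M_def by (rule exp_type_cross_term[OF assms(1,2)] exp_type_cross_term[OF assms(2,1)])+
  have real_nz: "N (of_real t) \<noteq> 0" "M (of_real t) \<noteq> 0" if "0 < t" for t
    using pressure_quot_real_pos(2,3)[OF assms(1) that] pressure_quot_real_pos(2,3)[OF assms(2) that] R.r_l_pos S.r_l_pos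
    by (simp_all add: N_def M_def cross_term_def)
  have modulus: "cmod (N (of_real t)) = cmod (M (of_real t))" if t: "0 < t" for t
  proof -
    have "fst (data2 c \<mu> l r) t = fst (data2 c \<mu> m s) t" using D by simp
    then have "cmod (pressure_quot c \<mu> l r (of_real t)) = cmod (pressure_quot c \<mu> m s (of_real t))"
      using t pressure_quot_real_pos(1)[OF assms(1) t] pressure_quot_real_pos(1)[OF assms(2) t] by (simp add: data2_def)
    moreover note pressure_quot_ratio[OF assms(1,2) pressure_quot_real_pos(3)[OF assms(1) t] pressure_quot_real_pos(3)[OF assms(2) t], of c \<mu>]
    ultimately have "cmod (of_real (c * \<mu> / pi) * N (of_real t)) = cmod (of_real (c * \<mu> / pi) * M (of_real t))"
      unfolding N_def M_def by (metis norm_mult)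
    moreover have "cmod (of_real (c * \<mu> / pi)) \<noteq> 0" using assms(3,4) by simp
    ultimately show ?thesis unfolding norm_mult by (simp only: mult_cancel_left simp_thms)
  qed
  have refl: "N (- cnj k) = cnj (N k)" "M (- cnj k) = cnj (M k)" for k
  proof -
    have i: "imp_fun (of_real a * - cnj k) = cnj (imp_fun (of_real a * k))" for a
      using imp_fun_reflect[of "of_real a * k"] by simp
    show "N (- cnj k) = cnj (N k)" "M (- cnj k) = cnj (M k)"
      unfolding N_def M_def cross_term_def i R.jost_reflect S.jost_reflect by simp_all
  qed
  have holm: "(\<lambda>k. f (- k)) holomorphic_on UNIV" if "exp_type f" for f
    using exp_type_holo[OF exp_type_scale[OF that, of "-1"]] by simp
  \<comment> \<open>For real t the value at - t is the conjugate of the value at t. The squared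
    modulus is thus f(t) f(-t), and equality of moduli becomes an identity between entire
    functions.\<close>
  have prod: "N k * N (- k) = M k * M (- k)" for k
  proof (rule entire_eq_on_pos_reals[of "\<lambda>k. N k * N (- k)" "\<lambda>k. M k * M (- k)"])
    fix t :: real assume t: "0 < t"
    have "N (of_real t) * N (- of_real t) = of_real ((cmod (N (of_real t)))\<^sup>2)"
      using refl(1)[of "of_real t"] by (simp only: complex_cnj_complex_of_real complex_norm_square)
    moreover have "M (of_real t) * M (- of_real t) = of_real ((cmod (M (of_real t)))\<^sup>2)"
      using refl(2)[of "of_real t"] by (simp only: complex_cnj_complex_of_real complex_norm_square)
    ultimately show "N (of_real t) * N (- of_real t) = M (of_real t) * M (- of_real t)" using modulus[OF t] by simp
  qed (intro holomorphic_on_mult exp_type_holo exp holm)+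
  \<comment> \<open>In the closed lower half plane the impedance vanishes only at 0, to an order
    independent of the radius. The zeros of \<open>jost\<close> there are the poles in the fourth
    quadrant and their reflections.\<close>
  have low: "zorder N k = zorder M k" if k: "Im k \<le> 0" for k
  proof -
    have "zorder (\<lambda>k. imp_fun (of_real (r l) * k)) k = zorder (\<lambda>k. imp_fun (of_real (s m) * k)) k"
    proof (cases "k = 0")
      case True
      have "zorder (\<lambda>k. imp_fun (of_real a * k)) 0 = zorder imp_fun 0" if "0 < a" for a
        using zorder_scale[OF analytic_on_imp_meromorphic_on[OF exp_type_analytic[OF exp_type_imp_fun]], of "of_real a" 0] that
        by simp
      then show ?thesis using True R.r_l_pos S.r_l_pos by simp
    next
      case False
      have "zorder (\<lambda>k. imp_fun (of_real a * k)) k = 0" if a: "0 < a" for a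
      proof (rule zorder_eq_0I[OF exp_type_analytic[OF exp_type_scale[OF exp_type_imp_fun]]])
        have "0 < Re (imp_fun (of_real a * k))" using a k False by (intro Re_imp_fun_pos) (auto simp: mult_nonneg_nonpos)
        then show "imp_fun (of_real a * k) \<noteq> 0" by auto
      qed
      then show ?thesis using R.r_l_pos S.r_l_pos by simp
    qed
    moreover have "zorder (jost l r) k = zorder (jost m s) k"
    proof (cases "Re k \<noteq> 0 \<and> Im k \<noteq> 0")
      case True
      have "poles_minus c \<mu> l r = poles_minus c \<mu> m s" using D by (simp add: data2_def)
      note mult = same_listings_mult(1)[OF assms(1-4) this]
      show ?thesis
        by (rule zorder_jost_eq[OF assms(1-4) mult, of quadrant4]) (use True k in \<open>auto simp: quadrant4_def\<close>)
    next
      case False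
      then have "jost l r k \<noteq> 0" "jost m s k \<noteq> 0" using R.jost_zero S.jost_zero by blast+
      then show ?thesis
        by (simp add: zorder_eq_0I exp_type_analytic[OF R.exp_type_jost] exp_type_analytic[OF S.exp_type_jost])
    qed
    ultimately show ?thesis
      unfolding N_def M_def zorder_cross_term[OF assms(1,2)] zorder_cross_term[OF assms(2,1)] by simp
  qed
  have one: "N 1 \<noteq> 0" "M 1 \<noteq> 0" using real_nz[of 1] by simp_all
  have evN: "\<forall>\<^sub>F k in at a. N k \<noteq> 0" for a by (rule exp_type_eventually_nonzero[OF exp(1) one(1)])
  have evM: "\<forall>\<^sub>F k in at a. M k \<noteq> 0" for a by (rule exp_type_eventually_nonzero[OF exp(2) one(2)])
  \<comment> \<open>In the upper half plane, subtract the orders at - k, already known to agree,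
    from those in the product identity.\<close>
  have zo: "zorder N k = zorder M k" for k
  proof (cases "Im k \<le> 0")
    case False
    have sum: "zorder (\<lambda>k. f k * f (- k)) k = zorder f k + zorder f (- k)" if f: "exp_type f" "f 1 \<noteq> 0" for f
    proof -
      have e: "exp_type (\<lambda>k. f (- k))" using exp_type_scale[OF f(1), of "-1"] by simp
      have "\<forall>\<^sub>F w in at k. f w \<noteq> 0" "\<forall>\<^sub>F w in at k. f (- w) \<noteq> 0"
        using exp_type_eventually_nonzero[OF f] exp_type_eventually_nonzero[OF e, of "-1"] f(2) by simp_all
      then have "\<forall>\<^sub>F w in at k. f w * f (- w) \<noteq> 0" by eventually_elim simp
      from zorder_times_analytic[OF exp_type_analytic[OF f(1)] exp_type_analytic[OF e] this]
      show ?thesis using zorder_minus_arg[OF f(1)] by simp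
    qed
    have "zorder N k + zorder N (- k) = zorder M k + zorder M (- k)"
      using sum[OF exp(1) one(1)] sum[OF exp(2) one(2)] prod by simp
    moreover have "zorder N (- k) = zorder M (- k)" using False by (intro low) simp
    ultimately show ?thesis by simp
  qed (rule low)
  have zero: "M k = 0 \<longleftrightarrow> N k = 0" for k
    using zo[of k] zorder_pos_iff'[OF exp_type_analytic[OF exp(1)] eventually_frequently[OF _ evN[of k]]]
      zorder_pos_iff'[OF exp_type_analytic[OF exp(2)] eventually_frequently[OF _ evM[of k]]] by simp
  obtain h where h: "h holomorphic_on UNIV" "\<And>z. h z \<noteq> 0" "\<And>z. N z = h z * M z"
    using holomorphic_zorder_factorization[OF exp_type_holo[OF exp(1)] open_UNIV connected_UNIV
      exp_type_holo[OF exp(2)] zero zo[symmetric]] by (metis UNIV_I)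
  obtain \<zeta> where \<zeta>: "exp_type \<zeta>" "\<And>w. imp_fun w = w * \<zeta> w" "\<zeta> 0 \<noteq> 0"
    by (rule imp_fun_factor) (rule that; assumption)
  \<comment> \<open>\<open>n\<close> and \<open>g\<close> are \<open>N\<close> and \<open>M\<close>
    divided by the common factor k \<zeta>(0) / s(m), which makes \<open>g\<close> equal to 1 at the
    origin.\<close>
  define n where "n k = of_real (s m / r l) / \<zeta> 0 * (\<zeta> (of_real (r l) * k) * jost m s k)" for k
  define g where "g k = 1 / \<zeta> 0 * (\<zeta> (of_real (s m) * k) * jost l r k)" for k
  have rs: "complex_of_real (r l) \<noteq> 0" "complex_of_real (s m) \<noteq> 0" using R.r_l_pos S.r_l_pos by auto
  have n: "n k * (k * \<zeta> 0 / of_real (s m)) = N k" for k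
    using rs \<zeta>(3) by (simp add: n_def N_def cross_term_def \<zeta>(2)[of "of_real (r l) * k"] power2_eq_square)
  have g: "g k * (k * \<zeta> 0 / of_real (s m)) = M k" for k
    using rs \<zeta>(3) by (simp add: g_def M_def cross_term_def \<zeta>(2)[of "of_real (s m) * k"] power2_eq_square)
  have en: "exp_type n" unfolding n_def[abs_def]
    by (rule exp_type_mult[OF exp_type_const exp_type_mult[OF exp_type_scale[OF \<zeta>(1)] S.exp_type_jost]])
  have eg: "exp_type g" unfolding g_def[abs_def]
    by (rule exp_type_mult[OF exp_type_const exp_type_mult[OF exp_type_scale[OF \<zeta>(1)] R.exp_type_jost]])
  have g0: "g 0 = 1" using \<zeta>(3) by (simp add: g_def R.jost_0)
  have nhg: "n k = h k * g k" for k
  proof (rule entire_eq_on_pos_reals[of n "\<lambda>k. h k * g k"])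
    fix t :: real assume t: "0 < t"
    define u where "u = of_real t * \<zeta> 0 / complex_of_real (s m)"
    have u: "u \<noteq> 0" using t \<zeta>(3) rs by (simp add: u_def)
    have "n (of_real t) * u = h (of_real t) * g (of_real t) * u"
      using n[of "of_real t"] g[of "of_real t"] h(3)[of "of_real t"] unfolding u_def by (simp only: mult.assoc)
    then show "n (of_real t) = h (of_real t) * g (of_real t)" using u by simp
  qed (intro holomorphic_on_mult exp_type_holo en eg h)+
  have "exp_type h" by (rule exp_type_quotient[OF en eg g0 h(1) nhg])
  then obtain b where b: "\<And>k. h k = h 0 * exp (b * k)" by (rule exp_type_zero_free[OF _ h(2)]) (rule that)
  have h0: "h 0 = of_real (s m / r l)" using nhg[of 0] g0 \<zeta>(3) by (simp add: n_def S.jost_0)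
  \<comment> \<open>The quotient h has modulus 1 on the positive axis. Its modulus at t is (s(m) /
    r(l)) exp (Re b t), so comparing t = 1 with t = 2 gives Re b = 0, and then the lip radii
    agree.\<close>
  have h1: "s m / r l * exp (Re b * t) = 1" if t: "0 < t" for t
  proof -
    have "cmod (h (of_real t)) = 1"
      using h(3)[of "of_real t"] modulus[OF t] real_nz(2)[OF t] by (simp add: norm_mult)
    moreover have "cmod (of_real (s m / r l)) = s m / r l"
      unfolding norm_of_real using R.r_l_pos S.r_l_pos by (intro abs_of_pos) simp
    then have "cmod (h (of_real t)) = s m / r l * exp (Re b * t)"
      unfolding b[of "of_real t"] h0 norm_mult by simp
    ultimately show ?thesis by (rule trans[OF sym, rotated -1])
  qed
  have "exp (Re b * 1) = exp (Re b * 2)"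
    using h1[of 1] h1[of 2] R.r_l_pos S.r_l_pos by (metis mult_left_cancel mult_zero_left zero_less_numeral zero_less_one zero_neq_one)
  then have "Re b = 0" by simp
  then have rho: "r l = s m" using h1[of 1] R.r_l_pos by simp
  have "jost m s k = exp (b * k) * jost l r k" for k
  proof (rule entire_eq_on_pos_reals[of "jost m s" "\<lambda>k. exp (b * k) * jost l r k"])
    fix t :: real assume t: "0 < t"
    have "N (of_real t) = exp (b * of_real t) * M (of_real t)"
      using h(3)[of "of_real t"] b[of "of_real t"] h0 rho S.r_l_pos by simp
    then show "jost m s (of_real t) = exp (b * of_real t) * jost l r (of_real t)"
      using pressure_quot_real_pos(2)[OF assms(2) t] S.r_l_pos by (simp add: N_def M_def cross_term_def rho)
  qed (intro holomorphic_intros exp_type_holo R.exp_type_jost S.exp_type_jost)+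
  from jost_ratio_unique[OF assms(2,1) this] rho show ?thesis by auto
qed

lemma data_equiv_apply:
  assumes "data_equiv D D'" "D l r = D m s" "0 < l" "r \<in> radius_class l" "0 < m" "s \<in> radius_class m"
  shows "D' l r = D' m s"
  using assms unfolding data_equiv_def by blast

theorem theorem6p4:
  fixes c \<mu> l m :: real and r s :: "real \<Rightarrow> real"
    and D :: "real \<Rightarrow> (real \<Rightarrow> real) \<Rightarrow> 'd"
  assumes "0 < c" and "0 < \<mu>"
    and "0 < l" and "r \<in> radius_class l"
    and "0 < m" and "s \<in> radius_class m"
    and "data1 c \<mu> l r = data1 c \<mu> m s \<or>
         data2 c \<mu> l r = data2 c \<mu> m s \<or>
         data3 c \<mu> l r = data3 c \<mu> m s \<or>
         data4 c \<mu> l r = data4 c \<mu> m s \<or>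
         data5 c \<mu> l r = data5 c \<mu> m s \<or>
         data6 c \<mu> l r = data6 c \<mu> m s \<or>
         ((data_equiv D (data1 c \<mu>) \<or> data_equiv D (data2 c \<mu>) \<or> data_equiv D (data3 c \<mu>) \<or>
           data_equiv D (data4 c \<mu>) \<or> data_equiv D (data5 c \<mu>) \<or> data_equiv D (data6 c \<mu>)) \<and>
          D l r = D m s)"
  shows "l = m \<and> (\<forall>x\<in>{0..l}. r x = s x)"
proof -
  obtain r' where R: "tract l r r'" using radius_class_tract assms(3,4) by blast
  obtain s' where S: "tract m s s'" using radius_class_tract assms(5,6) by blast
  have listings: ?thesis if "poles_minus c \<mu> l r = poles_minus c \<mu> m s" "poles_plus c \<mu> l r = poles_plus c \<mu> m s" "l = m \<or> r l = s m"
    by (rule determined_by_poles[OF R S assms(1,2) _ that(3)])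
       (use same_listings_mult[OF R S assms(1,2)] that(1,2) in blast)
  have products: ?thesis if "E_fun c \<mu> l r = E_fun c \<mu> m s" "l = m \<or> r l = s m"
  proof (rule determined_by_poles[OF R S assms(1,2) _ that(2)])
    fix k assume "k \<in> quadrant1 \<union> quadrant4"
    then show "pole_mult (lip_pressure c \<mu> l r) k = pole_mult (lip_pressure c \<mu> m s) k"
      using tract.zorder_E_fun[OF R assms(1,2), of k] tract.zorder_E_fun[OF S assms(1,2), of k] that(1) by simp
  qed
  have sets: "?thesis" if "data1 c \<mu> l r = data1 c \<mu> m s \<or> data2 c \<mu> l r = data2 c \<mu> m s \<or>
      data3 c \<mu> l r = data3 c \<mu> m s \<or> data4 c \<mu> l r = data4 c \<mu> m s \<or>
      data5 c \<mu> l r = data5 c \<mu> m s \<or> data6 c \<mu> l r = data6 c \<mu> m s"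
    using that data1_determines[OF R S assms(1,2)] data2_determines[OF R S assms(1,2)] listings products
    unfolding data3_def data4_def data5_def data6_def prod.inject by argo
  note equiv = data_equiv_apply[of D "data1 c \<mu>", OF _ _ assms(3-6)] data_equiv_apply[of D "data2 c \<mu>", OF _ _ assms(3-6)]
    data_equiv_apply[of D "data3 c \<mu>", OF _ _ assms(3-6)] data_equiv_apply[of D "data4 c \<mu>", OF _ _ assms(3-6)]
    data_equiv_apply[of D "data5 c \<mu>", OF _ _ assms(3-6)] data_equiv_apply[of D "data6 c \<mu>", OF _ _ assms(3-6)]
  show ?thesis using assms(7) equiv by (intro sets) argo
qed

end
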